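(* Let $U:\mathbb{R}\to(-\infty,\infty]$ be measurable with $U(x)=U(-x)$, $\inf_x U(x)>-\infty$, $0<\int e^{-U(x)}dx<\infty$, and suppose that either $U(x)<\infty$ for all $x$, or there is $0<K<\infty$ with $U(x)<\infty$ for $|x|<K$ and $U(x)=\infty$ for $|x|>K$. Then for every $0<\delta<1$ there exists $0<L<\infty$ such that for all $n\ge1$, $U$ has $(\delta,L)$-controlled gradients on $\mathbb{T}_n^2$.
   Context: For $n\ge1$, $\mathbb{T}_n^2$ is the discrete torus with vertex set $V(\mathbb{T}_n^2)=\{-n+1,\dots,n\}^2$, where $(a,b)$ and $(c,d)$ are adjacent if they agree in one coordinate and differ by exactly $1$ modulo $2n$ in the other; $E(\mathbb{T}_n^2)$ is its edge set and $\mathbf 0=(0,0)$. $\mu_{\mathbb{T}_n^2,\mathbf 0,U}$ is the probability measure on $\varphi:V(\mathbb{T}_n^2)\to\mathbb{R}$ with density $Z^{-1}\exp(-\sum_{(v,w)\in E(\mathbb{T}_n^2)}U(\varphi_v-\varphi_w))$ with respect to $\delta_0(d\varphi_{\mathbf 0})\prod_{v\ne\mathbf 0}d\varphi_v$. For $0<L<\infty$ and $0<\delta<1$, $U$ has $(\delta,L)$-controlled gradients on $\mathbb{T}_n^2$ if: (1) there is $K>L$ with $U(x)<\infty$ for $|x|<K$; and (2) if $\varphi\sim\mu_{\mathbb{T}_n^2,\mathbf 0,U}$ and $\mathcal{E}(\varphi,L):=\{(v,w)\in E(\mathbb{T}_n^2):|\varphi_v-\varphi_w|\ge L\}$, then $\mathbb{P}(e_1,\dots,e_k\in\mathcal{E}(\varphi,L))\le\delta^k$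 for all $k\ge1$ and all distinct $e_1,\dots,e_k\in E(\mathbb{T}_n^2)$. *)

theory Defs
  imports "HOL-Probability.Probability"
begin

definition torus_V :: "nat \<Rightarrow> (int \<times> int) set" where
  "torus_V n = {- int n + 1 .. int n} \<times> {- int n + 1 .. int n}"

definition diff_one_mod :: "nat \<Rightarrow> int \<Rightarrow> int \<Rightarrow> bool" where
  "diff_one_mod n x y \<longleftrightarrow> (x - y) mod (2 * int n) = 1 \<or> (y - x) mod (2 * int n) = 1"

definition torus_adj :: "nat \<Rightarrow> int \<times> int \<Rightarrow> int \<times> int \<Rightarrow> bool" where
  "torus_adj n v w \<longleftrightarrow> v \<in> torus_V n \<and> w \<in> torus_V n \<and>
     ((fst v = fst w \<and> diff_one_mod n (snd v) (snd w)) \<or>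
      (snd v = snd w \<and> diff_one_mod n (fst v) (fst w)))"

text \<open>Edge set E(T_n^2): each undirected edge is represented exactly once, as the
  ordered pair (v,w) with v lexicographically smaller than w.\<close>
definition torus_E :: "nat \<Rightarrow> ((int \<times> int) \<times> (int \<times> int)) set" where
  "torus_E n = {(v, w). torus_adj n v w \<and>
                  (fst v < fst w \<or> (fst v = fst w \<and> snd v < snd w))}"

definition exp_neg :: "ereal \<Rightarrow> ennreal" where
  "exp_neg x = (if x = \<infinity> then 0 else if x = -\<infinity> then \<infinity>
                else ennreal (exp (- real_of_ereal x)))"

definition hamiltonian :: "nat \<Rightarrow> (real \<Rightarrow> ereal) \<Rightarrow> (int \<times> int \<Rightarrow> real) \<Rightarrow> ereal" where
  "hamiltonian n U \<phi> = (\<Sum>(v, w)\<in>torus_E n. U (\<phi> v - \<phi> w))"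

definition ref_measure :: "nat \<Rightarrow> (int \<times> int \<Rightarrow> real) measure" where
  "ref_measure n = PiM (torus_V n) (\<lambda>v. if v = (0, 0) then return lborel 0 else lborel)"

definition partition_fn :: "nat \<Rightarrow> (real \<Rightarrow> ereal) \<Rightarrow> ennreal" where
  "partition_fn n U = (\<integral>\<^sup>+ \<phi>. exp_neg (hamiltonian n U \<phi>) \<partial>ref_measure n)"

definition gibbs_prob :: "nat \<Rightarrow> (real \<Rightarrow> ereal) \<Rightarrow> (int \<times> int \<Rightarrow> real) set \<Rightarrow> ennreal" where
  "gibbs_prob n U A =
     (\<integral>\<^sup>+ \<phi>. exp_neg (hamiltonian n U \<phi>) * indicator A \<phi> \<partial>ref_measure n) / partition_fn n U"

text \<open>(delta,L)-controlled gradients on T_n^2. Distinct edges e_1..e_k (k>=1) are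
  encoded as a finite nonempty set S of edges with card S = k. We also record that the
  Gibbs measure is well defined (0 < Z < \<infinity>), which the definition presupposes.\<close>
definition controlled_gradients :: "real \<Rightarrow> real \<Rightarrow> nat \<Rightarrow> (real \<Rightarrow> ereal) \<Rightarrow> bool" where
  "controlled_gradients \<delta> L n U \<longleftrightarrow>
     (\<exists>K>L. \<forall>x. \<bar>x\<bar> < K \<longrightarrow> U x < \<infinity>) \<and>
     0 < partition_fn n U \<and> partition_fn n U < \<infinity> \<and>
     (\<forall>S. S \<subseteq> torus_E n \<longrightarrow> S \<noteq> {} \<longrightarrow>
        gibbs_prob n U {\<phi>. \<forall>(v, w)\<in>S. \<bar>\<phi> v - \<phi> w\<bar> \<ge> L} \<le> ennreal (\<delta> ^ card S))"

end

theory Submission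
  imports Defs
begin

text \<open>
  The weight \<open>exp (- \<Sum> U)\<close> is reflection positive with respect to the axes of the torus that pass through
  vertices: given the heights on the axis, the two halves are independent, so Cauchy--Schwarz bounds the weight of
  an event by those of its two symmetrised versions. Applied to all vertical axes this chessboard argument spreads a set
  of large horizontal edges over full rows, and applied to all horizontal axes it spreads a family of full rows of one
  parity over all rows of that parity. Hence the probability that the edges of \<open>S\<close> are large is at most a power
  of the probability that all horizontal edges in the rows of one parity are large, with exponent proportional to
  \<open>card S / n\<^sup>2\<close>. The latter probability is at most \<open>(C \<tau>)^(n\<^sup>2)\<close>, where \<open>\<tau>\<close> is the mass of
  \<open>exp (- U)\<close> beyond \<open>L\<close>: bound the numerator by integrating along a spanning tree, and the partition function from below
  by choosing the heights one after the other in a small interval while avoiding a set of small measure.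
  Finally \<open>\<tau>\<close> becomes arbitrarily small as \<open>L\<close> approaches the edge of the region where \<open>U\<close> is finite.
  Every edge is used in both orientations with weight \<open>exp (- U / 2)\<close>, which makes edge sets stable under reflections.
\<close>

text \<open>With axes through vertices no edge joins the two open halves, so reflection positivity
  asks for no convexity of \<open>U\<close>. The price is parity: \<open>x -> 2 * j - x\<close>
  preserves the parity of a column. Horizontal edges sit in the gaps between columns, where
  mirroring acts as \<open>i -> 2 * j - 1 - i\<close> and reaches every gap; edges along a column
  reach only columns of the same parity. Hence \<open>S\<close> is split into four classes, by
  direction and by parity of the line carrying the edge, and some class \<open>C\<close> holds at
  least a quarter of it. The two spreadings cost the exponent \<open>(2 * n)^2\<close> and return
  \<open>2 * card C\<close>, because a column switches on the two gaps beside it. If full columns of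
  one parity have probability at most \<open>\<kappa>^(n * n)\<close>, then \<open>C\<close> has
  probability at most \<open>\<kappa>^(card C / 2)\<close>. With
  \<open>\<kappa> \<le> \<delta>^8\<close> this is at most \<open>\<delta>^(4 * card C)\<close>,
  hence at most \<open>\<delta>^(card S)\<close>. A further obstacle is \<open>n = 1\<close>, where
  both gaps of a row are the same edge. Reflected edge sets are therefore compared by inclusion
  only, which is enough because larger edge sets have smaller mass.\<close>

section \<open>The chessboard estimate in one dimension\<close>

text \<open>Index \<open>i\<close> stands for the gap between the columns \<open>i\<close> and
  \<open>i + 1\<close>, and \<open>j\<close> for an axis through column \<open>j\<close>. The first
  branch of the conditional covers the \<open>n\<close> gaps that start at the axis.\<close>

definition refl_left :: "nat \<Rightarrow> int \<Rightarrow> (int \<Rightarrow> 'a) \<Rightarrow> int \<Rightarrow> 'a" where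
  "refl_left n j c = (\<lambda>i. if (i - j) mod (2 * int n) < int n then c i else c (2 * j - 1 - i))"

definition refl_right :: "nat \<Rightarrow> int \<Rightarrow> (int \<Rightarrow> 'a) \<Rightarrow> int \<Rightarrow> 'a" where
  "refl_right n j c = (\<lambda>i. if (i - j) mod (2 * int n) < int n then c (2 * j - 1 - i) else c i)"

text \<open>Words on a cycle of length \<open>2 * n\<close>, kept as periodic functions on all
  integers so that reflected indices need no reduction.\<close>

definition periodic_words :: "nat \<Rightarrow> 'a set \<Rightarrow> (int \<Rightarrow> 'a) set" where
  "periodic_words n A = {c. (\<forall>i. c (i + 2 * int n) = c i) \<and> range c \<subseteq> A}"

lemma periodic_add_mult:
  fixes c :: "int \<Rightarrow> 'a"
  assumes "\<And>i. c (i + N) = c i"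
  shows "c (i + N * k) = c i"
proof (induction k rule: int_induct[where k = 0])
  case base
  then show ?case by simp
next
  case (step1 k)
  have "c (i + N * (k + 1)) = c ((i + N * k) + N)" by (simp add: algebra_simps)
  then show ?case using step1 assms by metis
next
  case (step2 k)
  have "c (i + N * (k - 1) + N) = c (i + N * k)" by (simp add: algebra_simps)
  then show ?case using step2 assms by metis
qed

lemma periodic_cong:
  fixes c :: "int \<Rightarrow> 'a"
  assumes "\<And>i. c (i + N) = c i" and "x mod N = y mod N"
  shows "c x = c y"
proof -
  from assms(2) obtain k where "x = y + N * k"
    by (metis mod_eqE add.commute diff_add_cancel)
  then show ?thesis using periodic_add_mult[where c = c, OF assms(1)] by simp
qed

lemma periodic_mod:
  fixes c :: "int \<Rightarrow> 'a"
  assumes "\<And>i. c (i + N) = c i"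
  shows "c (x mod N) = c x"
  by (rule periodic_cong[where c = c, OF assms]) simp

lemma finite_periodic_words:
  assumes "n \<ge> 1" "finite A"
  shows "finite (periodic_words n A)"
proof -
  let ?I = "{0..<2 * int n}"
  have "inj_on (\<lambda>c. restrict c ?I) (periodic_words n A)"
  proof (rule inj_onI, rule ext)
    fix c d :: "int \<Rightarrow> 'a" and x
    assume c: "c \<in> periodic_words n A" and d: "d \<in> periodic_words n A"
      and eq: "restrict c ?I = restrict d ?I"
    have x: "x mod (2 * int n) \<in> ?I" using assms by simp
    have "c x = c (x mod (2 * int n))"
      using c by (intro periodic_mod[symmetric]) (auto simp: periodic_words_def)
    also have "\<dots> = d (x mod (2 * int n))"
      using fun_cong[OF eq, of "x mod (2 * int n)"] x by simp
    also have "\<dots> = d x"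
      using d by (intro periodic_mod) (auto simp: periodic_words_def)
    finally show "c x = d x" .
  qed
  moreover have "(\<lambda>c. restrict c ?I) ` periodic_words n A \<subseteq> PiE ?I (\<lambda>_. A)"
    by (auto simp: periodic_words_def)
  ultimately show ?thesis
    using assms by (meson finite_PiE finite_atLeastLessThan_int finite_imageD finite_subset)
qed

lemma refl_in_periodic_words:
  assumes "n \<ge> 1" "c \<in> periodic_words n A"
  shows "refl_left n j c \<in> periodic_words n A" "refl_right n j c \<in> periodic_words n A"
proof -
  have p: "c (i + 2 * int n) = c i" for i using assms by (auto simp: periodic_words_def)
  have a: "c (2 * j - 1 - (i + 2 * int n)) = c (2 * j - 1 - i)" for i
    using p[of "2 * j - 1 - (i + 2 * int n)"] by (simp add: algebra_simps)
  have b: "(i + 2 * int n - j) mod (2 * int n) = (i - j) mod (2 * int n)" for i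
    by (metis add_diff_eq diff_add_eq mod_add_self2)
  show "refl_left n j c \<in> periodic_words n A" "refl_right n j c \<in> periodic_words n A"
    using assms p by (auto simp: periodic_words_def refl_left_def refl_right_def a b)
qed

lemma bij_betw_mod_reflect:
  fixes N a :: int
  assumes "N > 0"
  shows "bij_betw (\<lambda>i. (a - i) mod N) {0..<N} {0..<N}"
proof (rule bij_betw_byWitness[where f' = "\<lambda>i. (a - i) mod N"])
  have *: "(a - (a - i) mod N) mod N = i" if "i \<in> {0..<N}" for i
  proof -
    have "(a - (a - i) mod N) mod N = (a - (a - i)) mod N" by (rule mod_diff_right_eq)
    then show ?thesis using that by simp
  qed
  then show "\<forall>i\<in>{0..<N}. (a - (a - i) mod N) mod N = i" "\<forall>i\<in>{0..<N}. (a - (a - i) mod N) mod N = i"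
    by auto
  show "(\<lambda>i. (a - i) mod N) ` {0..<N} \<subseteq> {0..<N}" "(\<lambda>i. (a - i) mod N) ` {0..<N} \<subseteq> {0..<N}"
    using assms by auto
qed

text \<open>At every index one of the two words carries \<open>c i\<close> and the other the
  mirrored letter, and mirroring permutes the indices of a period.\<close>

lemma sum_refl_left_right:
  fixes g :: "'a \<Rightarrow> real"
  assumes "n \<ge> 1" "c \<in> periodic_words n A"
  shows "(\<Sum>i\<in>{0..<2 * int n}. g (refl_left n j c i)) + (\<Sum>i\<in>{0..<2 * int n}. g (refl_right n j c i))
         = 2 * (\<Sum>i\<in>{0..<2 * int n}. g (c i))"
proof -
  have p: "c (i + 2 * int n) = c i" for i using assms by (auto simp: periodic_words_def)
  have "(\<Sum>i\<in>{0..<2 * int n}. g (refl_left n j c i)) + (\<Sum>i\<in>{0..<2 * int n}. g (refl_right n j c i))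
     = (\<Sum>i\<in>{0..<2 * int n}. g (c i)) + (\<Sum>i\<in>{0..<2 * int n}. g (c (2 * j - 1 - i)))"
    unfolding sum.distrib[symmetric] by (rule sum.cong) (auto simp: refl_left_def refl_right_def)
  moreover have "(\<Sum>i\<in>{0..<2 * int n}. g (c (2 * j - 1 - i)))
      = (\<Sum>i\<in>{0..<2 * int n}. g (c ((2 * j - 1 - i) mod (2 * int n))))"
    by (simp add: periodic_mod[where c = c, OF p])
  moreover have "\<dots> = (\<Sum>i\<in>{0..<2 * int n}. g (c i))"
    by (rule sum.reindex_bij_betw[OF bij_betw_mod_reflect, where g = "\<lambda>i. g (c i)"]) (use assms in auto)
  ultimately show ?thesis by simp
qed

text \<open>Maximum principle: reflection positivity bounds \<open>F\<close> at a word by its mean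
  over the two reflected words, so maximisers reflect to maximisers. Starting from any maximiser,
  reflections lead to a constant word, where \<open>F\<close> is \<open>0\<close>.\<close>

lemma chessboard_positive:
  fixes Phi :: "(int \<Rightarrow> 'a) \<Rightarrow> real"
  assumes n: "n \<ge> 1" and A: "finite A" and pos: "\<And>c. 0 < Phi c"
    and rp: "\<And>c j. c \<in> periodic_words n A \<Longrightarrow>
               (Phi c)\<^sup>2 \<le> Phi (refl_left n j c) * Phi (refl_right n j c)"
    and c: "c \<in> periodic_words n A"
  shows "Phi c ^ (2 * n) \<le> (\<Prod>i\<in>{0..<2 * int n}. Phi (\<lambda>_. c i))"
proof -
  define I where "I = {0..<2 * int n}"
  have cI: "card I = 2 * n" and fI: "finite I" by (auto simp: I_def)
  define g where "g = (\<lambda>a. ln (Phi (\<lambda>_::int. a)))"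
  \<comment> \<open>The sum is what the claimed estimate allows, and \<open>2 * real n\<close> is
    the number of letters, so \<open>F\<close> vanishes on constant words. The claim is that
    \<open>F\<close> is nowhere positive.\<close>
  define F where "F = (\<lambda>c. 2 * real n * ln (Phi c) - (\<Sum>i\<in>I. g (c i)))"
  have F2: "2 * F d \<le> F (refl_left n j d) + F (refl_right n j d)" if d: "d \<in> periodic_words n A" for d j
  proof -
    have "ln ((Phi d)\<^sup>2) \<le> ln (Phi (refl_left n j d) * Phi (refl_right n j d))"
      using rp[OF d, of j] pos[of d] pos[of "refl_left n j d"] pos[of "refl_right n j d"]
      by (subst ln_le_cancel_iff) auto
    then have "2 * ln (Phi d) \<le> ln (Phi (refl_left n j d)) + ln (Phi (refl_right n j d))"
      using pos[of d] pos[of "refl_left n j d"] pos[of "refl_right n j d"]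
      by (simp add: ln_realpow ln_mult)
    from mult_left_mono[OF this, of "2 * real n"]
    have "4 * real n * ln (Phi d) \<le> 2 * real n * ln (Phi (refl_left n j d)) + 2 * real n * ln (Phi (refl_right n j d))"
      by (simp add: algebra_simps)
    with sum_refl_left_right[OF n d, of g j] show ?thesis
      by (simp add: F_def I_def)
  qed
  have finP: "finite (periodic_words n A)" by (rule finite_periodic_words[OF n A])
  define M where "M = Max (F ` periodic_words n A)"
  have le_M: "F d \<le> M" if "d \<in> periodic_words n A" for d
    using finP that by (simp add: M_def)
  define Q where "Q = {d \<in> periodic_words n A. F d = M}"
  have "M \<in> F ` periodic_words n A"
    unfolding M_def using finP c by (intro Max_in) auto
  then obtain d0 where d0: "d0 \<in> Q" by (auto simp: Q_def)
  \<comment> \<open>Neither reflected value exceeds \<open>M\<close>, and together they are at least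
    \<open>2 * M\<close>, so both equal \<open>M\<close>.\<close>
  have Q_right: "refl_right n j d \<in> Q" if "d \<in> Q" for d j
  proof -
    from that have d: "d \<in> periodic_words n A" "F d = M" by (auto simp: Q_def)
    note r = refl_in_periodic_words[OF n d(1), of j]
    show ?thesis using F2[OF d(1), of j] le_M[OF r(1)] le_M[OF r(2)] d(2) r(2) by (auto simp: Q_def)
  qed
  \<comment> \<open>The maximisers of \<open>F\<close> are closed under reflection, and reflecting at the end of a constant run
    prolongs the run.\<close>
  have run: "\<exists>d\<in>Q. \<exists>s. \<forall>i\<in>{s..<s + int r}. d i = d0 0" if "1 \<le> r" "r \<le> n" for r
    using that
  proof (induction r rule: dec_induct)
    case base
    have "i = 0" if "i \<in> {0..<0 + int 1}" for i using that by auto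
    then have "\<forall>i\<in>{0..<0 + int 1}. d0 i = d0 0" by blast
    then show ?case using d0 by blast
  next
    case (step r)
    then obtain d s where d: "d \<in> Q" and s: "\<And>i. s \<le> i \<Longrightarrow> i < s + int r \<Longrightarrow> d i = d0 0" by force
    \<comment> \<open>The axis sits just behind the run: the letter at \<open>s + int r\<close>
      becomes a copy of the last letter of the run, while the run itself has offset at least
      \<open>int n\<close> and is kept.\<close>
    have "refl_right n (s + int r) d i = d0 0" if i: "s \<le> i" "i < s + int (Suc r)" for i
    proof (cases "i = s + int r")
      case True
      then show ?thesis using step by (simp add: refl_right_def s)
    next
      case False
      have "(i - (s + int r)) mod (2 * int n) = i - (s + int r) + 2 * int n"
        using False i step by (intro int_mod_pos_eq[where q = "-1"]) auto
      then show ?thesis using False i step by (auto simp: refl_right_def s)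
    qed
    then show ?case using Q_right[OF d, of "s + int r"] by (intro bexI exI[of _ s]) auto
  qed
  \<comment> \<open>A run over half a period is copied to the other half by one more reflection,
    which yields a constant maximiser.\<close>
  from run[of n] n obtain d s where d: "d \<in> Q" and s: "\<And>i. s \<le> i \<Longrightarrow> i < s + int n \<Longrightarrow> d i = d0 0" by force
  have dp: "d (i + 2 * int n) = d i" for i using d by (auto simp: Q_def periodic_words_def)
  have "refl_right n (s + int n) d i = d0 0" for i
  proof -
    define m where "m = (i - (s + int n)) mod (2 * int n)"
    have m: "0 \<le> m" "m < 2 * int n" using n by (auto simp: m_def)
    show ?thesis
    proof (cases "m < int n")
      case True
      have "d (2 * (s + int n) - 1 - i) = d (s + int n - 1 - m)"
      proof (rule periodic_cong[where c = d, OF dp])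
        have "(s + int n - 1 - m) mod (2 * int n) = (s + int n - 1 - (i - (s + int n))) mod (2 * int n)"
          unfolding m_def by (rule mod_diff_right_eq)
        then show "(2 * (s + int n) - 1 - i) mod (2 * int n) = (s + int n - 1 - m) mod (2 * int n)"
          by (simp add: algebra_simps)
      qed
      then show ?thesis using True m by (simp add: refl_right_def m_def[symmetric] s)
    next
      case False
      have "d i = d (s + int n + m - 2 * int n)"
      proof (rule periodic_cong[where c = d, OF dp])
        have "(s + int n + m - 2 * int n) mod (2 * int n) = (s + int n + m) mod (2 * int n)"
          by (metis minus_mod_self2)
        also have "\<dots> = (s + int n + (i - (s + int n))) mod (2 * int n)"
          unfolding m_def by (rule mod_add_right_eq)
        finally show "i mod (2 * int n) = (s + int n + m - 2 * int n) mod (2 * int n)" by simp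
      qed
      then show ?thesis using False m by (simp add: refl_right_def m_def[symmetric] s)
    qed
  qed
  then have "refl_right n (s + int n) d = (\<lambda>_. d0 0)" by auto
  with Q_right[OF d] have "(\<lambda>_. d0 0) \<in> Q" by metis
  then have "M = 0" using cI by (simp add: Q_def F_def g_def)
  with le_M[OF c] have "2 * real n * ln (Phi c) \<le> (\<Sum>i\<in>I. ln (Phi (\<lambda>_. c i)))"
    by (simp add: F_def g_def)
  then have "ln (Phi c ^ (2 * n)) \<le> ln (\<Prod>i\<in>I. Phi (\<lambda>_. c i))"
    using less_imp_neq[OF pos, symmetric] by (subst ln_prod[OF fI]) (auto simp: ln_realpow)
  then show ?thesis
    using pos by (subst (asm) ln_le_cancel_iff) (auto simp: I_def intro!: prod_pos)
qed

text \<open>Zero values are avoided by adding \<open>e > 0\<close>. This keeps reflection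
  positivity, since \<open>Phi d\<close> is at most the arithmetic mean of the two reflected values;
  then \<open>e\<close> tends to \<open>0\<close>.\<close>

lemma chessboard:
  fixes Phi :: "(int \<Rightarrow> 'a) \<Rightarrow> real"
  assumes n: "n \<ge> 1" and A: "finite A" and nonneg: "\<And>c. 0 \<le> Phi c"
    and rp: "\<And>c j. c \<in> periodic_words n A \<Longrightarrow>
               (Phi c)\<^sup>2 \<le> Phi (refl_left n j c) * Phi (refl_right n j c)"
    and c: "c \<in> periodic_words n A"
  shows "Phi c ^ (2 * n) \<le> (\<Prod>i\<in>{0..<2 * int n}. Phi (\<lambda>_. c i))"
proof -
  have eps: "(Phi c + e) ^ (2 * n) \<le> (\<Prod>i\<in>{0..<2 * int n}. (Phi (\<lambda>_. c i) + e))" if e: "e > 0" for e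
  proof (rule chessboard_positive[OF n A _ _ c, where Phi = "\<lambda>c. Phi c + e"])
    show "0 < Phi d + e" for d using nonneg[of d] e by linarith
    fix d j assume d: "d \<in> periodic_words n A"
    define a b where "a = Phi (refl_left n j d)" and "b = Phi (refl_right n j d)"
    have ab: "0 \<le> a" "0 \<le> b" "(Phi d)\<^sup>2 \<le> a * b" using nonneg rp[OF d, of j] by (auto simp: a_def b_def)
    have "(2 * Phi d)\<^sup>2 \<le> (a + b)\<^sup>2"
      using ab zero_le_power2[of "a - b"] by (simp add: power2_eq_square algebra_simps)
    then have "2 * Phi d \<le> a + b" by (rule power2_le_imp_le) (use ab in auto)
    then have "e * (2 * Phi d) \<le> e * (a + b)" using e by simp
    then show "(Phi d + e)\<^sup>2 \<le> (a + e) * (b + e)"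
      using ab by (simp add: power2_eq_square algebra_simps)
  qed
  have "((\<lambda>e. (Phi c + e) ^ (2 * n)) \<longlongrightarrow> (Phi c + 0) ^ (2 * n)) (at_right 0)"
    by (intro tendsto_intros)
  moreover have "((\<lambda>e. \<Prod>i\<in>{0..<2 * int n}. (Phi (\<lambda>_. c i) + e)) \<longlongrightarrow> (\<Prod>i\<in>{0..<2 * int n}. (Phi (\<lambda>_. c i) + 0))) (at_right 0)"
    by (intro tendsto_intros)
  ultimately show ?thesis
    using eps by (auto intro!: tendsto_le[of "at_right (0::real)"] simp: eventually_at_filter)
qed

section \<open>Pinned masses of gradient models\<close>

abbreviation leb :: "'v set \<Rightarrow> ('v \<Rightarrow> real) measure" where
  "leb V \<equiv> PiM V (\<lambda>_. lborel)"

interpretation leb: product_sigma_finite "\<lambda>_. lborel :: real measure"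
  by standard

lemma sigma_finite_leb: "finite V \<Longrightarrow> sigma_finite_measure (leb V)"
  by (rule leb.sigma_finite)

text \<open>Two index sets are allowed because reflection positivity carries integrals over one half
  of the graph to the other half.\<close>

lemma nn_integral_leb_reindex:
  assumes V: "finite V" and W: "finite W" and s: "bij_betw s V W" and f: "f \<in> borel_measurable (leb V)"
  shows "(\<integral>\<^sup>+ x. f x \<partial>leb V) = (\<integral>\<^sup>+ y. f (\<lambda>v\<in>V. y (s v)) \<partial>leb W)"
proof -
  have m: "(\<lambda>y. \<lambda>v\<in>V. y (s v)) \<in> measurable (leb W) (leb V)"
    using s by (intro measurable_restrict measurable_component_singleton) (auto simp: bij_betw_def)
  have "distr (leb W) (leb V) (\<lambda>y. \<lambda>v\<in>V. y (s v)) = leb V"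
  proof (rule leb.PiM_eqI[OF V])
    fix A :: "'a \<Rightarrow> real set" assume A: "\<And>i. i \<in> V \<Longrightarrow> A i \<in> sets lborel"
    define t where "t = the_inv_into V s"
    have t: "t (s v) = v" if "v \<in> V" for v
      using that s by (simp add: t_def the_inv_into_f_f bij_betw_def)
    have tW: "t w \<in> V" if "w \<in> W" for w
      using that s t by (auto simp: bij_betw_def)
    have st: "s (t w) = w" if "w \<in> W" for w
      using that s t by (auto simp: bij_betw_def)
    have pre: "(\<lambda>y. \<lambda>v\<in>V. y (s v)) -` (Pi\<^sub>E V A) \<inter> space (leb W) = Pi\<^sub>E W (\<lambda>w. A (t w))"
    proof (intro set_eqI iffI)
      fix y assume y: "y \<in> (\<lambda>y. \<lambda>v\<in>V. y (s v)) -` (Pi\<^sub>E V A) \<inter> space (leb W)"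
      have "y w \<in> A (t w)" if "w \<in> W" for w
        using y tW[OF that] st[OF that] by (auto simp: PiE_iff)
      then show "y \<in> Pi\<^sub>E W (\<lambda>w. A (t w))" using y by (auto simp: PiE_iff space_PiM)
    next
      fix y assume y: "y \<in> Pi\<^sub>E W (\<lambda>w. A (t w))"
      have "y (s v) \<in> A v" if "v \<in> V" for v
        using y that s t[OF that] by (metis PiE_mem bij_betw_apply)
      then show "y \<in> (\<lambda>y. \<lambda>v\<in>V. y (s v)) -` (Pi\<^sub>E V A) \<inter> space (leb W)"
        using y by (auto simp: PiE_iff space_PiM)
    qed
    have "emeasure (distr (leb W) (leb V) (\<lambda>y. \<lambda>v\<in>V. y (s v))) (Pi\<^sub>E V A)
        = emeasure (leb W) (Pi\<^sub>E W (\<lambda>w. A (t w)))"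
      using A V m by (subst emeasure_distr) (auto simp: pre intro!: sets_PiM_I_finite)
    also have "\<dots> = (\<Prod>w\<in>W. emeasure lborel (A (t w)))"
      using A tW W by (intro leb.emeasure_PiM) auto
    also have "\<dots> = (\<Prod>v\<in>V. emeasure lborel (A (t (s v))))"
      by (rule prod.reindex_bij_betw[OF s, symmetric])
    also have "\<dots> = (\<Prod>v\<in>V. emeasure lborel (A v))" by (rule prod.cong) (auto simp: t)
    finally show "emeasure (distr (leb W) (leb V) (\<lambda>y. \<lambda>v\<in>V. y (s v))) (Pi\<^sub>E V A)
        = (\<Prod>v\<in>V. emeasure lborel (A v))" .
  qed simp
  then have "(\<integral>\<^sup>+ x. f x \<partial>leb V) = (\<integral>\<^sup>+ x. f x \<partial>distr (leb W) (leb V) (\<lambda>y. \<lambda>v\<in>V. y (s v)))" by simp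
  also have "\<dots> = (\<integral>\<^sup>+ y. f (\<lambda>v\<in>V. y (s v)) \<partial>leb W)"
    using f m by (intro nn_integral_distr) auto
  finally show ?thesis .
qed

text \<open>Edge weights see differences only, so this common translation is what makes the location
  and the law of the pin immaterial.\<close>

lemma nn_integral_leb_shift:
  fixes t :: real
  assumes V: "finite V" and f: "f \<in> borel_measurable (leb V)"
  shows "(\<integral>\<^sup>+ x. f (\<lambda>v\<in>V. x v + t) \<partial>leb V) = (\<integral>\<^sup>+ x. f x \<partial>leb V)"
proof -
  have m: "(\<lambda>x. \<lambda>v\<in>V. x v + t) \<in> measurable (leb V) (leb V)"
    by measurable
  have "distr (leb V) (leb V) (\<lambda>x. \<lambda>v\<in>V. x v + t) = leb V"
  proof (rule leb.PiM_eqI[OF V])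
    fix A :: "'a \<Rightarrow> real set" assume A: "\<And>i. i \<in> V \<Longrightarrow> A i \<in> sets lborel"
    have pre: "(\<lambda>x. \<lambda>v\<in>V. x v + t) -` (Pi\<^sub>E V A) \<inter> space (leb V) = Pi\<^sub>E V (\<lambda>v. (\<lambda>x. x + t) -` A v)"
      by (auto simp: PiE_iff space_PiM)
    have s: "(\<lambda>x. x + t) -` A v \<in> sets borel" if "v \<in> V" for v
    proof -
      have "(\<lambda>x. x + t) \<in> borel_measurable borel" by simp
      from measurable_sets[OF this] A[OF that] show ?thesis by simp
    qed
    have e: "emeasure lborel ((\<lambda>x. x + t) -` A v) = emeasure lborel (A v)" if "v \<in> V" for v
    proof -
      have "emeasure lborel (A v) = emeasure (distr lborel borel ((+) t)) (A v)"
        by (simp add: lborel_distr_plus)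
      also have "\<dots> = emeasure lborel ((+) t -` A v)"
        using A[OF that] by (subst emeasure_distr) auto
      finally show ?thesis by (simp add: add.commute[of t] vimage_def)
    qed
    have "emeasure (distr (leb V) (leb V) (\<lambda>x. \<lambda>v\<in>V. x v + t)) (Pi\<^sub>E V A)
        = emeasure (leb V) (Pi\<^sub>E V (\<lambda>v. (\<lambda>x. x + t) -` A v))"
      using A V m by (subst emeasure_distr) (auto simp: pre intro!: sets_PiM_I_finite)
    also have "\<dots> = (\<Prod>v\<in>V. emeasure lborel ((\<lambda>x. x + t) -` A v))"
      using s V by (intro leb.emeasure_PiM) auto
    also have "\<dots> = (\<Prod>v\<in>V. emeasure lborel (A v))" by (rule prod.cong) (auto simp: e)
    finally show "emeasure (distr (leb V) (leb V) (\<lambda>x. \<lambda>v\<in>V. x v + t)) (Pi\<^sub>E V A)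
        = (\<Prod>v\<in>V. emeasure lborel (A v))" .
  qed simp
  then have "(\<integral>\<^sup>+ x. f x \<partial>leb V) = (\<integral>\<^sup>+ x. f x \<partial>distr (leb V) (leb V) (\<lambda>x. \<lambda>v\<in>V. x v + t))" by simp
  also have "\<dots> = (\<integral>\<^sup>+ x. f (\<lambda>v\<in>V. x v + t) \<partial>leb V)"
    using f m by (intro nn_integral_distr) auto
  finally show ?thesis by simp
qed

definition edge_prod :: "('v \<times> 'v) set \<Rightarrow> ('v \<times> 'v \<Rightarrow> real \<Rightarrow> ennreal) \<Rightarrow> ('v \<Rightarrow> real) \<Rightarrow> ennreal" where
  "edge_prod D f x = (\<Prod>e\<in>D. f e (x (fst e) - x (snd e)))"

text \<open>Smearing the pinned coordinate over \<open>[0,1]\<close> instead of fixing it at \<open>0\<close> keeps the reference measure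
  a Lebesgue measure and gives the same value, because the integrand only sees differences.\<close>

definition pinned_mass ::
    "'v set \<Rightarrow> ('v \<times> 'v) set \<Rightarrow> ('v \<times> 'v \<Rightarrow> real \<Rightarrow> ennreal) \<Rightarrow> 'v \<Rightarrow> ennreal" where
  "pinned_mass V D f p = (\<integral>\<^sup>+ x. indicator {0..1} (x p) * edge_prod D f x \<partial>leb V)"

section \<open>Basic properties of pinned masses and independence of the pin\<close>

lemma edge_prod_measurable:
  assumes "D \<subseteq> V \<times> V" "\<And>e. e \<in> D \<Longrightarrow> f e \<in> borel_measurable borel"
  shows "edge_prod D f \<in> borel_measurable (leb V)"
proof -
  have "(\<lambda>x. f e (x (fst e) - x (snd e))) \<in> borel_measurable (leb V)" if "e \<in> D" for e
  proof -
    have [measurable]: "fst e \<in> V" "snd e \<in> V" using that assms by auto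
    note assms(2)[OF that, measurable]
    show ?thesis by measurable
  qed
  then show ?thesis unfolding edge_prod_def[abs_def] by (rule borel_measurable_prod_ennreal)
qed

lemma pin_measurable:
  "p \<in> V \<Longrightarrow> (\<lambda>x. indicator {0..1::real} (x p) :: ennreal) \<in> borel_measurable (leb V)"
  by measurable

lemma edge_prod_cong:
  "\<lbrakk>\<And>e. e \<in> D \<Longrightarrow> f e = g e; \<And>e. e \<in> D \<Longrightarrow> x (fst e) - x (snd e) = y (fst e) - y (snd e)\<rbrakk>
    \<Longrightarrow> edge_prod D f x = edge_prod D g y"
  unfolding edge_prod_def by (rule prod.cong) auto

lemma pinned_mass_mono:
  assumes "\<And>e x. e \<in> D \<Longrightarrow> f e x \<le> g e x"
  shows "pinned_mass V D f p \<le> pinned_mass V D g p"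
  unfolding pinned_mass_def edge_prod_def
  by (intro nn_integral_mono mult_left_mono prod_mono_ennreal) (auto simp: assms)

lemma pinned_mass_cong:
  assumes "\<And>e. e \<in> D \<Longrightarrow> f e = g e"
  shows "pinned_mass V D f p = pinned_mass V D g p"
  unfolding pinned_mass_def edge_prod_def
  by (intro nn_integral_cong arg_cong2[where f = "(*)"] prod.cong) (auto simp: assms)

lemma nn_integral_indicator_unit:
  "(\<integral>\<^sup>+ t. indicator {0..1} (a + t) \<partial>lborel) = 1" "(\<integral>\<^sup>+ t. indicator {0..1} (a - t) \<partial>lborel) = 1"
  for a :: real
proof -
  have "indicator {0..1} (a + t) = (indicator {-a..1-a} t :: ennreal)"
    "indicator {0..1} (a - t) = (indicator {a-1..a} t :: ennreal)" for t
    by (auto simp: indicator_def)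
  then show "(\<integral>\<^sup>+ t. indicator {0..1} (a + t) \<partial>lborel) = 1"
    "(\<integral>\<^sup>+ t. indicator {0..1} (a - t) \<partial>lborel) = 1" by simp_all
qed

text \<open>The factor \<open>1\<close>, written as an integral over \<open>t\<close> of the window
  at \<open>x q + t\<close>, is inserted, and translating all heights by \<open>t\<close> exchanges
  the roles of \<open>p\<close> and \<open>q\<close>. This moves the pin onto a reflection axis or
  to the root of a tree.\<close>

lemma pinned_mass_pin:
  assumes V: "finite V" and D: "D \<subseteq> V \<times> V" and f: "\<And>e. e \<in> D \<Longrightarrow> f e \<in> borel_measurable borel"
    and p: "p \<in> V" and q: "q \<in> V"
  shows "pinned_mass V D f p = pinned_mass V D f q"
proof -
  interpret P: pair_sigma_finite "leb V" "lborel :: real measure"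
    using sigma_finite_leb[OF V] by (simp add: pair_sigma_finite_def sigma_finite_lborel)
  have F[measurable]: "edge_prod D f \<in> borel_measurable (leb V)"
    by (rule edge_prod_measurable[OF D f])
  note [measurable] = p q
  have "pinned_mass V D f p
      = (\<integral>\<^sup>+ x. (\<integral>\<^sup>+ t. indicator {0..1} (x p) * edge_prod D f x * indicator {0..1} (x q + t) \<partial>lborel) \<partial>leb V)"
    unfolding pinned_mass_def by (simp add: nn_integral_cmult nn_integral_indicator_unit)
  also have "\<dots> = (\<integral>\<^sup>+ t. (\<integral>\<^sup>+ x. indicator {0..1} (x p) * edge_prod D f x * indicator {0..1} (x q + t) \<partial>leb V) \<partial>lborel)"
    by (rule P.Fubini'[symmetric]) measurable
  also have "\<dots> = (\<integral>\<^sup>+ t. (\<integral>\<^sup>+ x. indicator {0..1} (x p - t) * edge_prod D f x * indicator {0..1} (x q) \<partial>leb V) \<partial>lborel)"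
  proof (rule nn_integral_cong)
    fix t :: real
    let ?h = "\<lambda>x. indicator {0..1} (x p - t) * edge_prod D f x * indicator {0..1} (x q) :: ennreal"
    have h: "?h \<in> borel_measurable (leb V)" by measurable
    have "(\<integral>\<^sup>+ x. ?h x \<partial>leb V) = (\<integral>\<^sup>+ x. ?h (\<lambda>v\<in>V. x v + t) \<partial>leb V)"
      by (rule nn_integral_leb_shift[OF V h, symmetric])
    moreover have "edge_prod D f (\<lambda>v\<in>V. x v + t) = edge_prod D f x" for x
      using D by (intro edge_prod_cong) auto
    ultimately show "(\<integral>\<^sup>+ x. indicator {0..1} (x p) * edge_prod D f x * indicator {0..1} (x q + t) \<partial>leb V)
        = (\<integral>\<^sup>+ x. ?h x \<partial>leb V)" using p q by simp
  qed
  also have "\<dots> = (\<integral>\<^sup>+ x. (\<integral>\<^sup>+ t. indicator {0..1} (x p - t) * edge_prod D f x * indicator {0..1} (x q) \<partial>lborel) \<partial>leb V)"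
    by (rule P.Fubini') measurable
  also have "\<dots> = pinned_mass V D f q"
    unfolding pinned_mass_def
    by (simp add: nn_integral_multc nn_integral_indicator_unit mult.commute[of "edge_prod D f _"])
  finally show ?thesis .
qed

text \<open>After the free heights are integrated out, the result does not depend on the pinned
  height, by translation. So the Dirac measure at \<open>0\<close> and the uniform law on the unit
  interval give the same value.\<close>

lemma nn_integral_pinned_ref:
  fixes p :: 'v
  assumes V: "finite V" and D: "D \<subseteq> V \<times> V" and f: "\<And>e. e \<in> D \<Longrightarrow> f e \<in> borel_measurable borel"
    and p: "p \<in> V"
  shows "(\<integral>\<^sup>+ x. edge_prod D f x \<partial>PiM V (\<lambda>v. if v = p then return lborel 0 else lborel)) = pinned_mass V D f p"
proof -
  let ?M = "\<lambda>v. if v = p then return lborel 0 else lborel :: real measure"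
  define W where "W = V - {p}"
  have W: "finite W" "p \<notin> W" "V = insert p W" using V p by (auto simp: W_def)
  interpret R: product_sigma_finite ?M
    using prob_space_return[of 0 "lborel :: real measure"] sigma_finite_lborel
    by (intro product_sigma_finite.intro) (auto intro: prob_space_imp_sigma_finite)
  have sets_eq: "sets (PiM X ?M) = sets (leb X)" for X
    by (rule sets_PiM_cong) auto
  have WM: "PiM W ?M = leb W" by (rule PiM_cong) (use W in auto)
  have F[measurable]: "edge_prod D f \<in> borel_measurable (leb (insert p W))"
    using edge_prod_measurable[of D V f] D f W by simp
  have F': "edge_prod D f \<in> borel_measurable (PiM (insert p W) ?M)"
    using F by (simp cong: measurable_cong_sets add: sets_eq)
  have upd: "(\<integral>\<^sup>+ x. edge_prod D f (x(p := y)) \<partial>leb W) = (\<integral>\<^sup>+ x. edge_prod D f (x(p := 0)) \<partial>leb W)" for y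
  proof -
    have m: "(\<lambda>x. edge_prod D f (x(p := y))) \<in> borel_measurable (leb W)"
      by (rule measurable_compose[OF _ F]) (use W in measurable)
    have "(\<integral>\<^sup>+ x. edge_prod D f (x(p := y)) \<partial>leb W)
        = (\<integral>\<^sup>+ x. edge_prod D f ((\<lambda>v\<in>W. x v + y)(p := y)) \<partial>leb W)"
      by (rule nn_integral_leb_shift[OF W(1) m, symmetric])
    moreover have "edge_prod D f ((\<lambda>v\<in>W. x v + y)(p := y)) = edge_prod D f (x(p := 0))" for x
    proof (rule edge_prod_cong)
      fix e assume "e \<in> D"
      then have "fst e \<in> insert p W" "snd e \<in> insert p W" using D W by auto
      then show "((\<lambda>v\<in>W. x v + y)(p := y)) (fst e) - ((\<lambda>v\<in>W. x v + y)(p := y)) (snd e)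
          = (x(p := 0)) (fst e) - (x(p := 0)) (snd e)" by auto
    qed simp
    ultimately show ?thesis by simp
  qed
  have "(\<integral>\<^sup>+ x. edge_prod D f x \<partial>PiM V ?M) = (\<integral>\<^sup>+ y. (\<integral>\<^sup>+ x. edge_prod D f (x(p := y)) \<partial>leb W) \<partial>return lborel 0)"
    unfolding W(3) by (subst R.product_nn_integral_insert_rev[OF W(1,2) F']) (simp add: WM)
  also have "\<dots> = (\<integral>\<^sup>+ x. edge_prod D f (x(p := 0)) \<partial>leb W)"
    by (subst upd) (use prob_space.emeasure_space_1[OF prob_space_return[of 0 "lborel :: real measure"]] in simp)
  also have "\<dots> = (\<integral>\<^sup>+ y. indicator {0..1} (y::real) * (\<integral>\<^sup>+ x. edge_prod D f (x(p := 0)) \<partial>leb W) \<partial>lborel)"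
    by (simp add: nn_integral_multc)
  also have "\<dots> = (\<integral>\<^sup>+ y. (\<integral>\<^sup>+ x. indicator {0..1} ((x(p := y)) p) * edge_prod D f (x(p := y)) \<partial>leb W) \<partial>lborel)"
  proof (rule nn_integral_cong)
    fix y :: real
    have m: "(\<lambda>x. edge_prod D f (x(p := y))) \<in> borel_measurable (leb W)"
      by (rule measurable_compose[OF _ F]) (use W in measurable)
    show "indicator {0..1} y * (\<integral>\<^sup>+ x. edge_prod D f (x(p := 0)) \<partial>leb W)
      = (\<integral>\<^sup>+ x. indicator {0..1} ((x(p := y)) p) * edge_prod D f (x(p := y)) \<partial>leb W)"
      by (simp add: nn_integral_cmult[OF m] upd[of y])
  qed
  also have "\<dots> = pinned_mass V D f p"
    unfolding pinned_mass_def W(3) by (rule leb.product_nn_integral_insert_rev[OF W(1,2), symmetric]) measurable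
  finally show ?thesis .
qed

lemma pinned_mass_reindex:
  assumes V: "finite V" and D: "D \<subseteq> V \<times> V" and f: "\<And>e. e \<in> D \<Longrightarrow> f e \<in> borel_measurable borel"
    and p: "p \<in> V" and s: "bij_betw s V V" and sD: "bij_betw (map_prod s s) D D"
  shows "pinned_mass V D (\<lambda>e. f (map_prod s s e)) p = pinned_mass V D f (s p)"
proof -
  have "(\<lambda>x. indicator {0..1} (x p) * edge_prod D (\<lambda>e. f (map_prod s s e)) x) \<in> borel_measurable (leb V)"
    using p D by (intro borel_measurable_times_ennreal edge_prod_measurable pin_measurable)
       (auto intro!: f bij_betw_apply[OF sD])
  from nn_integral_leb_reindex[OF V V s this]
  have "pinned_mass V D (\<lambda>e. f (map_prod s s e)) p
      = (\<integral>\<^sup>+ y. indicator {0..1} (y (s p)) * edge_prod D (\<lambda>e. f (map_prod s s e)) (\<lambda>v\<in>V. y (s v)) \<partial>leb V)"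
    unfolding pinned_mass_def using p by simp
  moreover have "edge_prod D (\<lambda>e. f (map_prod s s e)) (\<lambda>v\<in>V. y (s v)) = edge_prod D f y" for y
    unfolding edge_prod_def
    by (subst prod.reindex_bij_betw[OF sD, symmetric]) (use D in \<open>auto intro!: prod.cong\<close>)
  ultimately show ?thesis by (simp add: pinned_mass_def)
qed

section \<open>Reflection positivity\<close>

text \<open>\<open>V0\<close> is the axis, and \<open>AB\<close> forbids edges between the open
  halves. The two masses on the right arise by copying one half onto the other.\<close>

lemma reflection_positivity:
  fixes r :: "'v \<Rightarrow> 'v" and f :: "'v \<times> 'v \<Rightarrow> real \<Rightarrow> ennreal"
  assumes fin: "finite V0" "finite A" "finite B"
    and disj: "V0 \<inter> A = {}" "V0 \<inter> B = {}" "A \<inter> B = {}"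
    and V: "V = V0 \<union> A \<union> B"
    and D: "D \<subseteq> V \<times> V" and f: "\<And>e. e \<in> D \<Longrightarrow> f e \<in> borel_measurable borel"
    and p: "p \<in> V0"
    and r0: "\<And>v. v \<in> V0 \<Longrightarrow> r v = v" and rA: "\<And>v. v \<in> A \<Longrightarrow> r v \<in> B" and rB: "\<And>v. v \<in> B \<Longrightarrow> r v \<in> A"
    and rr: "\<And>v. v \<in> V \<Longrightarrow> r (r v) = v"
    and rD: "\<And>v w. (v, w) \<in> D \<Longrightarrow> (r v, r w) \<in> D"
    and AB: "\<And>v w. (v, w) \<in> D \<Longrightarrow> \<not> (v \<in> A \<and> w \<in> B) \<and> \<not> (v \<in> B \<and> w \<in> A)"
  shows "(pinned_mass V D f p)\<^sup>2
    \<le> pinned_mass V D (\<lambda>e. if fst e \<in> B \<or> snd e \<in> B then f (map_prod r r e) else f e) p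
    * pinned_mass V D (\<lambda>e. if fst e \<in> A \<or> snd e \<in> A then f (map_prod r r e) else f e) p"
proof -
  define D0 where "D0 = {e\<in>D. fst e \<in> V0 \<and> snd e \<in> V0}"
  define DA where "DA = {e\<in>D. fst e \<in> A \<or> snd e \<in> A}"
  define DB where "DB = {e\<in>D. fst e \<in> B \<or> snd e \<in> B}"
  define R where "R = map_prod r r"
  have finD: "finite D" using D V fin by (meson finite_SigmaI finite_UnI finite_subset)
  have D_split: "D = D0 \<union> (DA \<union> DB)" using D by (auto simp: D0_def DA_def DB_def V)
  have D_disj: "D0 \<inter> (DA \<union> DB) = {}" "DA \<inter> DB = {}"
    using disj AB by (auto simp: D0_def DA_def DB_def)
  have finD': "finite D0" "finite DA" "finite DB" using finD by (auto simp: D0_def DA_def DB_def)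
  have D0_sub: "D0 \<subseteq> V0 \<times> V0" and D0D: "D0 \<subseteq> D" by (auto simp: D0_def)
  have DA_sub: "DA \<subseteq> (V0 \<union> A) \<times> (V0 \<union> A)" and DAD: "DA \<subseteq> D" using D AB by (auto simp: DA_def V)
  have DB_sub: "DB \<subseteq> (V0 \<union> B) \<times> (V0 \<union> B)" and DBD: "DB \<subseteq> D" using D AB by (auto simp: DB_def V)
  have RD: "R e \<in> D" if "e \<in> D" for e using that rD by (cases e) (auto simp: R_def)
  have RR: "R (R e) = e" if "e \<in> D" for e using that D by (cases e) (auto simp: R_def rr)
  have R_AB: "R e \<in> DB" if "e \<in> DA" for e
    using that RD rA by (auto simp: DA_def DB_def R_def)
  have R_BA: "R e \<in> DA" if "e \<in> DB" for e
    using that RD rB by (auto simp: DA_def DB_def R_def)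
  have bij_R: "bij_betw R DA DB"
    by (rule bij_betw_byWitness[where f' = R]) (use R_AB R_BA RR DAD DBD in auto)
  have bij_r: "bij_betw r B A"
    by (rule bij_betw_byWitness[where f' = r]) (use rA rB rr V in auto)
  \<comment> \<open>\<open>W\<close> collects the pin and the edges inside the axis;
    \<open>G\<close> is the half \<open>A\<close> integrated out for fixed heights on the
    axis.\<close>
  define W where "W = (\<lambda>(g :: 'v \<times> 'v \<Rightarrow> real \<Rightarrow> ennreal) x. indicator {0..1} (x p) * edge_prod D0 g x)"
  define G where "G = (\<lambda>(g :: 'v \<times> 'v \<Rightarrow> real \<Rightarrow> ennreal) x. \<integral>\<^sup>+ y. edge_prod DA g (merge V0 A (x, y)) \<partial>leb A)"
  interpret sA: sigma_finite_measure "leb A" by (rule sigma_finite_leb[OF fin(2)])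
  have G_meas: "G g \<in> borel_measurable (leb V0)" if "\<And>e. e \<in> D \<Longrightarrow> g e \<in> borel_measurable borel" for g
  proof -
    have [measurable]: "edge_prod DA g \<in> borel_measurable (leb (V0 \<union> A))"
      using DAD that by (intro edge_prod_measurable[OF DA_sub]) auto
    show ?thesis unfolding G_def by measurable
  qed
  have W_meas: "W g \<in> borel_measurable (leb V0)" if "\<And>e. e \<in> D \<Longrightarrow> g e \<in> borel_measurable borel" for g
    unfolding W_def using that D0D p
    by (intro borel_measurable_times_ennreal edge_prod_measurable[OF D0_sub] pin_measurable) auto
  \<comment> \<open>The half \<open>B\<close> is pulled back to \<open>A\<close> by the reflection,
    so both halves become the same functional \<open>G\<close>, at the weights \<open>g\<close> and
    at their mirror images.\<close>
  have mass: "pinned_mass V D g p = (\<integral>\<^sup>+ x. W g x * (G g x * G (\<lambda>e. g (R e)) x) \<partial>leb V0)"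
    if g: "\<And>e. e \<in> D \<Longrightarrow> g e \<in> borel_measurable borel" for g
  proof -
    have V': "V = V0 \<union> (A \<union> B)" using V by auto
    have FA: "edge_prod DA g \<in> borel_measurable (leb (V0 \<union> A))"
      using DAD g by (intro edge_prod_measurable[OF DA_sub]) auto
    have FB: "edge_prod DB g \<in> borel_measurable (leb (V0 \<union> B))"
      using DBD g by (intro edge_prod_measurable[OF DB_sub]) auto
    let ?F = "\<lambda>x. indicator {0..1} (x p) * edge_prod D g x"
    have F: "?F \<in> borel_measurable (leb (V0 \<union> (A \<union> B)))"
      using p D g unfolding V'[symmetric]
      by (intro borel_measurable_times_ennreal edge_prod_measurable pin_measurable) (auto simp: V)
    have inner: "(\<integral>\<^sup>+ z. ?F (merge V0 (A \<union> B) (x, z)) \<partial>leb (A \<union> B)) = W g x * (G g x * G (\<lambda>e. g (R e)) x)"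
      if x: "x \<in> space (leb V0)" for x
    proof -
      have mA: "(\<lambda>y. edge_prod DA g (merge V0 A (x, y))) \<in> borel_measurable (leb A)"
        using x by (intro measurable_compose[OF _ FA]) measurable
      have mB: "(\<lambda>y. edge_prod DB g (merge V0 B (x, y))) \<in> borel_measurable (leb B)"
        using x by (intro measurable_compose[OF _ FB]) measurable
      have mF: "(\<lambda>z. ?F (merge V0 (A \<union> B) (x, z))) \<in> borel_measurable (leb (A \<union> B))"
        using x by (intro measurable_compose[OF _ F]) measurable
      have split: "?F (merge V0 (A \<union> B) (x, merge A B (y, z)))
          = W g x * (edge_prod DA g (merge V0 A (x, y)) * edge_prod DB g (merge V0 B (x, z)))" for y z
      proof -
        let ?m = "merge V0 (A \<union> B) (x, merge A B (y, z))"
        have "edge_prod D g ?m = edge_prod D0 g ?m * (edge_prod DA g ?m * edge_prod DB g ?m)"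
          unfolding edge_prod_def using D_disj finD'
          by (subst D_split, subst prod.union_disjoint) (auto simp: prod.union_disjoint)
        moreover have "edge_prod D0 g ?m = edge_prod D0 g x"
          using D0_sub by (intro edge_prod_cong) (auto simp: merge_def)
        moreover have "edge_prod DA g ?m = edge_prod DA g (merge V0 A (x, y))"
        proof (intro edge_prod_cong refl arg_cong2[where f = "(-)"])
          have "?m v = merge V0 A (x, y) v" if "v \<in> V0 \<union> A" for v
            using that disj by (auto simp: merge_def)
          then show "?m (fst e) = merge V0 A (x, y) (fst e)" "?m (snd e) = merge V0 A (x, y) (snd e)"
            if "e \<in> DA" for e using subsetD[OF DA_sub that] by (simp_all add: mem_Times_iff)
        qed
        moreover have "edge_prod DB g ?m = edge_prod DB g (merge V0 B (x, z))"
        proof (intro edge_prod_cong refl arg_cong2[where f = "(-)"])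
          have "?m v = merge V0 B (x, z) v" if "v \<in> V0 \<union> B" for v
            using that disj by (auto simp: merge_def)
          then show "?m (fst e) = merge V0 B (x, z) (fst e)" "?m (snd e) = merge V0 B (x, z) (snd e)"
            if "e \<in> DB" for e using subsetD[OF DB_sub that] by (simp_all add: mem_Times_iff)
        qed
        moreover have "?m p = x p" using p by (auto simp: merge_def)
        ultimately show ?thesis by (simp add: W_def mult_ac)
      qed
      have GB: "(\<integral>\<^sup>+ z. edge_prod DB g (merge V0 B (x, z)) \<partial>leb B) = G (\<lambda>e. g (R e)) x"
      proof -
        have "edge_prod DB g (merge V0 B (x, \<lambda>v\<in>B. y (r v))) = edge_prod DA (\<lambda>e. g (R e)) (merge V0 A (x, y))" for y
        proof -
          have m: "merge V0 B (x, \<lambda>v\<in>B. y (r v)) (r v) = merge V0 A (x, y) v" if "v \<in> V0 \<union> A" for v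
            using that disj r0[of v] rA[of v] rr[of v] V by (auto simp: merge_def)
          show ?thesis
            unfolding edge_prod_def prod.reindex_bij_betw[OF bij_R, symmetric]
          proof (rule prod.cong)
            fix e assume "e \<in> DA"
            then have "fst e \<in> V0 \<union> A" "snd e \<in> V0 \<union> A" using DA_sub by (auto simp: mem_Times_iff)
            then show "g (R e) (merge V0 B (x, \<lambda>v\<in>B. y (r v)) (fst (R e)) - merge V0 B (x, \<lambda>v\<in>B. y (r v)) (snd (R e)))
                = g (R e) (merge V0 A (x, y) (fst e) - merge V0 A (x, y) (snd e))"
              using m by (simp add: R_def)
          qed simp
        qed
        then show ?thesis
          unfolding G_def nn_integral_leb_reindex[OF fin(3) fin(2) bij_r mB] by simp
      qed
      have "(\<integral>\<^sup>+ z. ?F (merge V0 (A \<union> B) (x, z)) \<partial>leb (A \<union> B))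
          = (\<integral>\<^sup>+ y. (\<integral>\<^sup>+ z. ?F (merge V0 (A \<union> B) (x, merge A B (y, z))) \<partial>leb B) \<partial>leb A)"
        by (rule leb.product_nn_integral_fold[OF disj(3) fin(2,3) mF])
      also have "\<dots> = W g x * (G g x * G (\<lambda>e. g (R e)) x)"
        unfolding split using mA mB
        by (simp add: nn_integral_cmult nn_integral_multc GB) (simp add: G_def)
      finally show ?thesis .
    qed
    have "pinned_mass V D g p = (\<integral>\<^sup>+ x. (\<integral>\<^sup>+ z. ?F (merge V0 (A \<union> B) (x, z)) \<partial>leb (A \<union> B)) \<partial>leb V0)"
      unfolding pinned_mass_def V' using disj fin F
      by (intro leb.product_nn_integral_fold) auto
    also have "\<dots> = (\<integral>\<^sup>+ x. W g x * (G g x * G (\<lambda>e. g (R e)) x) \<partial>leb V0)"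
      by (rule nn_integral_cong) (rule inner)
    finally show ?thesis .
  qed
  define fL where "fL = (\<lambda>e. if fst e \<in> B \<or> snd e \<in> B then f (R e) else f e)"
  define fR where "fR = (\<lambda>e. if fst e \<in> A \<or> snd e \<in> A then f (R e) else f e)"
  define f' where "f' = (\<lambda>e. f (R e))"
  have f': "f' e \<in> borel_measurable borel" if "e \<in> D" for e using f RD that by (auto simp: f'_def)
  have fL: "fL e \<in> borel_measurable borel" and fR: "fR e \<in> borel_measurable borel" if "e \<in> D" for e
    using f RD that by (auto simp: fL_def fR_def)
  have W_cong: "W g = W h" if "\<And>e. e \<in> D0 \<Longrightarrow> g e = h e" for g h
    unfolding W_def using that by (auto simp: edge_prod_def cong: prod.cong)
  have G_cong: "G g = G h" if "\<And>e. e \<in> DA \<Longrightarrow> g e = h e" for g h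
    unfolding G_def using that by (auto simp: edge_prod_def cong: prod.cong)
  have A_notB: "fst e \<notin> B" "snd e \<notin> B" if "e \<in> DA" for e using subsetD[OF DA_sub that] disj by (auto simp: mem_Times_iff)
  have RA_notA: "fst (R e) \<notin> A" "snd (R e) \<notin> A" if "e \<in> DA" for e
    using subsetD[OF DB_sub R_AB[OF that]] disj by (auto simp: mem_Times_iff)
  have D0_not: "fst e \<notin> A" "snd e \<notin> A" "fst e \<notin> B" "snd e \<notin> B" if "e \<in> D0" for e
    using subsetD[OF D0_sub that] disj by (auto simp: mem_Times_iff)
  have RA_B: "fst (R e) \<in> B \<or> snd (R e) \<in> B" if "e \<in> DA" for e using R_AB[OF that] by (auto simp: DB_def)
  \<comment> \<open>Symmetrising leaves the axis weight alone and makes the two half factors equal: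
    both are \<open>G f\<close> for \<open>fL\<close> and both are \<open>G f'\<close> for
    \<open>fR\<close>.\<close>
  have WL: "W fL = W f" and WR: "W fR = W f" using D0_not by (auto intro!: W_cong simp: fL_def fR_def)
  have GL: "G fL = G f" using A_notB by (intro G_cong) (auto simp: fL_def)
  have GL': "G (\<lambda>e. fL (R e)) = G f"
  proof (rule G_cong)
    fix e assume e: "e \<in> DA"
    then show "fL (R e) = f e" using RA_B[OF e] RR[of e] DAD by (auto simp: fL_def)
  qed
  have GR: "G fR = G f'" by (intro G_cong) (auto simp: fR_def f'_def DA_def)
  have GR': "G (\<lambda>e. fR (R e)) = G f'" using RA_notA by (intro G_cong) (auto simp: fR_def f'_def)
  have [measurable]: "W f \<in> borel_measurable (leb V0)" "G f \<in> borel_measurable (leb V0)"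
      "G f' \<in> borel_measurable (leb V0)"
    using W_meas G_meas f f' by blast+
  \<comment> \<open>With the axis weight as density, what remains is Cauchy-Schwarz for
    \<open>G f\<close> and \<open>G f'\<close>.\<close>
  let ?M = "density (leb V0) (W f)"
  have "pinned_mass V D f p = (\<integral>\<^sup>+ x. G f x * G f' x \<partial>?M)"
    using mass[of f] f unfolding f'_def[symmetric] by (subst nn_integral_density) auto
  moreover have "pinned_mass V D fL p = (\<integral>\<^sup>+ x. (G f x)\<^sup>2 \<partial>?M)"
    using mass[of fL] fL unfolding WL GL GL' by (subst nn_integral_density) (auto simp: power2_eq_square)
  moreover have "pinned_mass V D fR p = (\<integral>\<^sup>+ x. (G f' x)\<^sup>2 \<partial>?M)"
    using mass[of fR] fR unfolding WR GR GR' by (subst nn_integral_density) (auto simp: power2_eq_square)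
  moreover have "(\<integral>\<^sup>+ x. G f x * G f' x \<partial>?M)\<^sup>2 \<le> (\<integral>\<^sup>+ x. (G f x)\<^sup>2 \<partial>?M) * (\<integral>\<^sup>+ x. (G f' x)\<^sup>2 \<partial>?M)"
    by (rule Cauchy_Schwarz_nn_integral) simp_all
  ultimately have "(pinned_mass V D f p)\<^sup>2 \<le> pinned_mass V D fL p * pinned_mass V D fR p" by simp
  then show ?thesis unfolding fL_def fR_def R_def .
qed

section \<open>Tree and greedy bounds\<close>

lemma nn_integral_lborel_shift:
  fixes g :: "real \<Rightarrow> ennreal"
  assumes "g \<in> borel_measurable borel"
  shows "(\<integral>\<^sup>+ y. g (y - c) \<partial>lborel) = (\<integral>\<^sup>+ y. g y \<partial>lborel)"
  using nn_integral_real_affine[OF assms, of 1 "- c"] by simp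

text \<open>A vertex of maximal \<open>ht\<close> is nobody's parent, so its height occurs in a
  single factor. Integrating it out first gives a constant, and induction removes the rest of the
  tree.\<close>

lemma nn_integral_rooted_tree:
  fixes ht :: "'v \<Rightarrow> nat" and par :: "'v \<Rightarrow> 'v" and h :: "'v \<Rightarrow> real \<Rightarrow> ennreal"
  assumes "finite V" "rt \<in> V" "\<And>v. v \<in> V - {rt} \<Longrightarrow> par v \<in> V \<and> ht (par v) < ht v"
    and h: "\<And>v. h v \<in> borel_measurable borel"
  shows "(\<integral>\<^sup>+ x. indicator {0..1} (x rt) * (\<Prod>v\<in>V - {rt}. h v (x v - x (par v))) \<partial>leb V)
    = (\<Prod>v\<in>V - {rt}. \<integral>\<^sup>+ y. h v y \<partial>lborel)"
  using assms(1-3)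
proof (induction V rule: finite_psubset_induct)
  case (psubset V)
  show ?case
  proof (cases "V = {rt}")
    case True
    then show ?thesis using leb.product_nn_integral_singleton[of "indicator {0..1::real}" rt] by simp
  next
    case False
    then have ne: "V - {rt} \<noteq> {}" using psubset.prems by auto
    obtain v where v: "v \<in> V - {rt}" and vmax: "\<And>w. w \<in> V - {rt} \<Longrightarrow> ht w \<le> ht v"
    proof -
      have "finite (ht ` (V - {rt}))" "ht ` (V - {rt}) \<noteq> {}" using ne psubset.hyps by auto
      from Max_in[OF this] obtain v where "v \<in> V - {rt}" "ht v = Max (ht ` (V - {rt}))"
        by (metis imageE)
      then show ?thesis using psubset.hyps by (intro that[of v]) auto
    qed
    define W where "W = V - {v}"
    have W: "finite W" "v \<notin> W" "V = insert v W" "W \<subset> V" "rt \<in> W"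
      using v psubset by (auto simp: W_def)
    have parW: "par w \<in> W \<and> ht (par w) < ht w" if "w \<in> W - {rt}" for w
      using that psubset.prems(2)[of w] vmax[of w] by (auto simp: W_def)
    have parv: "par v \<in> W" using psubset.prems(2)[OF v] by (auto simp: W_def)
    have IH: "(\<integral>\<^sup>+ x. indicator {0..1} (x rt) * (\<Prod>v\<in>W - {rt}. h v (x v - x (par v))) \<partial>leb W)
        = (\<Prod>v\<in>W - {rt}. \<integral>\<^sup>+ y. h v y \<partial>lborel)"
      by (rule psubset.IH[OF W(4,5)]) (rule parW)
    have split: "V - {rt} = insert v (W - {rt})" using W v by auto
    note h[measurable]
    have m: "(\<lambda>x. \<Prod>v\<in>V - {rt}. h v (x v - x (par v))) \<in> borel_measurable (leb V)"
    proof (rule borel_measurable_prod_ennreal)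
      fix w assume "w \<in> V - {rt}"
      then have [measurable]: "w \<in> V" "par w \<in> V" using psubset.prems(2) by auto
      show "(\<lambda>x. h w (x w - x (par w))) \<in> borel_measurable (leb V)" by measurable
    qed
    have m': "(\<lambda>x. \<Prod>v\<in>W - {rt}. h v (x v - x (par v))) \<in> borel_measurable (leb W)"
    proof (rule borel_measurable_prod_ennreal)
      fix w assume "w \<in> W - {rt}"
      then have [measurable]: "w \<in> W" "par w \<in> W" using parW by auto
      show "(\<lambda>x. h w (x w - x (par w))) \<in> borel_measurable (leb W)" by measurable
    qed
    have "(\<integral>\<^sup>+ x. indicator {0..1} (x rt) * (\<Prod>v\<in>V - {rt}. h v (x v - x (par v))) \<partial>leb V)
      = (\<integral>\<^sup>+ x. (\<integral>\<^sup>+ y. indicator {0..1} ((x(v := y)) rt) *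
            (\<Prod>w\<in>V - {rt}. h w ((x(v := y)) w - (x(v := y)) (par w))) \<partial>lborel) \<partial>leb W)"
      using m psubset.prems(1) pin_measurable[of rt V] unfolding W(3)
      by (intro leb.product_nn_integral_insert[OF W(1,2)] borel_measurable_times_ennreal)
    also have "\<dots> = (\<integral>\<^sup>+ x. (\<integral>\<^sup>+ y. (indicator {0..1} (x rt) * (\<Prod>w\<in>W - {rt}. h w (x w - x (par w))))
            * h v (y - x (par v)) \<partial>lborel) \<partial>leb W)"
    proof (intro nn_integral_cong)
      fix x y
      have "(\<Prod>w\<in>V - {rt}. h w ((x(v := y)) w - (x(v := y)) (par w)))
          = h v (y - x (par v)) * (\<Prod>w\<in>W - {rt}. h w ((x(v := y)) w - (x(v := y)) (par w)))"
        unfolding split using W parv by (subst prod.insert) auto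
      also have "(\<Prod>w\<in>W - {rt}. h w ((x(v := y)) w - (x(v := y)) (par w)))
          = (\<Prod>w\<in>W - {rt}. h w (x w - x (par w)))"
        using W parW by (intro prod.cong) auto
      finally show "indicator {0..1} ((x(v := y)) rt) *
            (\<Prod>w\<in>V - {rt}. h w ((x(v := y)) w - (x(v := y)) (par w)))
          = (indicator {0..1} (x rt) * (\<Prod>w\<in>W - {rt}. h w (x w - x (par w)))) * h v (y - x (par v))"
        using W(2,5) by (auto simp: mult_ac)
    qed
    also have "\<dots> = (\<integral>\<^sup>+ x. (indicator {0..1} (x rt) * (\<Prod>w\<in>W - {rt}. h w (x w - x (par w))))
            * (\<integral>\<^sup>+ y. h v y \<partial>lborel) \<partial>leb W)"
      by (simp add: nn_integral_cmult nn_integral_lborel_shift h)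
    also have "\<dots> = (\<integral>\<^sup>+ x. indicator {0..1} (x rt) * (\<Prod>w\<in>W - {rt}. h w (x w - x (par w))) \<partial>leb W)
            * (\<integral>\<^sup>+ y. h v y \<partial>lborel)"
      using m' W(5) by (intro nn_integral_multc borel_measurable_times_ennreal pin_measurable)
    also have "\<dots> = (\<Prod>w\<in>V - {rt}. \<integral>\<^sup>+ y. h w y \<partial>lborel)"
      unfolding IH split using W by (subst prod.insert) (auto simp: mult.commute)
    finally show ?thesis .
  qed
qed

text \<open>Union bound: all heights lie in \<open>{0..a}\<close>, hence differences in
  \<open>{-a..a}\<close>, and each of at most \<open>k\<close> edges excludes measure at most
  \<open>\<eta>\<close>, so at most half of the interval is lost. The sign \<open>s\<close> absorbs
  the orientation of an edge.\<close>

lemma emeasure_all_good_ge: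
  fixes G :: "real set" and a \<eta> :: real
  assumes a: "0 < a" and G: "G \<in> sets borel" and eta: "emeasure lborel ({-a..a} - G) \<le> ennreal \<eta>"
    and k: "real k * \<eta> \<le> a / 2" and E: "finite E" "card E \<le> k" and eta0: "0 \<le> \<eta>"
    and c: "\<And>e. e \<in> E \<Longrightarrow> c e \<in> {0..a}" and s: "\<And>e. e \<in> E \<Longrightarrow> s e = 1 \<or> s e = -1"
  shows "ennreal (a / 2) \<le> (\<integral>\<^sup>+ y. indicator {0..a} y * (\<Prod>e\<in>E. indicator G (s e * (y - c e))) \<partial>lborel)"
proof -
  define Bad where "Bad = (\<lambda>e. {y\<in>{0..a}. s e * (y - c e) \<notin> G})"
  define Good where "Good = {y\<in>{0..a}. \<forall>e\<in>E. s e * (y - c e) \<in> G}"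
  note [measurable] = G
  have [measurable]: "Bad e \<in> sets borel" for e unfolding Bad_def by measurable
  have [measurable]: "Good \<in> sets borel" unfolding Good_def using E by measurable
  have ind: "indicator {0..a} y * (\<Prod>e\<in>E. indicator G (s e * (y - c e))) = (indicator Good y :: ennreal)" for y
    using E(1) by (auto simp: Good_def indicator_def)
  have bad: "emeasure lborel (Bad e) \<le> ennreal \<eta>" if e: "e \<in> E" for e
  proof -
    have "emeasure lborel (Bad e) \<le> emeasure lborel ((\<lambda>y. s e * (y - c e)) -` ({-a..a} - G))"
      using c[OF e] s[OF e] by (intro emeasure_mono) (auto simp: Bad_def intro!: measurable_sets_borel[where M=borel])
    also have "\<dots> = (\<integral>\<^sup>+ y. indicator ({-a..a} - G) (s e * (y - c e)) \<partial>lborel)"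
      by (subst nn_integral_indicator[symmetric])
         (auto intro!: nn_integral_cong measurable_sets_borel[where M=borel] simp: indicator_def)
    also have "\<dots> = (\<integral>\<^sup>+ y. indicator ({-a..a} - G) (s e * y) \<partial>lborel)"
      by (rule nn_integral_lborel_shift[where g = "\<lambda>y. indicator ({-a..a} - G) (s e * y)"]) measurable
    also have "\<dots> = (\<integral>\<^sup>+ y. indicator ({-a..a} - G) y \<partial>lborel)"
      using nn_integral_real_affine[of "indicator ({-a..a} - G)" "s e" 0] s[OF e] by auto
    also have "\<dots> \<le> ennreal \<eta>" using eta by simp
    finally show ?thesis .
  qed
  have "{0..a} \<subseteq> Good \<union> (\<Union>e\<in>E. Bad e)" by (auto simp: Good_def Bad_def)
  then have "emeasure lborel {0..a} \<le> emeasure lborel (Good \<union> (\<Union>e\<in>E. Bad e))"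
    using E by (intro emeasure_mono) (auto intro!: sets.Un sets.finite_UN)
  also have "\<dots> \<le> emeasure lborel Good + emeasure lborel (\<Union>e\<in>E. Bad e)"
    using E by (intro emeasure_subadditive) auto
  also have "emeasure lborel (\<Union>e\<in>E. Bad e) \<le> (\<Sum>e\<in>E. emeasure lborel (Bad e))"
    using E by (intro emeasure_subadditive_finite) auto
  also have "\<dots> \<le> (\<Sum>e\<in>E. ennreal \<eta>)" by (intro sum_mono bad)
  also have "\<dots> = ennreal (real (card E) * \<eta>)" using eta0 by (simp add: ennreal_mult ennreal_of_nat_eq_real_of_nat)
  also have "\<dots> \<le> ennreal (a / 2)"
    using k E(2) eta0 mult_right_mono[of "real (card E)" "real k" \<eta>] by (intro ennreal_leI) auto
  finally have "ennreal a \<le> emeasure lborel Good + ennreal (a / 2)"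
    using a by (simp add: add_left_mono)
  moreover have "ennreal a = ennreal (a / 2) + ennreal (a / 2)"
    using a by (simp flip: ennreal_plus)
  ultimately have "ennreal (a / 2) + ennreal (a / 2) \<le> ennreal (a / 2) + emeasure lborel Good"
    by (simp only: add.commute)
  then have "ennreal (a / 2) \<le> emeasure lborel Good"
    by (simp only: ennreal_add_left_cancel_le) simp
  then show ?thesis unfolding ind by simp
qed

text \<open>Vertices are placed one at a time. A new vertex only has to respect its edges to
  vertices placed before, and whatever their heights in the box, at least half of
  \<open>{0..a}\<close> stays admissible.\<close>

lemma nn_integral_all_good_ge:
  fixes G :: "real set" and a \<eta> :: real and D :: "('v \<times> 'v) set"
  assumes a: "0 < a" and G: "G \<in> sets borel" and eta: "emeasure lborel ({-a..a} - G) \<le> ennreal \<eta>"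
    and k: "real k * \<eta> \<le> a / 2" and eta0: "0 \<le> \<eta>"
    and V: "finite V" and D: "D \<subseteq> V \<times> V" and noloop: "\<And>v. (v, v) \<notin> D"
    and deg: "\<And>v. card {e\<in>D. fst e = v \<or> snd e = v} \<le> k"
  shows "ennreal ((a / 2) ^ card V)
    \<le> (\<integral>\<^sup>+ x. (\<Prod>v\<in>V. indicator {0..a} (x v)) * edge_prod D (\<lambda>_. indicator G) x \<partial>leb V)"
  using V D noloop deg
proof (induction V arbitrary: D rule: finite_induct)
  case empty
  then show ?case using leb.nn_integral_empty[of "\<lambda>_ :: 'v \<Rightarrow> real. 1"] by (simp add: edge_prod_def del: nn_integral_const)
next
  case (insert v W)
  define Dv where "Dv = {e\<in>D. fst e = v \<or> snd e = v}"
  define DW where "DW = D - Dv"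
  have finD: "finite D" using insert by (meson finite_SigmaI finite_insert finite_subset)
  have DW: "DW \<subseteq> W \<times> W" using insert by (auto simp: DW_def Dv_def)
  have finv: "finite Dv" "finite DW" using finD by (auto simp: Dv_def DW_def)
  have IH: "ennreal ((a / 2) ^ card W)
    \<le> (\<integral>\<^sup>+ x. (\<Prod>v\<in>W. indicator {0..a} (x v)) * edge_prod DW (\<lambda>_. indicator G) x \<partial>leb W)"
  proof (rule insert.IH[OF DW])
    show "(u, u) \<notin> DW" for u using insert.prems by (auto simp: DW_def)
    show "card {e \<in> DW. fst e = u \<or> snd e = u} \<le> k" for u
    proof -
      have "card {e \<in> DW. fst e = u \<or> snd e = u} \<le> card {e \<in> D. fst e = u \<or> snd e = u}"
        using finD by (intro card_mono) (auto simp: DW_def)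
      also have "\<dots> \<le> k" by (rule insert.prems(3))
      finally show ?thesis .
    qed
  qed
  note [measurable] = G
  have edge_meas: "edge_prod E (\<lambda>_. indicator G) \<in> borel_measurable (leb X)" if "E \<subseteq> X \<times> X" for E X
    using that by (intro edge_prod_measurable) auto
  \<comment> \<open>The endpoint other than \<open>v\<close>, and the sign with which the height of
    \<open>v\<close> enters the difference along the edge.\<close>
  define oth where "oth = (\<lambda>e :: 'v \<times> 'v. if fst e = v then snd e else fst e :: 'v)"
  define sg where "sg = (\<lambda>e :: 'v \<times> 'v. if fst e = v then 1 else -1 :: real)"
  have oth: "oth e \<in> W" if "e \<in> Dv" for e
    using that insert.prems(1,2) by (cases e) (auto simp: Dv_def oth_def)
  let ?P = "\<lambda>x. (\<Prod>v\<in>W. indicator {0..a} (x v)) * edge_prod DW (\<lambda>_. indicator G) x :: ennreal"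
  let ?F = "\<lambda>x. (\<Prod>v\<in>insert v W. indicator {0..a} (x v)) * edge_prod D (\<lambda>_. indicator G) x :: ennreal"
  have box_meas: "(\<lambda>x. \<Prod>v\<in>X. indicator {0..a} (x v) :: ennreal) \<in> borel_measurable (leb X)" for X :: "'v set"
    by (rule borel_measurable_prod_ennreal) measurable
  have F_meas: "?F \<in> borel_measurable (leb (insert v W))"
    by (rule borel_measurable_times_ennreal[OF box_meas edge_meas[OF insert.prems(1)]])
  have P_meas: "?P \<in> borel_measurable (leb W)"
    by (rule borel_measurable_times_ennreal[OF box_meas edge_meas[OF DW]])
  have upd: "?F (x(v := y)) = ?P x * (indicator {0..a} y * (\<Prod>e\<in>Dv. indicator G (sg e * (y - x (oth e)))))" for x y
  proof -
    have "(\<Prod>u\<in>insert v W. indicator {0..a} ((x(v := y)) u) :: ennreal)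
        = indicator {0..a} y * (\<Prod>u\<in>W. indicator {0..a} (x u))"
    proof -
      have "(\<Prod>u\<in>W. indicator {0..a} ((x(v := y)) u) :: ennreal) = (\<Prod>u\<in>W. indicator {0..a} (x u))"
        using insert.hyps by (intro prod.cong) auto
      then show ?thesis using insert.hyps by simp
    qed
    moreover have "edge_prod D (\<lambda>_. indicator G) (x(v := y))
        = edge_prod DW (\<lambda>_. indicator G) (x(v := y)) * edge_prod Dv (\<lambda>_. indicator G) (x(v := y))"
    proof -
      have D_eq: "D = DW \<union> Dv" and disj: "DW \<inter> Dv = {}" by (auto simp: DW_def Dv_def)
      show ?thesis unfolding edge_prod_def
        by (subst D_eq) (rule prod.union_disjoint[OF finv(2,1) disj])
    qed
    moreover have "edge_prod DW (\<lambda>_. indicator G) (x(v := y)) = edge_prod DW (\<lambda>_. indicator G) x"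
      using DW insert.hyps by (intro edge_prod_cong) auto
    moreover have "edge_prod Dv (\<lambda>_. indicator G) (x(v := y))
        = (\<Prod>e\<in>Dv. indicator G (sg e * (y - x (oth e))))"
      unfolding edge_prod_def
      using insert.prems(2) by (intro prod.cong) (auto simp: Dv_def sg_def oth_def)
    ultimately show ?thesis by (simp add: mult_ac)
  qed
  have "ennreal ((a / 2) ^ card (insert v W)) = ennreal ((a / 2) ^ card W) * ennreal (a / 2)"
  proof -
    have "(a / 2) ^ card (insert v W) = (a / 2) ^ card W * (a / 2)" using insert.hyps by simp
    moreover have "ennreal ((a / 2) ^ card W * (a / 2)) = ennreal ((a / 2) ^ card W) * ennreal (a / 2)"
      using a by (intro ennreal_mult) auto
    ultimately show ?thesis by (simp only:)
  qed
  also have "\<dots> \<le> (\<integral>\<^sup>+ x. ?P x \<partial>leb W) * ennreal (a / 2)" by (rule mult_right_mono[OF IH]) simp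
  also have "\<dots> = (\<integral>\<^sup>+ x. ?P x * ennreal (a / 2) \<partial>leb W)"
    by (rule nn_integral_multc[OF P_meas, symmetric])
  also have "\<dots> \<le> (\<integral>\<^sup>+ x. (\<integral>\<^sup>+ y. ?F (x(v := y)) \<partial>lborel) \<partial>leb W)"
  proof (rule nn_integral_mono)
    fix x
    show "?P x * ennreal (a / 2) \<le> (\<integral>\<^sup>+ y. ?F (x(v := y)) \<partial>lborel)"
    proof (cases "\<forall>u\<in>W. x u \<in> {0..a}")
      case True
      have "ennreal (a / 2) \<le> (\<integral>\<^sup>+ y. indicator {0..a} y * (\<Prod>e\<in>Dv. indicator G (sg e * (y - x (oth e)))) \<partial>lborel)"
        using True oth insert.prems(3)[of v]
        by (intro emeasure_all_good_ge[OF a G eta k finv(1) _ eta0]) (auto simp: sg_def Dv_def)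
      then have "?P x * ennreal (a / 2) \<le> ?P x * (\<integral>\<^sup>+ y. indicator {0..a} y * (\<Prod>e\<in>Dv. indicator G (sg e * (y - x (oth e)))) \<partial>lborel)"
        by (rule mult_left_mono) simp
      also have "\<dots> = (\<integral>\<^sup>+ y. ?F (x(v := y)) \<partial>lborel)"
        unfolding upd by (rule nn_integral_cmult[symmetric]) measurable
      finally show ?thesis .
    next
      \<comment> \<open>Outside the box the left side vanishes, so the union bound is needed only
        for heights in \<open>{0..a}\<close>.\<close>
      case False
      then have "(\<Prod>v\<in>W. indicator {0..a} (x v)) = (0 :: ennreal)"
        using insert.hyps by (auto simp: indicator_def)
      then show ?thesis by (simp only: mult_zero_left zero_le)
    qed
  qed
  also have "\<dots> = (\<integral>\<^sup>+ x. ?F x \<partial>leb (insert v W))"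
    by (rule leb.product_nn_integral_insert[OF insert.hyps F_meas, symmetric])
  finally show ?case .
qed

text \<open>Restricting all heights to \<open>{0..a}\<close> and all differences to the set where
  \<open>q\<close> is at least \<open>\<epsilon>\<close> leaves a factor \<open>\<epsilon>\<close>
  per edge and \<open>a / 2\<close> per vertex.\<close>

lemma pinned_mass_lower:
  fixes a \<eta> \<epsilon> :: real and D :: "('v \<times> 'v) set" and q :: "real \<Rightarrow> ennreal"
  assumes a: "0 < a" "a \<le> 1" and q: "q \<in> borel_measurable borel" and eps: "0 \<le> \<epsilon>"
    and eta: "emeasure lborel {x\<in>{-a..a}. q x < ennreal \<epsilon>} \<le> ennreal \<eta>"
    and k: "real k * \<eta> \<le> a / 2" and eta0: "0 \<le> \<eta>"
    and V: "finite V" and D: "D \<subseteq> V \<times> V" and noloop: "\<And>v. (v, v) \<notin> D"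
    and deg: "\<And>v. card {e\<in>D. fst e = v \<or> snd e = v} \<le> k" and p: "p \<in> V"
  shows "ennreal (\<epsilon> ^ card D * (a / 2) ^ card V) \<le> pinned_mass V D (\<lambda>_. q) p"
proof -
  define G where "G = {x. ennreal \<epsilon> \<le> q x}"
  have G: "G \<in> sets borel" unfolding G_def using q by measurable
  have "{-a..a} - G = {x\<in>{-a..a}. q x < ennreal \<epsilon>}" by (auto simp: G_def)
  note * = nn_integral_all_good_ge[OF a(1) G eta[folded this] k eta0 V D noloop deg]
  have finD: "finite D" using D V by (meson finite_SigmaI finite_subset)
  have m: "(\<lambda>x. (\<Prod>v\<in>V. indicator {0..a} (x v)) * edge_prod D (\<lambda>_. indicator G) x :: ennreal) \<in> borel_measurable (leb V)"
    using D G by (intro borel_measurable_times_ennreal borel_measurable_prod_ennreal edge_prod_measurable) auto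
  have "ennreal (\<epsilon> ^ card D * (a / 2) ^ card V) = ennreal (\<epsilon> ^ card D) * ennreal ((a / 2) ^ card V)"
    using a eps by (simp add: ennreal_mult)
  also have "\<dots> \<le> ennreal (\<epsilon> ^ card D) * (\<integral>\<^sup>+ x. (\<Prod>v\<in>V. indicator {0..a} (x v)) * edge_prod D (\<lambda>_. indicator G) x \<partial>leb V)"
    by (rule mult_left_mono[OF *]) simp
  also have "\<dots> = (\<integral>\<^sup>+ x. ennreal (\<epsilon> ^ card D) * ((\<Prod>v\<in>V. indicator {0..a} (x v)) * edge_prod D (\<lambda>_. indicator G) x) \<partial>leb V)"
    by (rule nn_integral_cmult[OF m, symmetric])
  also have "\<dots> \<le> pinned_mass V D (\<lambda>_. q) p"
    unfolding pinned_mass_def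
  proof (rule nn_integral_mono)
    fix x :: "'v \<Rightarrow> real"
    \<comment> \<open>Here \<open>a \<le> 1\<close> matters: the box has to fit into the window of
      the pin.\<close>
    have "(\<Prod>v\<in>V. indicator {0..a} (x v)) \<le> (indicator {0..1} (x p) :: ennreal)"
    proof (cases "x p \<in> {0..1}")
      case True
      then show ?thesis by (auto intro!: prod_le_1 simp: indicator_def)
    next
      case False
      then have "indicator {0..a} (x p) = (0::ennreal)" using a by (auto simp: indicator_def)
      then have "(\<Prod>v\<in>V. indicator {0..a} (x v)) = (0::ennreal)"
        using V p by (intro prod_zero) auto
      then show ?thesis by (simp only: zero_le)
    qed
    moreover have "ennreal (\<epsilon> ^ card D) * edge_prod D (\<lambda>_. indicator G) x \<le> edge_prod D (\<lambda>_. q) x"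
    proof -
      have "ennreal (\<epsilon> ^ card D) * edge_prod D (\<lambda>_. indicator G) x
         = (\<Prod>e\<in>D. ennreal \<epsilon> * indicator G (x (fst e) - x (snd e)))"
        using eps by (simp add: edge_prod_def prod.distrib ennreal_power)
      also have "\<dots> \<le> edge_prod D (\<lambda>_. q) x"
        unfolding edge_prod_def by (rule prod_mono_ennreal) (auto simp: G_def indicator_def)
      finally show ?thesis .
    qed
    ultimately have "(\<Prod>v\<in>V. indicator {0..a} (x v)) * (ennreal (\<epsilon> ^ card D) * edge_prod D (\<lambda>_. indicator G) x)
        \<le> indicator {0..1} (x p) * edge_prod D (\<lambda>_. q) x"
      by (rule mult_mono) auto
    then show "ennreal (\<epsilon> ^ card D) * ((\<Prod>v\<in>V. indicator {0..a} (x v)) * edge_prod D (\<lambda>_. indicator G) x)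
        \<le> indicator {0..1} (x p) * edge_prod D (\<lambda>_. q) x"
      by (simp add: mult_ac)
  qed
  finally show ?thesis .
qed

section \<open>Reflections of the torus\<close>

definition torus_D :: "nat \<Rightarrow> ((int \<times> int) \<times> (int \<times> int)) set" where
  "torus_D n = {(v, w). torus_adj n v w}"

text \<open>The representative of \<open>x\<close> modulo \<open>2 * int n\<close> in the range of
  torus coordinates.\<close>

definition wrap :: "nat \<Rightarrow> int \<Rightarrow> int" where
  "wrap n x = (x + int n - 1) mod (2 * int n) - int n + 1"

text \<open>The mass with these weights is the unnormalised probability that all gradients on
  \<open>S\<close> have absolute value at least \<open>L\<close>.\<close>

definition tilt :: "(real \<Rightarrow> ennreal) \<Rightarrow> real \<Rightarrow> 'e set \<Rightarrow> 'e \<Rightarrow> real \<Rightarrow> ennreal" where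
  "tilt q L S e x = q x * (if e \<in> S then indicator {x. L \<le> \<bar>x\<bar>} x else 1)"

lemma tilt_measurable: "q \<in> borel_measurable borel \<Longrightarrow> tilt q L S e \<in> borel_measurable borel"
proof -
  assume [measurable]: "q \<in> borel_measurable borel"
  have [measurable]: "{x :: real. L \<le> \<bar>x\<bar>} \<in> sets borel" by measurable
  show ?thesis unfolding tilt_def[abs_def] by (cases "e \<in> S") simp_all
qed

lemma tilt_antimono: "S \<subseteq> T \<Longrightarrow> tilt q L T e x \<le> tilt q L S e x"
  unfolding tilt_def by (intro mult_left_mono) (auto simp: indicator_def)

lemma tilt_empty [simp]: "tilt q L {} e = q"
  by (auto simp: tilt_def)

section \<open>Arithmetic modulo the side length\<close>

lemma wrap_range: "n \<ge> 1 \<Longrightarrow> wrap n x \<in> {- int n + 1..int n}"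
proof -
  assume "n \<ge> 1"
  then have "0 \<le> (x + int n - 1) mod (2 * int n)" "(x + int n - 1) mod (2 * int n) < 2 * int n" by auto
  then show ?thesis by (auto simp: wrap_def)
qed

lemma wrap_mod: "wrap n x mod (2 * int n) = x mod (2 * int n)"
proof -
  have "wrap n x mod (2 * int n) = ((x + int n - 1) mod (2 * int n) - (int n - 1)) mod (2 * int n)"
    by (simp add: wrap_def algebra_simps)
  also have "\<dots> = ((x + int n - 1) - (int n - 1)) mod (2 * int n)" by (rule mod_diff_left_eq)
  finally show ?thesis by simp
qed

lemma wrap_cong: "x mod (2 * int n) = y mod (2 * int n) \<Longrightarrow> wrap n x = wrap n y"
  unfolding wrap_def by (metis add_diff_eq mod_add_left_eq)

lemma wrap_id: "n \<ge> 1 \<Longrightarrow> x \<in> {- int n + 1..int n} \<Longrightarrow> wrap n x = x"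
  unfolding wrap_def by (subst mod_pos_pos_trivial) auto

lemma eq_if_mod_eq:
  "n \<ge> 1 \<Longrightarrow> x \<in> {- int n + 1..int n} \<Longrightarrow> y \<in> {- int n + 1..int n} \<Longrightarrow> x mod (2 * int n) = y mod (2 * int n) \<Longrightarrow> x = y"
  by (metis wrap_cong wrap_id)

lemma wrap_mod2: "wrap n x mod 2 = x mod 2"
proof -
  have "wrap n x mod (2 * int n) mod 2 = x mod (2 * int n) mod 2" by (simp add: wrap_mod)
  then show ?thesis by (simp add: mod_mod_cancel)
qed

lemma mod_diff_cong:
  fixes a b a' b' N :: int
  assumes "a mod N = a' mod N" "b mod N = b' mod N"
  shows "(a - b) mod N = (a' - b') mod N"
  using assms by (metis mod_diff_eq)

lemma finite_torus_V: "finite (torus_V n)"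
  by (simp add: torus_V_def)

lemma torus_D_subset: "torus_D n \<subseteq> torus_V n \<times> torus_V n"
  by (auto simp: torus_D_def torus_adj_def)

lemma finite_torus_D: "finite (torus_D n)"
  using torus_D_subset finite_torus_V by (meson finite_SigmaI finite_subset)

lemma origin_in_torus: "n \<ge> 1 \<Longrightarrow> (0, 0) \<in> torus_V n"
  by (auto simp: torus_V_def)

lemma torus_D_iff:
  "((x, y), (x', y')) \<in> torus_D n \<longleftrightarrow>
     x \<in> {- int n + 1..int n} \<and> y \<in> {- int n + 1..int n} \<and> x' \<in> {- int n + 1..int n} \<and> y' \<in> {- int n + 1..int n} \<and>
     (x = x' \<and> ((y - y') mod (2 * int n) = 1 \<or> (y' - y) mod (2 * int n) = 1) \<or>
      y = y' \<and> ((x - x') mod (2 * int n) = 1 \<or> (x' - x) mod (2 * int n) = 1))"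
  by (auto simp: torus_D_def torus_adj_def torus_V_def diff_one_mod_def)

text \<open>Distance of the column \<open>x\<close> from the reflection axis \<open>j\<close> in the positive direction; the axis also
  contains the antipodal column \<open>j + n\<close>.\<close>

definition offset :: "nat \<Rightarrow> int \<Rightarrow> int \<Rightarrow> int" where
  "offset n j x = (x - j) mod (2 * int n)"

definition axis_refl :: "nat \<Rightarrow> int \<Rightarrow> int \<times> int \<Rightarrow> int \<times> int" where
  "axis_refl n j v = (wrap n (2 * j - fst v), snd v)"

lemma offset_bounds: "n \<ge> 1 \<Longrightarrow> 0 \<le> offset n j x \<and> offset n j x < 2 * int n"
  by (simp add: offset_def)

lemma offset_step:
  assumes "n \<ge> 1" "(x' - x) mod (2 * int n) = 1"
  shows "offset n j x' = (if offset n j x = 2 * int n - 1 then 0 else offset n j x + 1)"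
proof -
  have "offset n j x' = ((x - j) + (x' - x)) mod (2 * int n)" by (simp add: offset_def)
  also have "\<dots> = ((x - j) mod (2 * int n) + (x' - x) mod (2 * int n)) mod (2 * int n)" by (simp add: mod_add_eq)
  also have "\<dots> = (offset n j x + 1) mod (2 * int n)" by (simp add: offset_def assms)
  also have "\<dots> = (if offset n j x = 2 * int n - 1 then 0 else offset n j x + 1)"
    using offset_bounds[OF assms(1), of j x] by auto
  finally show ?thesis .
qed

lemma offset_pred:
  assumes "n \<ge> 1"
  shows "offset n j (x - 1) = (if offset n j x = 0 then 2 * int n - 1 else offset n j x - 1)"
proof -
  have "offset n j x = (if offset n j (x - 1) = 2 * int n - 1 then 0 else offset n j (x - 1) + 1)"
    using assms by (intro offset_step) auto
  then show ?thesis using offset_bounds[OF assms, of j "x - 1"] by (auto split: if_splits)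
qed

lemma offset_axis_refl:
  assumes "n \<ge> 1"
  shows "offset n j (wrap n (2 * j - x)) = (if offset n j x = 0 then 0 else 2 * int n - offset n j x)"
proof -
  have "offset n j (wrap n (2 * j - x)) = ((2 * j - x) - j) mod (2 * int n)"
    unfolding offset_def by (rule mod_diff_cong) (auto simp: wrap_mod)
  also have "\<dots> = (- (x - j)) mod (2 * int n)" by simp
  also have "\<dots> = (if offset n j x = 0 then 0 else 2 * int n - offset n j x)"
    unfolding zmod_zminus1_eq_if offset_def by (rule refl)
  finally show ?thesis .
qed

lemma axis_refl_diff:
  "(wrap n (2 * j - x) - wrap n (2 * j - x')) mod (2 * int n) = (x' - x) mod (2 * int n)"
proof -
  have "(wrap n (2 * j - x) - wrap n (2 * j - x')) mod (2 * int n) = ((2 * j - x) - (2 * j - x')) mod (2 * int n)"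
    by (rule mod_diff_cong) (auto simp: wrap_mod)
  then show ?thesis by simp
qed

text \<open>Open halves: the columns at offset \<open>0\<close> and \<open>int n\<close> form the
  axis and belong to neither side.\<close>

definition side_L :: "nat \<Rightarrow> int \<Rightarrow> (int \<times> int) set" where
  "side_L n j = {v \<in> torus_V n. 0 < offset n j (fst v) \<and> offset n j (fst v) < int n}"

definition side_R :: "nat \<Rightarrow> int \<Rightarrow> (int \<times> int) set" where
  "side_R n j = {v \<in> torus_V n. int n < offset n j (fst v)}"

text \<open>Tilting by this set is the symmetrised weight of \<open>reflection_positivity\<close> in
  which the left half is kept and copied to the right.\<close>

definition edges_L :: "nat \<Rightarrow> int \<Rightarrow> ((int \<times> int) \<times> (int \<times> int)) set \<Rightarrow> ((int \<times> int) \<times> (int \<times> int)) set" where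
  "edges_L n j S = {e. if fst e \<in> side_R n j \<or> snd e \<in> side_R n j
      then map_prod (axis_refl n j) (axis_refl n j) e \<in> S else e \<in> S}"

definition edges_R :: "nat \<Rightarrow> int \<Rightarrow> ((int \<times> int) \<times> (int \<times> int)) set \<Rightarrow> ((int \<times> int) \<times> (int \<times> int)) set" where
  "edges_R n j S = {e. if fst e \<in> side_L n j \<or> snd e \<in> side_L n j
      then map_prod (axis_refl n j) (axis_refl n j) e \<in> S else e \<in> S}"

definition torus_mass :: "nat \<Rightarrow> (real \<Rightarrow> ennreal) \<Rightarrow> real \<Rightarrow> ((int \<times> int) \<times> (int \<times> int)) set \<Rightarrow> ennreal" where
  "torus_mass n q L S = pinned_mass (torus_V n) (torus_D n) (tilt q L S) (0, 0)"

lemma torus_mass_antimono: "S \<subseteq> T \<Longrightarrow> torus_mass n q L T \<le> torus_mass n q L S"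
  unfolding torus_mass_def by (intro pinned_mass_mono tilt_antimono)

lemma torus_mass_pin:
  assumes "n \<ge> 1" "q \<in> borel_measurable borel" "p \<in> torus_V n"
  shows "torus_mass n q L S = pinned_mass (torus_V n) (torus_D n) (tilt q L S) p"
  unfolding torus_mass_def
  using assms finite_torus_V torus_D_subset origin_in_torus by (intro pinned_mass_pin tilt_measurable) auto

lemma torus_reflection:
  assumes n: "n \<ge> 1" and q: "q \<in> borel_measurable borel"
  shows "(torus_mass n q L S)\<^sup>2 \<le> torus_mass n q L (edges_L n j S) * torus_mass n q L (edges_R n j S)"
proof -
  let ?V0 = "{v \<in> torus_V n. offset n j (fst v) = 0 \<or> offset n j (fst v) = int n}"
  let ?A = "side_L n j" and ?B = "side_R n j" and ?r = "axis_refl n j"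
  \<comment> \<open>A vertex on the axis, since the pin must be fixed by the reflection; the pin at
    the origin is moved there.\<close>
  let ?p = "(wrap n j, 0 :: int)"
  have p: "?p \<in> ?V0"
  proof -
    have "offset n j (wrap n j) = (j - j) mod (2 * int n)"
      unfolding offset_def by (rule mod_diff_cong) (auto simp: wrap_mod)
    then show ?thesis using wrap_range[OF n, of j] n by (auto simp: torus_V_def)
  qed
  have "(pinned_mass (torus_V n) (torus_D n) (tilt q L S) ?p)\<^sup>2
    \<le> pinned_mass (torus_V n) (torus_D n)
        (\<lambda>e. if fst e \<in> ?B \<or> snd e \<in> ?B then tilt q L S (map_prod ?r ?r e) else tilt q L S e) ?p
    * pinned_mass (torus_V n) (torus_D n)
        (\<lambda>e. if fst e \<in> ?A \<or> snd e \<in> ?A then tilt q L S (map_prod ?r ?r e) else tilt q L S e) ?p"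
  proof (rule reflection_positivity[where ?V0.0 = ?V0 and A = ?A and B = ?B])
    show "finite ?V0" "finite ?A" "finite ?B"
      using finite_torus_V by (auto simp: side_L_def side_R_def)
    show "?V0 \<inter> ?A = {}" "?V0 \<inter> ?B = {}" "?A \<inter> ?B = {}"
      by (auto simp: side_L_def side_R_def)
    show "torus_V n = ?V0 \<union> ?A \<union> ?B"
    proof -
      have "v \<in> ?V0 \<union> ?A \<union> ?B" if "v \<in> torus_V n" for v
        using that offset_bounds[OF n, of j "fst v"] by (auto simp: side_L_def side_R_def)
      then show ?thesis by (auto simp: side_L_def side_R_def)
    qed
    show "torus_D n \<subseteq> torus_V n \<times> torus_V n" by (rule torus_D_subset)
    show "tilt q L S e \<in> borel_measurable borel" for e by (rule tilt_measurable[OF q])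
    show "?p \<in> ?V0" by (rule p)
    have rV: "?r v \<in> torus_V n" if "v \<in> torus_V n" for v
      using that wrap_range[OF n, of "2 * j - fst v"] by (auto simp: axis_refl_def torus_V_def)
    show "?r v = v" if "v \<in> ?V0" for v
    proof -
      have "(2 * j - fst v) mod (2 * int n) = fst v mod (2 * int n)"
      proof -
        have "offset n j (wrap n (2 * j - fst v)) = offset n j (fst v)"
          using that n by (auto simp: offset_axis_refl[OF n])
        then have "(wrap n (2 * j - fst v) - j) mod (2 * int n) = (fst v - j) mod (2 * int n)"
          by (simp add: offset_def)
        then have "(wrap n (2 * j - fst v) - j + j) mod (2 * int n) = (fst v - j + j) mod (2 * int n)"
          by (rule mod_add_cong) simp
        then show ?thesis by (simp add: wrap_mod)
      qed
      then have "wrap n (2 * j - fst v) = wrap n (fst v)" by (rule wrap_cong)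
      then show ?thesis using that by (auto simp: axis_refl_def torus_V_def wrap_id[OF n])
    qed
    show "?r v \<in> ?B" if "v \<in> ?A" for v
      using that rV[of v] by (auto simp: side_L_def side_R_def axis_refl_def offset_axis_refl[OF n])
    show "?r v \<in> ?A" if "v \<in> ?B" for v
      using that rV[of v] offset_bounds[OF n, of j "fst v"]
      by (auto simp: side_L_def side_R_def axis_refl_def offset_axis_refl[OF n])
    show "?r (?r v) = v" if "v \<in> torus_V n" for v
    proof -
      have "(2 * j - wrap n (2 * j - fst v)) mod (2 * int n) = (2 * j - (2 * j - fst v)) mod (2 * int n)"
        by (rule mod_diff_cong) (auto simp: wrap_mod)
      then have "wrap n (2 * j - wrap n (2 * j - fst v)) = wrap n (fst v)"
        by (intro wrap_cong) simp
      then show ?thesis using that by (auto simp: axis_refl_def torus_V_def wrap_id[OF n])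
    qed
    show "(?r v, ?r w) \<in> torus_D n" if "(v, w) \<in> torus_D n" for v w
    proof -
      obtain x y x' y' where [simp]: "v = (x, y)" "w = (x', y')" by (cases v, cases w)
      from that show ?thesis
        using wrap_range[OF n, of "2 * j - x"] wrap_range[OF n, of "2 * j - x'"]
        by (auto simp: axis_refl_def torus_D_iff axis_refl_diff)
    qed
    show "\<not> (v \<in> ?A \<and> w \<in> ?B) \<and> \<not> (v \<in> ?B \<and> w \<in> ?A)" if "(v, w) \<in> torus_D n" for v w
    proof -
      obtain x y x' y' where [simp]: "v = (x, y)" "w = (x', y')" by (cases v, cases w)
      from that have "x = x' \<or> (x - x') mod (2 * int n) = 1 \<or> (x' - x) mod (2 * int n) = 1"
        by (auto simp: torus_D_iff)
      then show ?thesis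
        using offset_step[OF n, of x x' j] offset_step[OF n, of x' x j]
        by (auto simp: side_L_def side_R_def split: if_splits)
    qed
  qed
  moreover have "pinned_mass (torus_V n) (torus_D n)
        (\<lambda>e. if fst e \<in> ?B \<or> snd e \<in> ?B then tilt q L S (map_prod ?r ?r e) else tilt q L S e) ?p
      = pinned_mass (torus_V n) (torus_D n) (tilt q L (edges_L n j S)) ?p"
    by (rule pinned_mass_cong) (auto simp: tilt_def edges_L_def)
  moreover have "pinned_mass (torus_V n) (torus_D n)
        (\<lambda>e. if fst e \<in> ?A \<or> snd e \<in> ?A then tilt q L S (map_prod ?r ?r e) else tilt q L S e) ?p
      = pinned_mass (torus_V n) (torus_D n) (tilt q L (edges_R n j S)) ?p"
    by (rule pinned_mass_cong) (auto simp: tilt_def edges_R_def)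
  moreover have "?p \<in> torus_V n" using p by auto
  ultimately show ?thesis using torus_mass_pin[OF n q] by simp
qed

text \<open>Reflections are set up for vertical axes only; exchanging the coordinates gives access
  to the horizontal ones.\<close>

lemma torus_mass_swap:
  assumes n: "n \<ge> 1" and q: "q \<in> borel_measurable borel"
  shows "torus_mass n q L {e. map_prod prod.swap prod.swap e \<in> S} = torus_mass n q L S"
proof -
  have b: "bij_betw prod.swap (torus_V n) (torus_V n)"
    by (rule bij_betw_byWitness[where f' = prod.swap]) (auto simp: torus_V_def)
  have bD: "bij_betw (map_prod prod.swap prod.swap) (torus_D n) (torus_D n)"
    by (rule bij_betw_byWitness[where f' = "map_prod prod.swap prod.swap"]) (auto simp: torus_D_iff)
  have "tilt q L {e. map_prod prod.swap prod.swap e \<in> S} = (\<lambda>e. tilt q L S (map_prod prod.swap prod.swap e))"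
    by (auto simp: tilt_def fun_eq_iff)
  then show ?thesis
    using pinned_mass_reindex[of "torus_V n" "torus_D n" "tilt q L S" "(0, 0)" prod.swap,
        OF finite_torus_V torus_D_subset tilt_measurable[OF q] origin_in_torus[OF n] b bD]
    by (simp add: torus_mass_def)
qed

section \<open>Spreading edge sets\<close>

text \<open>A word over gaps: the letter \<open>c x\<close> lists the rows whose edge from column
  \<open>x\<close> to the next column is selected. Both orientations of the edge are
  included.\<close>

definition row_edges :: "nat \<Rightarrow> (int \<Rightarrow> int set) \<Rightarrow> ((int \<times> int) \<times> (int \<times> int)) set" where
  "row_edges n c = {((x, y), (x', y')) | x y x' y'. ((x, y), (x', y')) \<in> torus_D n \<and> y = y' \<and>
     ((x' - x) mod (2 * int n) = 1 \<and> y \<in> c x \<or> (x - x') mod (2 * int n) = 1 \<and> y \<in> c x')}"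

definition column_edges :: "nat \<Rightarrow> int set \<Rightarrow> ((int \<times> int) \<times> (int \<times> int)) set" where
  "column_edges n J = {((x, y), (x', y')) | x y x' y'. ((x, y), (x', y')) \<in> torus_D n \<and> x = x' \<and> x \<in> J}"

lemma row_edges_iff:
  "((x, y), (x', y')) \<in> row_edges n c \<longleftrightarrow> ((x, y), (x', y')) \<in> torus_D n \<and> y = y' \<and>
     ((x' - x) mod (2 * int n) = 1 \<and> y \<in> c x \<or> (x - x') mod (2 * int n) = 1 \<and> y \<in> c x')"
  by (auto simp: row_edges_def)

lemma column_edges_iff:
  "((x, y), (x', y')) \<in> column_edges n J \<longleftrightarrow> ((x, y), (x', y')) \<in> torus_D n \<and> x = x' \<and> x \<in> J"
  by (auto simp: column_edges_def)

lemma torus_D_sym: "(v, w) \<in> torus_D n \<Longrightarrow> (w, v) \<in> torus_D n"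
  by (cases v, cases w) (auto simp: torus_D_iff)

lemma torus_D_refl: 
  assumes n: "n \<ge> 1" and e: "((x, y), (x', y')) \<in> torus_D n"
  shows "((wrap n (2 * j - x), y), (wrap n (2 * j - x'), y')) \<in> torus_D n"
  using e wrap_range[OF n, of "2 * j - x"] wrap_range[OF n, of "2 * j - x'"]
  by (auto simp: torus_D_iff axis_refl_diff)

lemma mod_eq_of_diff_one:
  fixes x x' :: int
  assumes "n \<ge> 1" "(x' - x) mod (2 * int n) = 1"
  shows "(a - x') mod (2 * int n) = (a - 1 - x) mod (2 * int n)"
proof -
  have "1 mod (2 * int n) = 1" using assms by simp
  then have "(a - x - (x' - x)) mod (2 * int n) = (a - x - 1) mod (2 * int n)"
    using assms by (intro mod_diff_cong) auto
  then show ?thesis by (simp add: algebra_simps)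
qed

text \<open>Mirroring reverses a gap: the image of the gap from \<open>x\<close> to
  \<open>x'\<close> starts at the image of \<open>x'\<close>, which is \<open>2 * j - 1 - x\<close>
  modulo the side length. The two conclusions are its two orientations.\<close>

lemma row_edges_refl:
  assumes n: "n \<ge> 1" and c: "\<And>i. c (i + 2 * int n) = c i"
    and e: "((x, y), (x', y)) \<in> torus_D n" and d: "(x' - x) mod (2 * int n) = 1"
    and y: "y \<in> c (2 * j - 1 - x)"
  shows "((wrap n (2 * j - x), y), (wrap n (2 * j - x'), y)) \<in> row_edges n c"
    and "((wrap n (2 * j - x'), y), (wrap n (2 * j - x), y)) \<in> row_edges n c"
proof -
  have "c (wrap n (2 * j - x')) = c (2 * j - 1 - x)"
    by (rule periodic_cong[where c = c, OF c]) (simp add: wrap_mod mod_eq_of_diff_one[OF n d])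
  then show "((wrap n (2 * j - x), y), (wrap n (2 * j - x'), y)) \<in> row_edges n c"
    "((wrap n (2 * j - x'), y), (wrap n (2 * j - x), y)) \<in> row_edges n c"
    using torus_D_refl[OF n e, of j] torus_D_refl[OF n torus_D_sym[OF e], of j] y d
    by (auto simp: row_edges_iff axis_refl_diff)
qed

text \<open>With only two columns, the gaps before and after a column consist of the same edges, and
  mirroring sends gap \<open>x\<close> to gap \<open>x'\<close>.\<close>

lemma row_letter_two:
  assumes n: "n = 1" and c: "\<And>i. c (i + 2 * int n) = c i" and d: "(x' - x) mod (2 * int n) = 1"
  shows "c (2 * j - 1 - x) = c x'"
proof (rule periodic_cong[where c = c, OF c])
  have "(x' - x) mod 2 = 1" using d n by simp
  then show "(2 * j - 1 - x) mod (2 * int n) = x' mod (2 * int n)" unfolding n by simp presburger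
qed

text \<open>Each gap lies in one closed half, so it is kept or mirrored as a whole. For
  \<open>n = 1\<close> the inclusion can be strict: both open halves are empty, so
  \<open>edges_L\<close> changes nothing, while \<open>refl_left\<close> forgets a letter.\<close>

lemma row_edges_refl_left:
  assumes n: "n \<ge> 1" and c: "\<And>i. c (i + 2 * int n) = c i"
  shows "row_edges n (refl_left n j c) \<subseteq> edges_L n j (row_edges n c)"
proof -
  have main: "((x, y), (x', y)) \<in> edges_L n j (row_edges n c) \<and> ((x', y), (x, y)) \<in> edges_L n j (row_edges n c)"
    if e: "((x, y), (x', y)) \<in> torus_D n" and d: "(x' - x) mod (2 * int n) = 1"
      and y: "y \<in> refl_left n j c x" for x x' y
  proof -
    note off = offset_bounds[OF n, of j x] offset_step[OF n d, of j]
    have V: "(x, y) \<in> torus_V n" "(x', y) \<in> torus_V n" using e torus_D_subset by auto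
    have B: "(x, y) \<in> side_R n j \<longleftrightarrow> int n < offset n j x" "(x', y) \<in> side_R n j \<longleftrightarrow> int n < offset n j x'"
      using V by (auto simp: side_R_def)
    have orig: "((x, y), (x', y)) \<in> row_edges n c \<and> ((x', y), (x, y)) \<in> row_edges n c" if "y \<in> c x \<or> n = 1 \<and> y \<in> c x'"
    proof -
      have "(x - x') mod (2 * int n) = 1" if "n = 1" using d unfolding that by simp presburger
      then show ?thesis using that e torus_D_sym[OF e] d by (auto simp: row_edges_iff)
    qed
    show ?thesis
    proof (cases "offset n j x < int n")
      case True
      then have "y \<in> c x" using y by (simp add: refl_left_def offset_def)
      moreover have "\<not> int n < offset n j x" "\<not> int n < offset n j x'" using True off by (auto split: if_splits)
      ultimately show ?thesis using orig B by (auto simp: edges_L_def)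
    next
      case False
      then have y': "y \<in> c (2 * j - 1 - x)" using y by (simp add: refl_left_def offset_def)
      show ?thesis
      proof (cases "int n < offset n j x \<or> int n < offset n j x'")
        case True
        then show ?thesis using row_edges_refl[OF n c e d y'] B by (auto simp: edges_L_def axis_refl_def)
      next
        case F: False
        \<comment> \<open>The gap starts on the antipodal axis column, but its end is not inside the
          right half. So the end is the other axis column, which is adjacent only if
          \<open>n = 1\<close>.\<close>
        have "offset n j x = int n" using False F by linarith
        then have "int n = 2 * int n - 1" using off(2) F by (metis zless_add1_eq)
        then have "n = 1" by linarith
        then have "y \<in> c x'" using row_letter_two[where c = c, OF _ c d] y' by simp
        then show ?thesis using orig \<open>n = 1\<close> B F by (auto simp: edges_L_def)
      qed
    qed
  qed
  show ?thesis
  proof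
    fix e assume e: "e \<in> row_edges n (refl_left n j c)"
    obtain x y x' y' where [simp]: "e = ((x, y), (x', y'))" by (metis surj_pair)
    show "e \<in> edges_L n j (row_edges n c)"
      using e main[of x y x'] main[of x' y x] torus_D_sym by (auto simp: row_edges_iff)
  qed
qed

lemma row_edges_refl_right:
  assumes n: "n \<ge> 1" and c: "\<And>i. c (i + 2 * int n) = c i"
  shows "row_edges n (refl_right n j c) \<subseteq> edges_R n j (row_edges n c)"
proof -
  have main: "((x, y), (x', y)) \<in> edges_R n j (row_edges n c) \<and> ((x', y), (x, y)) \<in> edges_R n j (row_edges n c)"
    if e: "((x, y), (x', y)) \<in> torus_D n" and d: "(x' - x) mod (2 * int n) = 1"
      and y: "y \<in> refl_right n j c x" for x x' y
  proof -
    note off = offset_bounds[OF n, of j x] offset_step[OF n d, of j]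
    have V: "(x, y) \<in> torus_V n" "(x', y) \<in> torus_V n" using e torus_D_subset by auto
    have A: "(x, y) \<in> side_L n j \<longleftrightarrow> 0 < offset n j x \<and> offset n j x < int n"
      "(x', y) \<in> side_L n j \<longleftrightarrow> 0 < offset n j x' \<and> offset n j x' < int n"
      using V by (auto simp: side_L_def)
    have orig: "((x, y), (x', y)) \<in> row_edges n c \<and> ((x', y), (x, y)) \<in> row_edges n c" if "y \<in> c x \<or> n = 1 \<and> y \<in> c x'"
    proof -
      have "(x - x') mod (2 * int n) = 1" if "n = 1" using d unfolding that by simp presburger
      then show ?thesis using that e torus_D_sym[OF e] d by (auto simp: row_edges_iff)
    qed
    show ?thesis
    proof (cases "offset n j x < int n")
      case False
      then have "y \<in> c x" using y by (simp add: refl_right_def offset_def)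
      moreover have "\<not> (0 < offset n j x' \<and> offset n j x' < int n)" using False off by (auto split: if_splits)
      ultimately show ?thesis using orig A False by (auto simp: edges_R_def)
    next
      case True
      then have y': "y \<in> c (2 * j - 1 - x)" using y by (simp add: refl_right_def offset_def)
      show ?thesis
      proof (cases "(x, y) \<in> side_L n j \<or> (x', y) \<in> side_L n j")
        case True
        then show ?thesis using row_edges_refl[OF n c e d y'] by (auto simp: edges_R_def axis_refl_def)
      next
        case F: False
        \<comment> \<open>The gap starts at the axis without entering the left half, so again it
          joins the two axis columns.\<close>
        then have "n = 1" using True off n A by (auto split: if_splits)
        then have "y \<in> c x'" using row_letter_two[where c = c, OF _ c d] y' by simp
        then show ?thesis using orig \<open>n = 1\<close> F by (auto simp: edges_R_def)
      qed
    qed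
  qed
  show ?thesis
  proof
    fix e assume e: "e \<in> row_edges n (refl_right n j c)"
    obtain x y x' y' where [simp]: "e = ((x, y), (x', y'))" by (metis surj_pair)
    show "e \<in> edges_R n j (row_edges n c)"
      using e main[of x y x'] main[of x' y x] torus_D_sym by (auto simp: row_edges_iff)
  qed
qed

text \<open>A column of parity \<open>p\<close> counts as switched on if one of the two letters next to it is. Reflections through
  the column itself may separate these letters, and then only switch the column off, which increases the mass.\<close>

definition parity_columns :: "int \<Rightarrow> (int \<Rightarrow> bool) \<Rightarrow> int set" where
  "parity_columns p c = {x. x mod 2 = p \<and> (c x \<or> c (x - 1))}"

text \<open>On the axis \<open>2 * j - x\<close> is congruent to \<open>x\<close>, so mirroring
  exchanges the two gaps beside the column.\<close>

lemma axis_letters: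
  assumes n: "n \<ge> 1" and c: "\<And>i. c (i + 2 * int n) = c i" and "offset n j x = 0 \<or> offset n j x = int n"
  shows "c (2 * j - x) = c x" "c (2 * j - 1 - x) = c (x - 1)"
proof -
  have off: "(x - j) mod (2 * int n) = 0 \<or> (x - j) mod (2 * int n) = int n"
    using assms(3) by (simp add: offset_def)
  have "2 * (x - j) mod (2 * int n) = 0"
    using off by (metis mod_mult_right_eq mod_mult_self1_is_0 mod_self mult_zero_right mod_0)
  then obtain k where k: "2 * (x - j) = 2 * int n * k" by (metis mod_eq_0_iff_dvd dvdE)
  have "2 * j - x = x + 2 * int n * (- k)" "2 * j - 1 - x = (x - 1) + 2 * int n * (- k)"
    using k by (auto simp: algebra_simps)
  then show "c (2 * j - x) = c x" "c (2 * j - 1 - x) = c (x - 1)"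
    using periodic_add_mult[where c = c, OF c] by metis+
qed

text \<open>Off the axis both gaps beside a column lie on the same side, so its state is kept or
  mirrored. On the axis each reflected word repeats one of the two original letters, hence never
  switches a column on.\<close>

lemma column_edges_refl:
  assumes n: "n \<ge> 1" and c: "\<And>i. c (i + 2 * int n) = c i"
  shows "column_edges n (parity_columns p (refl_left n j c)) \<subseteq> edges_L n j (column_edges n (parity_columns p c))"
    "column_edges n (parity_columns p (refl_right n j c)) \<subseteq> edges_R n j (column_edges n (parity_columns p c))"
proof -
  have main: "((x, y), (x, y')) \<in> torus_D n \<Longrightarrow> x \<in> parity_columns p (refl_left n j c) \<Longrightarrow>
       ((x, y), (x, y')) \<in> edges_L n j (column_edges n (parity_columns p c))"
    "((x, y), (x, y')) \<in> torus_D n \<Longrightarrow> x \<in> parity_columns p (refl_right n j c) \<Longrightarrow>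
       ((x, y), (x, y')) \<in> edges_R n j (column_edges n (parity_columns p c))" for x y y'
  proof -
    assume e: "((x, y), (x, y')) \<in> torus_D n"
    have V: "(x, y) \<in> torus_V n" "(x, y') \<in> torus_V n" using e torus_D_subset by auto
    define d where "d = offset n j x"
    have d: "0 \<le> d" "d < 2 * int n" using offset_bounds[OF n, of j x] by (auto simp: d_def)
    have d1: "(x - 1 - j) mod (2 * int n) = (if d = 0 then 2 * int n - 1 else d - 1)"
      using offset_pred[OF n, of j x] by (simp add: d_def offset_def)
    have d0: "(x - j) mod (2 * int n) = d" by (simp add: d_def offset_def)
    have side: "(x, z) \<in> side_R n j \<longleftrightarrow> int n < d" "(x, z) \<in> side_L n j \<longleftrightarrow> 0 < d \<and> d < int n"
      if "z = y \<or> z = y'" for z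
      using V that by (auto simp: side_R_def side_L_def d_def)
    have w: "c (wrap n i) = c i" "c (wrap n i - 1) = c (i - 1)" for i
      by (rule periodic_cong[where c = c, OF c], rule wrap_mod)
         (rule periodic_cong[where c = c, OF c], rule mod_diff_cong, simp_all add: wrap_mod)
    have par: "wrap n (2 * j - x) mod 2 = x mod 2" unfolding wrap_mod2 by presburger
    have refl: "wrap n (2 * j - x) \<in> parity_columns p c \<longleftrightarrow> x mod 2 = p \<and> (c (2 * j - x) \<or> c (2 * j - 1 - x))"
      using w[of "2 * j - x"] par by (simp add: parity_columns_def algebra_simps)
    have e': "((wrap n (2 * j - x), y), (wrap n (2 * j - x), y')) \<in> torus_D n" by (rule torus_D_refl[OF n e])
    note ax = axis_letters[where c = c and x = x and j = j, OF n c, folded d_def]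
    \<comment> \<open>Mirroring sends gap \<open>x - 1\<close> to gap \<open>2 * j - x\<close>. At
      \<open>d = 0\<close> this gap has offset \<open>2 * int n - 1\<close>, so the two gaps beside
      the column lie in different halves.\<close>
    have L: "refl_left n j c x = (if d < int n then c x else c (2 * j - 1 - x))"
      "refl_left n j c (x - 1) = (if d \<noteq> 0 \<and> d \<le> int n then c (x - 1) else c (2 * j - x))"
      using d n by (auto simp: refl_left_def d0 d1)
    have R: "refl_right n j c x = (if d < int n then c (2 * j - 1 - x) else c x)"
      "refl_right n j c (x - 1) = (if d \<noteq> 0 \<and> d \<le> int n then c (2 * j - x) else c (x - 1))"
      using d n by (auto simp: refl_right_def d0 d1)
    show "((x, y), (x, y')) \<in> edges_L n j (column_edges n (parity_columns p c))"
      if x: "x \<in> parity_columns p (refl_left n j c)"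
    proof (cases "int n < d")
      case True
      then have "wrap n (2 * j - x) \<in> parity_columns p c" using x L unfolding refl by (auto simp: parity_columns_def)
      then show ?thesis using True e' side by (auto simp: edges_L_def axis_refl_def column_edges_iff)
    next
      case False
      then have "x \<in> parity_columns p c" using x L ax n by (auto simp: parity_columns_def split: if_splits)
      then show ?thesis using False e side by (auto simp: edges_L_def column_edges_iff)
    qed
    show "((x, y), (x, y')) \<in> edges_R n j (column_edges n (parity_columns p c))"
      if x: "x \<in> parity_columns p (refl_right n j c)"
    proof (cases "0 < d \<and> d < int n")
      case True
      then have "wrap n (2 * j - x) \<in> parity_columns p c" using x R unfolding refl by (auto simp: parity_columns_def)
      then show ?thesis using True e' side by (auto simp: edges_R_def axis_refl_def column_edges_iff)
    next
      case False
      then have "x \<in> parity_columns p c" using x R ax n d by (auto simp: parity_columns_def split: if_splits)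
      then show ?thesis using False e side by (auto simp: edges_R_def column_edges_iff)
    qed
  qed
  show "column_edges n (parity_columns p (refl_left n j c)) \<subseteq> edges_L n j (column_edges n (parity_columns p c))"
    "column_edges n (parity_columns p (refl_right n j c)) \<subseteq> edges_R n j (column_edges n (parity_columns p c))"
    using main by (auto simp: column_edges_def)
qed

section \<open>Chessboard bounds on the torus\<close>

definition torus_prob :: "nat \<Rightarrow> (real \<Rightarrow> ennreal) \<Rightarrow> real \<Rightarrow> ((int \<times> int) \<times> (int \<times> int)) set \<Rightarrow> real" where
  "torus_prob n q L S = enn2real (torus_mass n q L S) / enn2real (torus_mass n q L {})"

lemma finite_parity_range: "finite {y \<in> {- int n + 1..int n}. y mod 2 = p}"
  by (rule finite_subset[of _ "{- int n + 1..int n}"]) auto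

locale torus_weights =
  fixes n :: nat and q :: "real \<Rightarrow> ennreal" and L :: real
  assumes n: "n \<ge> 1" and q: "q \<in> borel_measurable borel"
    and mass_pos: "0 < torus_mass n q L {}" and mass_finite: "torus_mass n q L {} < \<infinity>"
begin

abbreviation mass where "mass \<equiv> torus_mass n q L"
abbreviation prob where "prob \<equiv> torus_prob n q L"

lemma mass_less_top: "mass S < top"
  using torus_mass_antimono[of "{}" S n q L] mass_finite by (auto simp: less_top intro: le_less_trans)

lemma Z_pos: "0 < enn2real (mass {})"
  using mass_pos mass_finite by (simp add: enn2real_positive_iff)

lemma prob_nonneg: "0 \<le> prob S"
  by (simp add: torus_prob_def)

lemma prob_antimono: "S \<subseteq> T \<Longrightarrow> prob T \<le> prob S"
  unfolding torus_prob_def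
  by (intro divide_right_mono enn2real_mono torus_mass_antimono mass_less_top) auto

lemma prob_empty: "prob {} = 1"
  using Z_pos by (simp add: torus_prob_def)

lemma prob_le_1: "prob S \<le> 1"
  using prob_antimono[of "{}" S] prob_empty by simp

lemma prob_reflection: "(prob S)\<^sup>2 \<le> prob (edges_L n j S) * prob (edges_R n j S)"
proof -
  have "enn2real ((mass S)\<^sup>2) \<le> enn2real (mass (edges_L n j S) * mass (edges_R n j S))"
    by (rule enn2real_mono[OF torus_reflection[OF n q]]) (simp add: ennreal_mult_less_top mass_less_top)
  then have "(enn2real (mass S))\<^sup>2 \<le> enn2real (mass (edges_L n j S)) * enn2real (mass (edges_R n j S))"
    by (simp add: power2_eq_square enn2real_mult)
  then show ?thesis
    using Z_pos by (simp add: torus_prob_def power_divide power2_eq_square divide_right_mono)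
qed

lemma prob_swap: "prob {e. map_prod prod.swap prod.swap e \<in> S} = prob S"
  by (simp add: torus_prob_def torus_mass_swap[OF n q])

text \<open>Probabilities decrease with the edge set, so the inclusions for reflected words become
  reflection positivity in the sense of \<open>chessboard\<close>.\<close>

lemma row_chessboard:
  assumes A: "finite A" and c: "c \<in> periodic_words n A"
  shows "prob (row_edges n c) ^ (2 * n) \<le> (\<Prod>i\<in>{0..<2 * int n}. prob (row_edges n (\<lambda>_. c i)))"
proof (rule chessboard[OF n A _ _ c])
  fix d j assume "d \<in> periodic_words n A"
  then have d: "d (i + 2 * int n) = d i" for i by (auto simp: periodic_words_def)
  have "(prob (row_edges n d))\<^sup>2 \<le> prob (edges_L n j (row_edges n d)) * prob (edges_R n j (row_edges n d))"
    by (rule prob_reflection)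
  also have "\<dots> \<le> prob (row_edges n (refl_left n j d)) * prob (row_edges n (refl_right n j d))"
    using row_edges_refl_left[where c = d, OF n d, of j] row_edges_refl_right[where c = d, OF n d, of j]
    by (intro mult_mono prob_antimono prob_nonneg)
  finally show "(prob (row_edges n d))\<^sup>2 \<le> prob (row_edges n (refl_left n j d)) * prob (row_edges n (refl_right n j d))" .
qed (rule prob_nonneg)

text \<open>A constant letter \<open>J\<close> fills the rows in \<open>J\<close>. Turning them into
  columns lets the second spreading use vertical axes again.\<close>

lemma prob_full_rows: "prob (row_edges n (\<lambda>_. J)) = prob (column_edges n J)"
proof -
  have "{e. map_prod prod.swap prod.swap e \<in> row_edges n (\<lambda>_. J)} = column_edges n J" (is "?S = _")
  proof (rule set_eqI)
    fix e :: "(int \<times> int) \<times> int \<times> int"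
    obtain x y x' y' where e: "e = ((x, y), (x', y'))" by (metis surj_pair)
    show "e \<in> ?S \<longleftrightarrow> e \<in> column_edges n J"
      by (auto simp: e row_edges_iff column_edges_iff torus_D_iff)
  qed
  then show ?thesis using prob_swap[of "row_edges n (\<lambda>_. J)"] by simp
qed

text \<open>Gaps are the letters here, and every gap is adjacent to exactly one column of parity
  \<open>p\<close>. A word therefore encodes \<open>J\<close> without ambiguity, with two letters
  switched on per column; this is the origin of the \<open>2\<close> in the exponent.\<close>

lemma column_chessboard:
  assumes J: "J \<subseteq> {x \<in> {- int n + 1..int n}. x mod 2 = p}"
  shows "prob (column_edges n J) ^ (2 * n) \<le> prob (column_edges n {x. x mod 2 = p}) ^ (2 * card J)"
proof -
  define t where "t = prob (column_edges n {x. x mod 2 = p})"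
  \<comment> \<open>A gap is on if the adjacent column of parity \<open>p\<close> belongs to
    \<open>J\<close>; that column is \<open>x\<close> or \<open>x + 1\<close>, depending on the
    parity of \<open>x\<close>.\<close>
  define c where "c = (\<lambda>x. if x mod 2 = p then wrap n x \<in> J else wrap n (x + 1) \<in> J)"
  have finJ: "finite J" using J by (rule finite_subset[OF _ finite_parity_range])
  have c: "c \<in> periodic_words n UNIV"
  proof -
    have "wrap n (x + 2 * int n) = wrap n x" "wrap n (x + 2 * int n + 1) = wrap n (x + 1)" for x
      by (rule wrap_cong, simp) (rule wrap_cong, metis add.commute add.left_commute mod_add_self2)
    then show ?thesis by (auto simp: periodic_words_def c_def)
  qed
  have "prob (column_edges n (parity_columns p c)) ^ (2 * n)
      \<le> (\<Prod>i\<in>{0..<2 * int n}. prob (column_edges n (parity_columns p (\<lambda>_. c i))))"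
  proof (rule chessboard[OF n _ _ _ c, where Phi = "\<lambda>c. prob (column_edges n (parity_columns p c))"])
    fix d :: "int \<Rightarrow> bool" and j assume "d \<in> periodic_words n UNIV"
    then have d: "d (i + 2 * int n) = d i" for i by (auto simp: periodic_words_def)
    let ?S = "column_edges n (parity_columns p d)"
    have "(prob ?S)\<^sup>2 \<le> prob (edges_L n j ?S) * prob (edges_R n j ?S)"
      by (rule prob_reflection)
    also have "\<dots> \<le> prob (column_edges n (parity_columns p (refl_left n j d)))
        * prob (column_edges n (parity_columns p (refl_right n j d)))"
      by (intro mult_mono prob_antimono prob_nonneg column_edges_refl n d)
    finally show "(prob ?S)\<^sup>2 \<le> prob (column_edges n (parity_columns p (refl_left n j d)))
        * prob (column_edges n (parity_columns p (refl_right n j d)))" .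
  qed (auto simp: prob_nonneg)
  also have "\<dots> = (\<Prod>i\<in>{0..<2 * int n}. if c i then t else 1)"
  proof (rule prod.cong)
    fix i
    have "parity_columns p (\<lambda>_. c i) = (if c i then {x. x mod 2 = p} else {})"
      by (auto simp: parity_columns_def)
    moreover have "column_edges n {} = {}" by (auto simp: column_edges_def)
    ultimately show "prob (column_edges n (parity_columns p (\<lambda>_. c i))) = (if c i then t else 1)"
      by (simp add: t_def prob_empty)
  qed simp
  also have "\<dots> = t ^ card {i\<in>{0..<2 * int n}. c i}"
    by (subst prod.If_cases) (auto simp: Int_def)
  also have "\<dots> \<le> t ^ (2 * card J)"
  proof (rule power_decreasing)
    \<comment> \<open>The gaps after and before a column of \<open>J\<close>. They have different
      parities, so the two images are disjoint.\<close>
    let ?f = "\<lambda>x. x mod (2 * int n)" and ?g = "\<lambda>x. (x - 1) mod (2 * int n)"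
    have inj: "inj_on ?f J" "inj_on ?g J"
    proof -
      show "inj_on ?f J" using J eq_if_mod_eq[OF n] by (intro inj_onI) (metis (no_types, lifting) mem_Collect_eq subsetD)
      show "inj_on ?g J"
      proof (rule inj_onI)
        fix x y assume xy: "x \<in> J" "y \<in> J" "(x - 1) mod (2 * int n) = (y - 1) mod (2 * int n)"
        from xy(3) have "(x - 1 + 1) mod (2 * int n) = (y - 1 + 1) mod (2 * int n)" by (rule mod_add_cong) simp
        then show "x = y" using xy J eq_if_mod_eq[OF n, of x y] by auto
      qed
    qed
    have parf: "x mod (2 * int n) mod 2 = x mod 2" for x by (simp add: mod_mod_cancel)
    have disj: "?f ` J \<inter> ?g ` J = {}"
    proof (rule ccontr)
      assume "?f ` J \<inter> ?g ` J \<noteq> {}"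
      then obtain x y where xy: "x \<in> J" "y \<in> J" "x mod (2 * int n) = (y - 1) mod (2 * int n)" by auto
      then have "x mod 2 = (y - 1) mod 2" by (metis parf)
      moreover have "x mod 2 = p" "y mod 2 = p" using xy J by auto
      ultimately show False by presburger
    qed
    have sub: "?f ` J \<union> ?g ` J \<subseteq> {i\<in>{0..<2 * int n}. c i}"
    proof
      fix i assume i: "i \<in> ?f ` J \<union> ?g ` J"
      have "c i"
      proof (cases "i \<in> ?f ` J")
        case True
        then obtain x where x: "x \<in> J" "i = x mod (2 * int n)" by auto
        have "wrap n i = wrap n x" using x by (intro wrap_cong) simp
        moreover have "wrap n x = x" using x J by (intro wrap_id[OF n]) auto
        moreover have "i mod 2 = p" using x J parf[of x] by auto
        ultimately show ?thesis using x by (simp add: c_def)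
      next
        case False
        then obtain x where x: "x \<in> J" "i = (x - 1) mod (2 * int n)" using i by auto
        have "wrap n (i + 1) = wrap n x" using x by (intro wrap_cong) (simp add: mod_add_left_eq)
        moreover have "wrap n x = x" using x J by (intro wrap_id[OF n]) auto
        moreover have "i mod 2 \<noteq> p"
        proof -
          have "i mod 2 = (x - 1) mod 2" using x parf by simp
          moreover have "x mod 2 = p" using x J by auto
          ultimately show ?thesis by presburger
        qed
        ultimately show ?thesis using x by (simp add: c_def)
      qed
      moreover have "i \<in> {0..<2 * int n}" using i n by auto
      ultimately show "i \<in> {i\<in>{0..<2 * int n}. c i}" by auto
    qed
    have "2 * card J = card (?f ` J \<union> ?g ` J)"
      using finJ disj inj by (subst card_Un_disjoint) (auto simp: card_image)
    also have "\<dots> \<le> card {i\<in>{0..<2 * int n}. c i}"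
      by (rule card_mono[OF _ sub]) (rule finite_subset[OF _ finite_atLeastLessThan_int[of 0 "2 * int n"]], auto)
    finally show "2 * card J \<le> card {i\<in>{0..<2 * int n}. c i}" .
  qed (auto simp: t_def prob_nonneg prob_le_1)
  finally have "prob (column_edges n (parity_columns p c)) ^ (2 * n) \<le> t ^ (2 * card J)" .
  moreover have "column_edges n (parity_columns p c) = column_edges n J"
  proof -
    have "x \<in> parity_columns p c \<longleftrightarrow> x \<in> J" if "x \<in> {- int n + 1..int n}" for x
    proof -
      have w: "wrap n x = x" by (rule wrap_id[OF n that])
      have "(x - 1) mod 2 \<noteq> p" if "x mod 2 = p" using that by presburger
      then show ?thesis using J by (auto simp: parity_columns_def c_def w)
    qed
    then show ?thesis by (auto simp: column_edges_def torus_D_iff)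
  qed
  ultimately show ?thesis by (simp add: t_def)
qed

text \<open>Rows are spread first, which leaves one factor per gap; raising to the power
  \<open>2 * n\<close> again allows the columns to be spread in each factor.\<close>

lemma row_edges_bound:
  assumes c: "c \<in> periodic_words n (Pow {y \<in> {- int n + 1..int n}. y mod 2 = p})"
  shows "prob (row_edges n c) ^ (2 * n * (2 * n))
    \<le> prob (column_edges n {x. x mod 2 = p}) ^ (2 * (\<Sum>i\<in>{0..<2 * int n}. card (c i)))"
proof -
  have ci: "c i \<subseteq> {y \<in> {- int n + 1..int n}. y mod 2 = p}" for i using c unfolding periodic_words_def by blast
  have "prob (row_edges n c) ^ (2 * n * (2 * n)) = (prob (row_edges n c) ^ (2 * n)) ^ (2 * n)"
    by (rule power_mult)
  also have "\<dots> \<le> (\<Prod>i\<in>{0..<2 * int n}. prob (row_edges n (\<lambda>_. c i))) ^ (2 * n)"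
    using finite_parity_range by (intro power_mono row_chessboard[OF _ c] prob_nonneg zero_le_power) auto
  also have "\<dots> = (\<Prod>i\<in>{0..<2 * int n}. prob (column_edges n (c i)) ^ (2 * n))"
    by (simp add: prob_full_rows prod_power_distrib)
  also have "\<dots> \<le> (\<Prod>i\<in>{0..<2 * int n}. prob (column_edges n {x. x mod 2 = p}) ^ (2 * card (c i)))"
    by (intro prod_mono conjI column_chessboard ci) (auto simp: prob_nonneg)
  also have "\<dots> = prob (column_edges n {x. x mod 2 = p}) ^ (2 * (\<Sum>i\<in>{0..<2 * int n}. card (c i)))"
    by (simp add: power_sum sum_distrib_left)
  finally show ?thesis .
qed

text \<open>\<open>S\<close> is read as a word over gaps. Every edge of \<open>S\<close> occurs as
  at least one letter entry, and this direction suffices because probabilities are at most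
  \<open>1\<close>.\<close>

lemma horizontal_bound:
  assumes S: "S \<subseteq> torus_E n" and hor: "\<And>x y x' y'. ((x, y), (x', y')) \<in> S \<Longrightarrow> y = y' \<and> y mod 2 = p"
  shows "prob (S \<union> S\<inverse>) ^ (2 * n * (2 * n)) \<le> prob (column_edges n {x. x mod 2 = p}) ^ (2 * card S)"
proof -
  let ?t = "prob (column_edges n {x. x mod 2 = p})"
  define e where "e = (\<lambda>i (y :: int). ((wrap n i, y), (wrap n (i + 1), y)))"
  define c where "c = (\<lambda>i. {y. e i y \<in> S \<union> S\<inverse>})"
  have SD: "S \<subseteq> torus_D n" using S by (auto simp: torus_E_def torus_D_def)
  have inv: "S \<union> S\<inverse> \<subseteq> torus_D n" using SD torus_D_sym by auto
  have hor': "y = y' \<and> y mod 2 = p" if "((x, y), (x', y')) \<in> S \<union> S\<inverse>" for x y x' y'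
    using that hor by fastforce
  have c: "c \<in> periodic_words n (Pow {y \<in> {- int n + 1..int n}. y mod 2 = p})"
  proof -
    have "wrap n (i + 2 * int n) = wrap n i" "wrap n (i + 2 * int n + 1) = wrap n (i + 1)" for i
      by (rule wrap_cong, simp) (rule wrap_cong, metis add.commute add.left_commute mod_add_self2)
    then have "c (i + 2 * int n) = c i" for i by (simp add: c_def e_def)
    moreover have "y \<in> {- int n + 1..int n} \<and> y mod 2 = p" if "y \<in> c i" for y i
    proof -
      have m: "((wrap n i, y), (wrap n (i + 1), y)) \<in> S \<union> S\<inverse>" using that by (simp add: c_def e_def)
      show ?thesis using subsetD[OF inv m] hor'[OF m] by (auto simp: torus_D_iff)
    qed
    ultimately show ?thesis by (auto simp: periodic_words_def)
  qed
  have wr: "wrap n x = x \<and> wrap n (x + 1) = x'"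
    if "x \<in> {- int n + 1..int n}" "x' \<in> {- int n + 1..int n}" "(x' - x) mod (2 * int n) = 1" for x x'
  proof -
    have "(1 :: int) mod (2 * int n) = 1" using n by simp
    then have "(x' - x + x) mod (2 * int n) = (1 + x) mod (2 * int n)"
      using that by (intro mod_add_cong) auto
    then have "wrap n (x + 1) = wrap n x'" by (intro wrap_cong) (simp add: add.commute)
    then show ?thesis using that wrap_id[OF n] by simp
  qed
  have sub: "row_edges n c \<subseteq> S \<union> S\<inverse>"
  proof
    fix ed assume ed: "ed \<in> row_edges n c"
    obtain x y x' y' where [simp]: "ed = ((x, y), (x', y'))" by (metis surj_pair)
    have D: "((x, y), (x', y')) \<in> torus_D n" and [simp]: "y' = y" using ed by (auto simp: row_edges_iff)
    have R: "x \<in> {- int n + 1..int n}" "x' \<in> {- int n + 1..int n}" using D by (auto simp: torus_D_iff)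
    consider "(x' - x) mod (2 * int n) = 1" "y \<in> c x" | "(x - x') mod (2 * int n) = 1" "y \<in> c x'"
      using ed by (auto simp: row_edges_iff)
    then show "ed \<in> S \<union> S\<inverse>"
    proof cases
      case 1
      then show ?thesis using wr[OF R 1(1)] by (auto simp: c_def e_def)
    next
      case 2
      then show ?thesis using wr[OF R(2) R(1) 2(1)] by (auto simp: c_def e_def)
    qed
  qed
  \<comment> \<open>Gap edges run from column \<open>i\<close> to the next one. The edge closing the
    cycle runs against the lexicographic order of \<open>torus_E\<close>, so decoding may have to
    swap its ends.\<close>
  define f where "f = (\<lambda>(i, y). if e i y \<in> S then e i y else prod.swap (e i y))"
  have finc: "finite (c i)" for i
  proof -
    have "c i \<subseteq> {y \<in> {- int n + 1..int n}. y mod 2 = p}" using c unfolding periodic_words_def by blast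
    then show ?thesis by (rule finite_subset[OF _ finite_parity_range])
  qed
  have "S \<subseteq> f ` (SIGMA i:{0..<2 * int n}. c i)"
  proof
    fix ed assume ed: "ed \<in> S"
    obtain x y x' y' where [simp]: "ed = ((x, y), (x', y'))" by (metis surj_pair)
    have [simp]: "y' = y" using hor ed by auto
    have D: "((x, y), (x', y)) \<in> torus_D n" using ed SD by auto
    have lt: "x < x'" using ed S by (auto simp: torus_E_def)
    have R: "x \<in> {- int n + 1..int n}" "x' \<in> {- int n + 1..int n}" using D by (auto simp: torus_D_iff)
    have w: "wrap n (i mod (2 * int n)) = wrap n i" "wrap n (i mod (2 * int n) + 1) = wrap n (i + 1)" for i
      by (rule wrap_cong, simp) (rule wrap_cong, simp add: mod_add_left_eq)
    consider "(x' - x) mod (2 * int n) = 1" | "(x - x') mod (2 * int n) = 1"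
      using D lt by (auto simp: torus_D_iff)
    then show "ed \<in> f ` (SIGMA i:{0..<2 * int n}. c i)"
    proof cases
      case 1
      have "e (x mod (2 * int n)) y = ed" using wr[OF R 1] w[of x] by (simp add: e_def)
      then show ?thesis using ed n
        by (intro image_eqI[of _ _ "(x mod (2 * int n), y)"]) (auto simp: f_def c_def)
    next
      case 2
      have e: "e (x' mod (2 * int n)) y = prod.swap ed" using wr[OF R(2) R(1) 2] w[of x'] by (simp add: e_def)
      have "prod.swap ed \<notin> S" using S lt by (auto simp: torus_E_def)
      with e show ?thesis using ed n
        by (intro image_eqI[of _ _ "(x' mod (2 * int n), y)"]) (auto simp: f_def c_def)
    qed
  qed
  then have "card S \<le> card (f ` (SIGMA i:{0..<2 * int n}. c i))"
    using finc by (intro card_mono) auto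
  also have "\<dots> \<le> card (SIGMA i:{0..<2 * int n}. c i)" using finc by (intro card_image_le) auto
  also have "\<dots> = (\<Sum>i\<in>{0..<2 * int n}. card (c i))" using finc by (subst card_SigmaI) auto
  finally have card: "card S \<le> (\<Sum>i\<in>{0..<2 * int n}. card (c i))" .
  have "prob (S \<union> S\<inverse>) ^ (2 * n * (2 * n)) \<le> prob (row_edges n c) ^ (2 * n * (2 * n))"
    by (intro power_mono prob_antimono sub prob_nonneg)
  also have "\<dots> \<le> ?t ^ (2 * (\<Sum>i\<in>{0..<2 * int n}. card (c i)))" by (rule row_edges_bound[OF c])
  also have "\<dots> \<le> ?t ^ (2 * card S)"
    using card by (intro power_decreasing prob_nonneg prob_le_1) auto
  finally show ?thesis .
qed

lemma vertical_bound:
  assumes S: "S \<subseteq> torus_E n" and ver: "\<And>x y x' y'. ((x, y), (x', y')) \<in> S \<Longrightarrow> x = x' \<and> x mod 2 = p"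
  shows "prob (S \<union> S\<inverse>) ^ (2 * n * (2 * n)) \<le> prob (column_edges n {x. x mod 2 = p}) ^ (2 * card S)"
proof -
  let ?sw = "map_prod prod.swap prod.swap :: (int \<times> int) \<times> (int \<times> int) \<Rightarrow> _"
  let ?T = "{e. ?sw e \<in> S}"
  have inv: "?sw (?sw e) = e" for e by (cases e) auto
  have T: "?T = ?sw ` S"
  proof (intro set_eqI iffI)
    fix e assume "e \<in> ?T"
    then show "e \<in> ?sw ` S" by (intro image_eqI[of _ _ "?sw e"]) (auto simp: inv)
  qed (auto simp: inv)
  have "inj_on ?sw S" by (rule inj_on_inverseI[where g = ?sw]) (rule inv)
  then have "card ?T = card S" unfolding T by (rule card_image)
  moreover have "prob (?T \<union> ?T\<inverse>) = prob (S \<union> S\<inverse>)"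
  proof -
    have "?T \<union> ?T\<inverse> = {e. ?sw e \<in> S \<union> S\<inverse>}" by auto
    then show ?thesis by (simp only: prob_swap)
  qed
  moreover have "prob (?T \<union> ?T\<inverse>) ^ (2 * n * (2 * n)) \<le> prob (column_edges n {x. x mod 2 = p}) ^ (2 * card ?T)"
  proof (rule horizontal_bound)
    show "?T \<subseteq> torus_E n"
    proof
      fix e assume e: "e \<in> ?T"
      obtain x y x' y' where [simp]: "e = ((x, y), (x', y'))" by (metis surj_pair)
      from e have s: "((y, x), (y', x')) \<in> S" by simp
      \<comment> \<open>For an edge parallel to a coordinate axis one coordinate is constant, so the
        lexicographic order of its ends survives exchanging the coordinates.\<close>
      then have "y = y'" using ver by blast
      then show "e \<in> torus_E n" using subsetD[OF S s]
        by (auto simp: torus_E_def torus_adj_def torus_V_def)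
    qed
    show "y = y' \<and> y mod 2 = p" if "((x, y), (x', y')) \<in> ?T" for x y x' y'
      using that ver by simp
  qed
  ultimately show ?thesis by simp
qed

end

section \<open>Bounds on torus masses\<close>

lemma nat_double: "nat (2 * int n) = 2 * n"
  by simp

lemma card_torus_V: "card (torus_V n) = 4 * (n * n)"
  by (simp add: torus_V_def nat_double)

lemma torus_neighbours:
  assumes n: "n \<ge> 1" and e: "((x, y), (x', y')) \<in> torus_D n"
  shows "(x', y') \<in> {(wrap n (x + 1), y), (wrap n (x - 1), y), (x, wrap n (y + 1)), (x, wrap n (y - 1))}"
proof -
  have step: "b = wrap n (a + 1)" if "(b - a) mod (2 * int n) = 1" "b \<in> {- int n + 1..int n}" for a b
  proof -
    have "(1 :: int) mod (2 * int n) = 1" using n by simp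
    then have "(b - a + a) mod (2 * int n) = (1 + a) mod (2 * int n)"
      using that by (intro mod_add_cong) auto
    then have "wrap n b = wrap n (a + 1)" by (intro wrap_cong) (simp add: add.commute)
    then show ?thesis using wrap_id[OF n that(2)] by simp
  qed
  have step': "b = wrap n (a - 1)" if "(a - b) mod (2 * int n) = 1" "b \<in> {- int n + 1..int n}" for a b
  proof -
    have "(1 :: int) mod (2 * int n) = 1" using n by simp
    then have "(a - (a - b)) mod (2 * int n) = (a - 1) mod (2 * int n)"
      using that by (intro mod_diff_cong) auto
    then have "wrap n b = wrap n (a - 1)" by (intro wrap_cong) simp
    then show ?thesis using wrap_id[OF n that(2)] by simp
  qed
  show ?thesis using e step step' unfolding torus_D_iff by blast
qed

lemma card_torus_out: "n \<ge> 1 \<Longrightarrow> card {w. (v, w) \<in> torus_D n} \<le> 4"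
proof -
  assume n: "n \<ge> 1"
  obtain x y where v: "v = (x, y)" by (cases v)
  let ?l = "[(wrap n (x + 1), y), (wrap n (x - 1), y), (x, wrap n (y + 1)), (x, wrap n (y - 1))]"
  have "{w. (v, w) \<in> torus_D n} \<subseteq> set ?l"
    using torus_neighbours[OF n] unfolding v by fastforce
  then have "card {w. (v, w) \<in> torus_D n} \<le> card (set ?l)" by (intro card_mono) auto
  also have "\<dots> \<le> length ?l" by (rule card_length)
  finally show ?thesis by simp
qed

text \<open>At most four neighbours, each joined by two oriented edges; this is the \<open>k\<close>
  of the greedy lower bound.\<close>

lemma torus_degree:
  assumes n: "n \<ge> 1"
  shows "card {e \<in> torus_D n. fst e = v \<or> snd e = v} \<le> 8"
proof -
  let ?N = "{w. (v, w) \<in> torus_D n}"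
  have fin: "finite ?N"
    using finite_torus_V torus_D_subset by (auto intro: finite_subset[of _ "torus_V n"])
  have "{e \<in> torus_D n. fst e = v \<or> snd e = v} \<subseteq> Pair v ` ?N \<union> (\<lambda>w. (w, v)) ` ?N"
    using torus_D_sym by fastforce
  then have "card {e \<in> torus_D n. fst e = v \<or> snd e = v} \<le> card (Pair v ` ?N \<union> (\<lambda>w. (w, v)) ` ?N)"
    using fin by (intro card_mono) auto
  also have "\<dots> \<le> card (Pair v ` ?N) + card ((\<lambda>w. (w, v)) ` ?N)" by (rule card_Un_le)
  also have "\<dots> \<le> card ?N + card ?N" by (intro add_mono card_image_le fin)
  also have "\<dots> \<le> 8" using card_torus_out[OF n, of v] by simp
  finally show ?thesis .
qed

lemma card_torus_D:
  assumes n: "n \<ge> 1"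
  shows "card (torus_D n) \<le> 16 * (n * n)"
proof -
  define M where "M = (\<lambda>v. {w. (v, w) \<in> torus_D n})"
  have D_eq: "torus_D n = Sigma (torus_V n) M" using torus_D_subset by (auto simp: M_def)
  have fin: "finite (M v)" for v
    using finite_torus_V torus_D_subset by (auto simp: M_def intro: finite_subset[of _ "torus_V n"])
  have "card (torus_D n) = (\<Sum>v\<in>torus_V n. card (M v))"
    unfolding D_eq using finite_torus_V fin by (intro card_SigmaI) auto
  also have "\<dots> \<le> (\<Sum>v\<in>torus_V n. 4)" unfolding M_def by (intro sum_mono card_torus_out n)
  finally show ?thesis by (simp add: card_torus_V)
qed

lemma torus_noloop: "n \<ge> 1 \<Longrightarrow> (v, v) \<notin> torus_D n"
  by (cases v) (auto simp: torus_D_iff)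

text \<open>Eight oriented edges per vertex make \<open>a / 16\<close> the tolerance with
  \<open>8 * (a / 16) = a / 2\<close>. The exponents \<open>16\<close> and \<open>4\<close> bound
  the numbers of oriented edges and vertices per \<open>n * n\<close>.\<close>

lemma torus_mass_lower:
  fixes a \<eta> \<epsilon> :: real
  assumes n: "n \<ge> 1" and a: "0 < a" "a \<le> 1" and q: "q \<in> borel_measurable borel"
    and eps: "0 \<le> \<epsilon>" "\<epsilon> \<le> 1"
    and bad: "emeasure lborel {x\<in>{-a..a}. q x < ennreal \<epsilon>} \<le> ennreal (a / 16)"
  shows "ennreal ((\<epsilon> ^ 16 * (a / 2) ^ 4) ^ (n * n)) \<le> torus_mass n q L {}"
proof -
  have "(\<epsilon> ^ 16 * (a / 2) ^ 4) ^ (n * n) = \<epsilon> ^ (16 * (n * n)) * (a / 2) ^ card (torus_V n)"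
    by (simp only: power_mult_distrib power_mult card_torus_V)
  also have "\<dots> \<le> \<epsilon> ^ card (torus_D n) * (a / 2) ^ card (torus_V n)"
    using eps a card_torus_D[OF n] by (intro mult_right_mono power_decreasing) auto
  finally have "ennreal ((\<epsilon> ^ 16 * (a / 2) ^ 4) ^ (n * n))
      \<le> ennreal (\<epsilon> ^ card (torus_D n) * (a / 2) ^ card (torus_V n))" by (rule ennreal_leI)
  also have "\<dots> \<le> pinned_mass (torus_V n) (torus_D n) (\<lambda>_. q) (0, 0)"
    using a by (intro pinned_mass_lower[OF a q eps(1) bad, where k = 8] finite_torus_V torus_D_subset
       torus_noloop torus_degree origin_in_torus n) auto
  also have "\<dots> = torus_mass n q L {}"
    unfolding torus_mass_def by (intro pinned_mass_cong) simp
  finally show ?thesis .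
qed

text \<open>The spanning tree of the upper bound is a comb: every column is a path, and the columns are joined along
  the bottom row.\<close>

definition comb_parent :: "nat \<Rightarrow> int \<times> int \<Rightarrow> int \<times> int" where
  "comb_parent n v = (if snd v \<noteq> - int n + 1 then (fst v, snd v - 1) else (fst v - 1, snd v))"

lemma comb_parent_edge:
  assumes n: "n \<ge> 1" and v: "v \<in> torus_V n - {(- int n + 1, - int n + 1)}"
  shows "(v, comb_parent n v) \<in> torus_D n"
proof -
  obtain x y where "v = (x, y)" by (cases v)
  then show ?thesis using v n by (auto simp: comb_parent_def torus_D_iff torus_V_def)
qed

text \<open>The two orientations of a tree edge combine to \<open>q x * q x\<close>, by evenness,
  and are integrated; all other edges are bounded by \<open>Q\<close>. The indicator is kept on the
  vertical tree edges of the columns in \<open>J\<close>.\<close>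

lemma torus_mass_comb_bound:
  fixes Q :: real
  assumes n: "n \<ge> 1" and q: "q \<in> borel_measurable borel" and even: "\<And>x. q (- x) = q x"
    and Q: "1 \<le> Q" "\<And>x. q x \<le> ennreal Q"
  shows "torus_mass n q L (column_edges n J) \<le> ennreal (Q ^ (16 * (n * n))) *
    (\<Prod>v\<in>torus_V n - {(- int n + 1, - int n + 1)}.
       if fst v \<in> J \<and> snd v \<noteq> - int n + 1 then \<integral>\<^sup>+ x. q x * q x * indicator {x. L \<le> \<bar>x\<bar>} x \<partial>lborel
       else \<integral>\<^sup>+ x. q x * q x \<partial>lborel)"
proof -
  define rt where "rt = (- int n + 1, - int n + 1)"
  define W where "W = torus_V n - {rt}"
  define par where "par = comb_parent n"
  \<comment> \<open>A parent has coordinate sum smaller by one; adding \<open>2 * int n\<close>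
    keeps the sum positive on the torus.\<close>
  define ht where "ht = (\<lambda>v :: int \<times> int. nat (fst v + snd v + 2 * int n))"
  define S where "S = column_edges n J"
  define h where "h = (\<lambda>(v :: int \<times> int) z. if fst v \<in> J \<and> snd v \<noteq> - int n + 1
      then q z * q z * indicator {x. L \<le> \<bar>x\<bar>} z else q z * q z)"
  have finW: "finite W" using finite_torus_V by (simp add: W_def)
  have rt: "rt \<in> torus_V n" using n by (auto simp: rt_def torus_V_def)
  have parD: "(v, par v) \<in> torus_D n" if "v \<in> W" for v
    using comb_parent_edge[OF n] that by (auto simp: W_def par_def rt_def)
  have parV: "par v \<in> torus_V n" if "v \<in> W" for v using parD[OF that] torus_D_subset by auto
  have ht: "ht (par v) < ht v" if "v \<in> W" for v
    using that by (cases v) (auto simp: W_def rt_def torus_V_def par_def comb_parent_def ht_def)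
  have [measurable]: "{x :: real. L \<le> \<bar>x\<bar>} \<in> sets borel" by measurable
  note [measurable] = q
  have h_meas: "h v \<in> borel_measurable borel" for v
    unfolding h_def by (cases "fst v \<in> J \<and> snd v \<noteq> - int n + 1") simp_all
  define T1 where "T1 = (\<lambda>v. (v, par v)) ` W"
  define T2 where "T2 = (\<lambda>v. (par v, v)) ` W"
  define R where "R = torus_D n - (T1 \<union> T2)"
  have T: "T1 \<subseteq> torus_D n" "T2 \<subseteq> torus_D n" using parD torus_D_sym[OF parD] by (auto simp: T1_def T2_def)
  have fin: "finite T1" "finite T2" "finite R" using finW finite_torus_D by (auto simp: T1_def T2_def R_def)
  have disj: "T1 \<inter> T2 = {}"
  proof (rule ccontr)
    assume "T1 \<inter> T2 \<noteq> {}"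
    then obtain e where "e \<in> T1" "e \<in> T2" by blast
    then obtain v w where vw: "v \<in> W" "w \<in> W" "e = (v, par v)" "e = (par w, w)"
      unfolding T1_def T2_def by blast
    from vw(3,4) have "v = par w \<and> par v = w" by (metis prod.inject)
    then show False using ht[OF vw(1)] ht[OF vw(2)] by (metis less_asym)
  qed
  have bound: "edge_prod (torus_D n) (tilt q L S) x \<le> ennreal (Q ^ (16 * (n * n))) * (\<Prod>v\<in>W. h v (x v - x (par v)))" for x
  proof -
    let ?g = "\<lambda>e. tilt q L S e (x (fst e) - x (snd e))"
    have D_eq: "torus_D n = (T1 \<union> T2) \<union> R" using T by (auto simp: R_def)
    have "edge_prod (torus_D n) (tilt q L S) x = prod ?g (T1 \<union> T2) * prod ?g R"
      unfolding edge_prod_def by (subst D_eq, rule prod.union_disjoint) (use fin in \<open>auto simp: R_def\<close>)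
    also have "prod ?g (T1 \<union> T2) = prod ?g T1 * prod ?g T2"
      by (rule prod.union_disjoint[OF fin(1,2) disj])
    also have "prod ?g T1 = (\<Prod>v\<in>W. ?g (v, par v))"
      unfolding T1_def by (subst prod.reindex) (auto simp: inj_on_def)
    also have "prod ?g T2 = (\<Prod>v\<in>W. ?g (par v, v))"
      unfolding T2_def by (subst prod.reindex) (auto simp: inj_on_def)
    also have "(\<Prod>v\<in>W. ?g (v, par v)) * (\<Prod>v\<in>W. ?g (par v, v)) = (\<Prod>v\<in>W. ?g (v, par v) * ?g (par v, v))"
      by (simp add: prod.distrib)
    finally have eq: "edge_prod (torus_D n) (tilt q L S) x = (\<Prod>v\<in>W. ?g (v, par v) * ?g (par v, v)) * prod ?g R" .
    have "?g (v, par v) * ?g (par v, v) \<le> h v (x v - x (par v))" if v: "v \<in> W" for v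
    proof -
      let ?z = "x v - x (par v)"
      have e: "q (x (par v) - x v) = q ?z" using even[of ?z] by simp
      show ?thesis
      proof (cases "fst v \<in> J \<and> snd v \<noteq> - int n + 1")
        case True
        \<comment> \<open>Above the bottom row the parent lies in the same column, so both
          orientations of the edge are selected.\<close>
        have "(v, par v) \<in> S" "(par v, v) \<in> S"
          using True parD[OF v] torus_D_sym[OF parD[OF v]]
          by (cases v; auto simp: S_def column_edges_iff par_def comb_parent_def)+
        then have "?g (v, par v) * ?g (par v, v) = h v ?z"
          using True e by (auto simp: tilt_def h_def indicator_def abs_minus_commute)
        then show ?thesis by simp
      next
        case False
        have le: "tilt q L S e' z \<le> q z" for e' z using tilt_antimono[of "{}" S q L e' z] by simp
        have "?g (v, par v) \<le> q ?z" "?g (par v, v) \<le> q ?z"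
          using le[of "(v, par v)" ?z] le[of "(par v, v)" "x (par v) - x v"] e by simp_all
        then have "?g (v, par v) * ?g (par v, v) \<le> q ?z * q ?z"
          by (rule mult_mono) auto
        then show ?thesis using False by (auto simp: h_def)
      qed
    qed
    then have "(\<Prod>v\<in>W. ?g (v, par v) * ?g (par v, v)) \<le> (\<Prod>v\<in>W. h v (x v - x (par v)))"
      by (rule prod_mono_ennreal)
    moreover have "prod ?g R \<le> ennreal (Q ^ (16 * (n * n)))"
    proof -
      have "tilt q L S e' z \<le> ennreal Q" for e' z
        using tilt_antimono[of "{}" S q L e' z] Q(2)[of z] by simp
      then have "prod ?g R \<le> (\<Prod>e\<in>R. ennreal Q)" by (intro prod_mono_ennreal)
      also have "\<dots> = ennreal (Q ^ card R)" using Q by (simp add: ennreal_power)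
      also have "\<dots> \<le> ennreal (Q ^ (16 * (n * n)))"
      proof (intro ennreal_leI power_increasing)
        have "card R \<le> card (torus_D n)" using finite_torus_D by (intro card_mono) (auto simp: R_def)
        then show "card R \<le> 16 * (n * n)" using card_torus_D[OF n] by simp
      qed (use Q in auto)
      finally show ?thesis .
    qed
    ultimately have "edge_prod (torus_D n) (tilt q L S) x \<le> (\<Prod>v\<in>W. h v (x v - x (par v))) * ennreal (Q ^ (16 * (n * n)))"
      unfolding eq by (rule mult_mono) auto
    then show ?thesis by (simp only: mult.commute)
  qed
  have prod_meas: "(\<lambda>x. \<Prod>v\<in>W. h v (x v - x (par v))) \<in> borel_measurable (leb (torus_V n))"
  proof (rule borel_measurable_prod_ennreal)
    fix v assume v: "v \<in> W"
    have [measurable]: "v \<in> torus_V n" "par v \<in> torus_V n" using v parV by (auto simp: W_def)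
    note h_meas[measurable]
    show "(\<lambda>x. h v (x v - x (par v))) \<in> borel_measurable (leb (torus_V n))" by measurable
  qed
  have "torus_mass n q L S = pinned_mass (torus_V n) (torus_D n) (tilt q L S) rt"
    by (rule torus_mass_pin[OF n q rt])
  also have "\<dots> \<le> (\<integral>\<^sup>+ x. ennreal (Q ^ (16 * (n * n))) *
      (indicator {0..1} (x rt) * (\<Prod>v\<in>W. h v (x v - x (par v)))) \<partial>leb (torus_V n))"
    unfolding pinned_mass_def
  proof (rule nn_integral_mono)
    fix x :: "int \<times> int \<Rightarrow> real"
    have "indicator {0..1} (x rt) * edge_prod (torus_D n) (tilt q L S) x
      \<le> indicator {0..1} (x rt) * (ennreal (Q ^ (16 * (n * n))) * (\<Prod>v\<in>W. h v (x v - x (par v))))"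
      by (rule mult_left_mono[OF bound]) simp
    then show "indicator {0..1} (x rt) * edge_prod (torus_D n) (tilt q L S) x
      \<le> ennreal (Q ^ (16 * (n * n))) * (indicator {0..1} (x rt) * (\<Prod>v\<in>W. h v (x v - x (par v))))"
      by (simp only: mult.left_commute)
  qed
  also have "\<dots> = ennreal (Q ^ (16 * (n * n))) *
      (\<integral>\<^sup>+ x. indicator {0..1} (x rt) * (\<Prod>v\<in>W. h v (x v - x (par v))) \<partial>leb (torus_V n))"
    by (rule nn_integral_cmult) (rule borel_measurable_times_ennreal[OF pin_measurable[OF rt] prod_meas])
  also have "(\<integral>\<^sup>+ x. indicator {0..1} (x rt) * (\<Prod>v\<in>W. h v (x v - x (par v))) \<partial>leb (torus_V n))
      = (\<Prod>v\<in>W. \<integral>\<^sup>+ z. h v z \<partial>lborel)"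
    unfolding W_def
    by (rule nn_integral_rooted_tree[where ht = ht, OF finite_torus_V rt _ h_meas])
       (use parV ht in \<open>auto simp: W_def\<close>)
  also have "(\<Prod>v\<in>W. \<integral>\<^sup>+ z. h v z \<partial>lborel)
      = (\<Prod>v\<in>W. if fst v \<in> J \<and> snd v \<noteq> - int n + 1 then \<integral>\<^sup>+ x. q x * q x * indicator {x. L \<le> \<bar>x\<bar>} x \<partial>lborel
         else \<integral>\<^sup>+ x. q x * q x \<partial>lborel)"
    by (rule prod.cong) (auto simp: h_def)
  finally show ?thesis unfolding S_def W_def rt_def .
qed

lemma card_parity_range_ge:
  assumes p: "p = 0 \<or> p = 1"
  shows "n \<le> card {x \<in> {- int n + 1..int n}. x mod 2 = p}"
proof -
  \<comment> \<open>The smallest coordinate of parity \<open>p\<close>; from there \<open>n\<close>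
    steps of length two, counting the start, stay inside the range.\<close>
  define a where "a = - int n + 1 + (p - (- int n + 1)) mod 2"
  have a: "a mod 2 = p" "- int n + 1 \<le> a" "a \<le> - int n + 2"
    using p by (auto simp: a_def mod_add_right_eq)
  have "n = card ((\<lambda>k. a + 2 * int k) ` {..<n})"
    by (subst card_image) (auto simp: inj_on_def)
  also have "\<dots> \<le> card {x \<in> {- int n + 1..int n}. x mod 2 = p}"
    using a by (intro card_mono) (auto intro: finite_subset[of _ "{- int n + 1..int n}"])
  finally show ?thesis .
qed

text \<open>Each of the at least \<open>n\<close> columns of parity \<open>p\<close> contains
  \<open>2 * n - 1\<close> comb edges, so at least \<open>n * n\<close> integrals contribute
  \<open>\<tau>\<close>; the others contribute at most \<open>I\<close>.\<close>

lemma torus_mass_columns_upper: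
  fixes Q I \<tau> :: real
  assumes n: "n \<ge> 1" and q: "q \<in> borel_measurable borel" and even: "\<And>x. q (- x) = q x"
    and Q: "1 \<le> Q" "\<And>x. q x \<le> ennreal Q"
    and I: "1 \<le> I" "(\<integral>\<^sup>+ x. q x * q x \<partial>lborel) \<le> ennreal I"
    and \<tau>: "0 \<le> \<tau>" "\<tau> \<le> 1" "(\<integral>\<^sup>+ x. q x * q x * indicator {x. L \<le> \<bar>x\<bar>} x \<partial>lborel) \<le> ennreal \<tau>"
    and p: "p = 0 \<or> p = 1"
  shows "torus_mass n q L (column_edges n {x. x mod 2 = p}) \<le> ennreal ((Q ^ 16 * I ^ 4 * \<tau>) ^ (n * n))"
    and "torus_mass n q L {} < \<infinity>"
proof -
  define W where "W = torus_V n - {(- int n + 1, - int n + 1)}"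
  have finW: "finite W" using finite_torus_V by (simp add: W_def)
  define G where "G = {v \<in> W. fst v mod 2 = p \<and> snd v \<noteq> - int n + 1}"
  have G: "n * n \<le> card G"
  proof -
    have "G = {x \<in> {- int n + 1..int n}. x mod 2 = p} \<times> {- int n + 2..int n}"
      by (auto simp: G_def W_def torus_V_def)
    then have "card G = card {x \<in> {- int n + 1..int n}. x mod 2 = p} * (2 * n - 1)"
      by (simp add: card_cartesian_product nat_diff_distrib' nat_double)
    moreover have "n * n \<le> card {x \<in> {- int n + 1..int n}. x mod 2 = p} * (2 * n - 1)"
      using card_parity_range_ge[OF p, of n] n by (intro mult_le_mono) auto
    ultimately show ?thesis by simp
  qed
  have WG: "card (W - G) \<le> 4 * (n * n)"
    using card_mono[OF finite_torus_V, of "W - G" n] by (auto simp: W_def card_torus_V)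
  let ?t = "\<integral>\<^sup>+ x. q x * q x * indicator {x. L \<le> \<bar>x\<bar>} x \<partial>lborel" and ?i = "\<integral>\<^sup>+ x. q x * q x \<partial>lborel"
  have "torus_mass n q L (column_edges n {x. x mod 2 = p})
     \<le> ennreal (Q ^ (16 * (n * n))) * (\<Prod>v\<in>W. if fst v \<in> {x. x mod 2 = p} \<and> snd v \<noteq> - int n + 1 then ?t else ?i)"
    unfolding W_def by (rule torus_mass_comb_bound[OF n q even Q])
  also have "\<dots> \<le> ennreal (Q ^ (16 * (n * n))) * (\<Prod>v\<in>W. ennreal (if v \<in> G then \<tau> else I))"
    using I \<tau> by (intro mult_left_mono prod_mono_ennreal) (auto simp: G_def)
  also have "(\<Prod>v\<in>W. ennreal (if v \<in> G then \<tau> else I)) = ennreal (\<Prod>v\<in>W. if v \<in> G then \<tau> else I)"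
    using I \<tau> by (intro prod_ennreal) auto
  also have "(\<Prod>v\<in>W. if v \<in> G then \<tau> else I) = \<tau> ^ card G * I ^ card (W - G)"
  proof -
    have "W \<inter> G = G" "W \<inter> - G = W - G" by (auto simp: G_def)
    then show ?thesis using finW by (simp add: prod.If_cases Collect_mem_eq)
  qed
  also have "ennreal (Q ^ (16 * (n * n))) * ennreal (\<tau> ^ card G * I ^ card (W - G))
      = ennreal (Q ^ (16 * (n * n)) * (\<tau> ^ card G * I ^ card (W - G)))"
    using Q I \<tau> by (intro ennreal_mult[symmetric]) auto
  also have "\<dots> \<le> ennreal (Q ^ (16 * (n * n)) * (\<tau> ^ (n * n) * I ^ (4 * (n * n))))"
    using Q I \<tau> G WG by (intro ennreal_leI mult_left_mono mult_mono power_decreasing power_increasing) auto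
  also have "Q ^ (16 * (n * n)) * (\<tau> ^ (n * n) * I ^ (4 * (n * n))) = (Q ^ 16 * I ^ 4 * \<tau>) ^ (n * n)"
    by (simp only: power_mult_distrib power_mult[symmetric] mult_ac)
  finally show "torus_mass n q L (column_edges n {x. x mod 2 = p}) \<le> ennreal ((Q ^ 16 * I ^ 4 * \<tau>) ^ (n * n))" .
  have "column_edges n {} = {}" by (auto simp: column_edges_def)
  then have "torus_mass n q L {} \<le> ennreal (Q ^ (16 * (n * n))) * (\<Prod>v\<in>W. ?i)"
    using torus_mass_comb_bound[OF n q even Q, of L "{}"] by (simp add: W_def)
  also have "\<dots> < \<infinity>"
    using le_less_trans[OF I(2) ennreal_less_top] by (auto simp: ennreal_mult_less_top power_less_top_ennreal)
  finally show "torus_mass n q L {} < \<infinity>" .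
qed

section \<open>The Gibbs measure\<close>

text \<open>Keeping only the largest class of edges can only increase the probability. The power
  \<open>8\<close> compensates the quarter lost there and the factor \<open>2\<close> between
  \<open>2 * card C\<close> and the exponent \<open>2 * n * (2 * n)\<close> measured in units of
  \<open>n * n\<close>.\<close>

lemma (in torus_weights) prob_edges_le:
  fixes \<delta> \<kappa> :: real
  assumes kappa: "0 \<le> \<kappa>" "\<kappa> \<le> \<delta> ^ 8" and delta: "0 < \<delta>" "\<delta> < 1"
    and columns: "\<And>p. p = 0 \<or> p = 1 \<Longrightarrow> prob (column_edges n {x. x mod 2 = p}) \<le> \<kappa> ^ (n * n)"
    and S: "S \<subseteq> torus_E n"
  shows "prob (S \<union> S\<inverse>) \<le> \<delta> ^ card S"
proof -
  define H where "H = (\<lambda>p :: int. {e \<in> S. snd (fst e) = snd (snd e) \<and> snd (fst e) mod 2 = p})"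
  define V where "V = (\<lambda>p :: int. {e \<in> S. fst (fst e) = fst (snd e) \<and> fst (fst e) mod 2 = p})"
  have SD: "S \<subseteq> torus_D n" using S by (auto simp: torus_E_def torus_D_def)
  have finS: "finite S" using SD finite_torus_D by (rule finite_subset)
  have "S \<subseteq> (H 0 \<union> H 1) \<union> (V 0 \<union> V 1)"
  proof
    fix e assume e: "e \<in> S"
    obtain x y x' y' where [simp]: "e = ((x, y), (x', y'))" by (metis surj_pair)
    have "x = x' \<or> y = y'" using subsetD[OF SD e] by (auto simp: torus_D_iff)
    moreover have "x mod 2 = 0 \<or> x mod 2 = 1" "y mod 2 = 0 \<or> y mod 2 = 1" by presburger+
    ultimately show "e \<in> (H 0 \<union> H 1) \<union> (V 0 \<union> V 1)" using e by (auto simp: H_def V_def)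
  qed
  then have "card S \<le> card ((H 0 \<union> H 1) \<union> (V 0 \<union> V 1))"
    using finS by (intro card_mono) (auto simp: H_def V_def)
  also have "\<dots> \<le> (card (H 0) + card (H 1)) + (card (V 0) + card (V 1))"
    by (intro card_Un_le[THEN order_trans] add_mono card_Un_le)
  finally have cS: "card S \<le> (card (H 0) + card (H 1)) + (card (V 0) + card (V 1))" .
  have key: "prob (S \<union> S\<inverse>) \<le> \<delta> ^ card S"
    if CS: "C \<subseteq> S" and card: "card S \<le> 4 * card C" and p: "p = 0 \<or> p = 1"
      and b: "prob (C \<union> C\<inverse>) ^ (2 * n * (2 * n)) \<le> prob (column_edges n {x. x mod 2 = p}) ^ (2 * card C)" for C p
  proof -
    have "prob (C \<union> C\<inverse>) ^ (2 * n * (2 * n)) \<le> (\<kappa> ^ (n * n)) ^ (2 * card C)"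
      using b power_mono[OF columns[OF p] prob_nonneg, of "2 * card C"] by linarith
    also have "\<dots> \<le> ((\<delta> ^ 8) ^ (n * n)) ^ (2 * card C)"
      using kappa by (intro power_mono) auto
    also have "\<dots> = (\<delta> ^ (4 * card C)) ^ (2 * n * (2 * n))"
      by (simp add: power_mult[symmetric] mult_ac)
    finally have "prob (C \<union> C\<inverse>) \<le> \<delta> ^ (4 * card C)"
      using n delta by (subst (asm) power_mono_iff) (auto simp: prob_nonneg)
    also have "\<dots> \<le> \<delta> ^ card S" using card delta by (intro power_decreasing) auto
    finally have "prob (C \<union> C\<inverse>) \<le> \<delta> ^ card S" .
    moreover have "prob (S \<union> S\<inverse>) \<le> prob (C \<union> C\<inverse>)" using CS by (intro prob_antimono) auto
    ultimately show ?thesis by linarith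
  qed
  have H: "prob (H p \<union> (H p)\<inverse>) ^ (2 * n * (2 * n)) \<le> prob (column_edges n {x. x mod 2 = p}) ^ (2 * card (H p))" for p
    using S by (intro horizontal_bound) (auto simp: H_def)
  have V: "prob (V p \<union> (V p)\<inverse>) ^ (2 * n * (2 * n)) \<le> prob (column_edges n {x. x mod 2 = p}) ^ (2 * card (V p))" for p
    using S by (intro vertical_bound) (auto simp: V_def)
  have sub: "H p \<subseteq> S" "V p \<subseteq> S" for p by (auto simp: H_def V_def)
  consider "card S \<le> 4 * card (H 0)" | "card S \<le> 4 * card (H 1)" | "card S \<le> 4 * card (V 0)" | "card S \<le> 4 * card (V 1)"
    using cS by linarith
  then show ?thesis
    using key[OF sub(1) _ _ H, of 0] key[OF sub(1) _ _ H, of 1] key[OF sub(2) _ _ V, of 0] key[OF sub(2) _ _ V, of 1]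
    by cases auto
qed

section \<open>Boltzmann weights as products over oriented edges\<close>

lemma exp_neg_add: "a \<noteq> -\<infinity> \<Longrightarrow> b \<noteq> -\<infinity> \<Longrightarrow> exp_neg (a + b) = exp_neg a * exp_neg b"
  by (cases a; cases b) (auto simp: exp_neg_def ennreal_mult[symmetric] exp_add[symmetric])

lemma exp_neg_sum:
  assumes "finite E" "\<And>e. e \<in> E \<Longrightarrow> f e \<noteq> -\<infinity>"
  shows "exp_neg (sum f E) = (\<Prod>e\<in>E. exp_neg (f e))"
proof -
  have "sum f E \<noteq> -\<infinity> \<and> exp_neg (sum f E) = (\<Prod>e\<in>E. exp_neg (f e))"
    using assms by (induction E rule: finite_induct) (auto simp: exp_neg_add, simp add: exp_neg_def)
  then show ?thesis ..
qed

lemma exp_neg_measurable: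
  assumes [measurable]: "U \<in> borel_measurable M"
  shows "(\<lambda>x. exp_neg (U x)) \<in> borel_measurable M"
proof -
  have [measurable]: "{x \<in> space M. U x = a} \<in> sets M" for a
  proof -
    have "U -` {a} \<inter> space M \<in> sets M" by (rule measurable_sets[OF assms]) simp
    moreover have "U -` {a} \<inter> space M = {x \<in> space M. U x = a}" by auto
    ultimately show ?thesis by simp
  qed
  show ?thesis unfolding exp_neg_def by measurable
qed

lemma finite_torus_E: "finite (torus_E n)"
  by (rule finite_subset[OF _ finite_torus_D]) (auto simp: torus_E_def torus_D_def)

lemma torus_D_eq: "n \<ge> 1 \<Longrightarrow> torus_D n = torus_E n \<union> prod.swap ` torus_E n"
proof (rule set_eqI)
  fix e :: "(int \<times> int) \<times> int \<times> int"
  assume n: "n \<ge> 1"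
  obtain x y x' y' where e: "e = ((x, y), (x', y'))" by (metis surj_pair)
  have E: "((x, y), (x', y')) \<in> torus_E n \<longleftrightarrow> ((x, y), (x', y')) \<in> torus_D n \<and> (x < x' \<or> x = x' \<and> y < y')" for x y x' y'
    by (auto simp: torus_E_def torus_D_def)
  have sw: "e \<in> prod.swap ` torus_E n \<longleftrightarrow> ((x', y'), (x, y)) \<in> torus_E n"
    unfolding e by (force simp: image_iff)
  have "(x, y) \<noteq> (x', y')" if "((x, y), (x', y')) \<in> torus_D n" using that torus_noloop[OF n] by metis
  then show "e \<in> torus_D n \<longleftrightarrow> e \<in> torus_E n \<union> prod.swap ` torus_E n"
    using torus_D_sym unfolding Un_iff sw E unfolding e E by (auto dest: torus_D_sym)
qed

text \<open>The two orientations of an edge contribute its indicator twice, which is harmless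
  because indicators are idempotent.\<close>

lemma gibbs_weight_eq:
  assumes n: "n \<ge> 1" and S: "S \<subseteq> torus_E n"
    and q: "\<And>x. q x * q x = exp_neg (U x)" and even: "\<And>x. q (- x) = q x" and U: "\<And>x. U x \<noteq> -\<infinity>"
  shows "exp_neg (hamiltonian n U \<phi>) * indicator {\<phi>. \<forall>(v, w)\<in>S. \<bar>\<phi> v - \<phi> w\<bar> \<ge> L} \<phi>
    = edge_prod (torus_D n) (tilt q L (S \<union> S\<inverse>)) \<phi>"
proof -
  let ?E = "torus_E n"
  let ?d = "\<lambda>e. \<phi> (fst e) - \<phi> (snd e)"
  let ?i = "\<lambda>e. if e \<in> S then indicator {x. L \<le> \<bar>x\<bar>} (?d e) else 1 :: ennreal"
  let ?f = "\<lambda>e. tilt q L (S \<union> S\<inverse>) e (?d e)"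
  have asym: "(v, w) \<in> ?E \<Longrightarrow> (w, v) \<notin> ?E" for v w by (auto simp: torus_E_def)
  have disj: "?E \<inter> prod.swap ` ?E = {}" using asym by auto
  have "edge_prod (torus_D n) (tilt q L (S \<union> S\<inverse>)) \<phi> = prod ?f ?E * prod ?f (prod.swap ` ?E)"
    unfolding edge_prod_def torus_D_eq[OF n] using finite_torus_E disj by (intro prod.union_disjoint) auto
  also have "prod ?f (prod.swap ` ?E) = (\<Prod>e\<in>?E. ?f (prod.swap e))"
    by (subst prod.reindex) (auto simp: inj_on_def)
  also have "prod ?f ?E * (\<Prod>e\<in>?E. ?f (prod.swap e)) = (\<Prod>e\<in>?E. ?f e * ?f (prod.swap e))"
    by (simp add: prod.distrib)
  also have "\<dots> = (\<Prod>e\<in>?E. exp_neg (U (?d e)) * ?i e)"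
  proof (rule prod.cong)
    fix e assume e: "e \<in> ?E"
    obtain v w where vw: "e = (v, w)" by (cases e)
    have "(v, w) \<in> S \<union> S\<inverse> \<longleftrightarrow> (v, w) \<in> S" "(w, v) \<in> S \<union> S\<inverse> \<longleftrightarrow> (v, w) \<in> S"
      using asym e S unfolding vw by blast+
    then show "?f e * ?f (prod.swap e) = exp_neg (U (?d e)) * ?i e"
      using q[of "\<phi> v - \<phi> w"] even[of "\<phi> v - \<phi> w"]
      by (auto simp: vw tilt_def indicator_def abs_minus_commute)
  qed simp
  also have "\<dots> = (\<Prod>e\<in>?E. exp_neg (U (?d e))) * (\<Prod>e\<in>?E. ?i e)" by (rule prod.distrib)
  also have "(\<Prod>e\<in>?E. exp_neg (U (?d e))) = exp_neg (hamiltonian n U \<phi>)"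
    unfolding hamiltonian_def using U
    by (subst exp_neg_sum[OF finite_torus_E]) (auto simp: case_prod_beta)
  also have "(\<Prod>e\<in>?E. ?i e) = (\<Prod>e\<in>S. indicator {x. L \<le> \<bar>x\<bar>} (?d e))"
    using S finite_torus_E by (subst prod.inter_restrict[symmetric, OF finite_torus_E]) (simp add: Int_absorb1)
  also have "\<dots> = indicator {\<phi>. \<forall>(v, w)\<in>S. \<bar>\<phi> v - \<phi> w\<bar> \<ge> L} \<phi>"
  proof (cases "\<forall>(v, w)\<in>S. \<bar>\<phi> v - \<phi> w\<bar> \<ge> L")
    case True
    then show ?thesis by (auto simp: case_prod_beta intro!: prod.neutral)
  next
    case False
    then obtain e where "e \<in> S" "\<not> L \<le> \<bar>?d e\<bar>" by (auto simp: case_prod_beta)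
    then have "(\<Prod>e\<in>S. indicator {x. L \<le> \<bar>x\<bar>} (?d e)) = (0 :: ennreal)"
      using finite_subset[OF S finite_torus_E] by (intro prod_zero bexI[of _ e]) auto
    moreover have "indicator {\<phi>. \<forall>(v, w)\<in>S. \<bar>\<phi> v - \<phi> w\<bar> \<ge> L} \<phi> = (0 :: ennreal)"
      using False by (simp add: indicator_def)
    ultimately show ?thesis by (simp only:)
  qed
  finally show ?thesis by (rule sym)
qed

lemma gibbs_prob_eq:
  assumes n: "n \<ge> 1" and S: "S \<subseteq> torus_E n" and qm: "q \<in> borel_measurable borel"
    and q: "\<And>x. q x * q x = exp_neg (U x)" and even: "\<And>x. q (- x) = q x" and U: "\<And>x. U x \<noteq> -\<infinity>"
  shows "partition_fn n U = torus_mass n q L {}"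
    and "gibbs_prob n U {\<phi>. \<forall>(v, w)\<in>S. \<bar>\<phi> v - \<phi> w\<bar> \<ge> L} = torus_mass n q L (S \<union> S\<inverse>) / torus_mass n q L {}"
proof -
  have *: "(\<integral>\<^sup>+ \<phi>. exp_neg (hamiltonian n U \<phi>) * indicator {\<phi>. \<forall>(v, w)\<in>T. \<bar>\<phi> v - \<phi> w\<bar> \<ge> L} \<phi> \<partial>ref_measure n)
      = torus_mass n q L (T \<union> T\<inverse>)" if "T \<subseteq> torus_E n" for T
    unfolding gibbs_weight_eq[where q = q and U = U, OF n that q even U] ref_measure_def torus_mass_def
    by (intro nn_integral_pinned_ref finite_torus_V torus_D_subset tilt_measurable qm origin_in_torus n)
  show Z: "partition_fn n U = torus_mass n q L {}"
    using *[of "{}"] by (simp add: partition_fn_def)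
  show "gibbs_prob n U {\<phi>. \<forall>(v, w)\<in>S. \<bar>\<phi> v - \<phi> w\<bar> \<ge> L} = torus_mass n q L (S \<union> S\<inverse>) / torus_mass n q L {}"
    unfolding gibbs_prob_def Z *[OF S] ..
qed

text \<open>Continuity from above of the finite measure with density \<open>w\<close>. It supplies
  both \<open>\<epsilon>\<close> for the lower bound and the threshold \<open>L\<close>.\<close>

lemma nn_integral_decseq_small:
  fixes w :: "'a \<Rightarrow> ennreal" and A :: "nat \<Rightarrow> 'a set" and \<tau> :: real
  assumes w: "w \<in> borel_measurable M" and fin: "(\<integral>\<^sup>+ x. w x \<partial>M) < \<infinity>"
    and A: "decseq A" "\<And>k. A k \<in> sets M"
    and null: "(\<integral>\<^sup>+ x. w x * indicator (\<Inter>k. A k) x \<partial>M) = 0" and tau: "0 < \<tau>"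
  shows "\<exists>k. (\<integral>\<^sup>+ x. w x * indicator (A k) x \<partial>M) \<le> ennreal \<tau>"
proof -
  let ?D = "density M w"
  have em: "emeasure ?D X = (\<integral>\<^sup>+ x. w x * indicator X x \<partial>M)" if "X \<in> sets M" for X
    by (rule emeasure_density[OF w that])
  have fin': "emeasure ?D X \<noteq> \<infinity>" for X
  proof -
    have "emeasure ?D X \<le> emeasure ?D (space M)" using emeasure_space[of ?D X] by simp
    also have "\<dots> \<le> (\<integral>\<^sup>+ x. w x \<partial>M)"
      by (subst em) (auto intro!: nn_integral_mono simp: indicator_def)
    finally show ?thesis using fin by (auto simp: top_unique)
  qed
  have "(\<lambda>k. emeasure ?D (A k)) \<longlonglongrightarrow> emeasure ?D (\<Inter>k. A k)"
    using A fin' by (intro Lim_emeasure_decseq) auto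
  moreover have "emeasure ?D (\<Inter>k. A k) = 0" using A null by (subst em) auto
  ultimately have "(\<lambda>k. emeasure ?D (A k)) \<longlonglongrightarrow> 0" by simp
  then have "eventually (\<lambda>k. emeasure ?D (A k) < ennreal \<tau>) sequentially"
    using tau by (intro order_tendstoD(2)) auto
  then obtain k where "emeasure ?D (A k) < ennreal \<tau>" by (auto simp: eventually_sequentially)
  then show ?thesis using em[OF A(2)] by (intro exI[of _ k]) auto
qed

text \<open>No constant depends on \<open>n\<close>: the column mass and the partition function are
  compared with constants to the power \<open>n * n\<close>, and \<open>small\<close> bounds the
  quotient of these constants by \<open>\<delta> ^ 8\<close>. Hence one \<open>L\<close> serves all
  tori.\<close>

lemma controlled_gradientsI:
  fixes a \<epsilon> Q I \<tau> \<delta> L :: real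
  assumes n: "n \<ge> 1" and qm: "q \<in> borel_measurable borel"
    and qU: "\<And>x. q x * q x = exp_neg (U x)" and even: "\<And>x. q (- x) = q x" and U: "\<And>x. U x \<noteq> -\<infinity>"
    and K: "\<exists>K>L. \<forall>x. \<bar>x\<bar> < K \<longrightarrow> U x < \<infinity>"
    and a: "0 < a" "a \<le> 1" and eps: "0 < \<epsilon>" "\<epsilon> \<le> 1"
    and bad: "emeasure lborel {x\<in>{-a..a}. q x < ennreal \<epsilon>} \<le> ennreal (a / 16)"
    and Q: "1 \<le> Q" "\<And>x. q x \<le> ennreal Q"
    and I: "1 \<le> I" "(\<integral>\<^sup>+ x. exp_neg (U x) \<partial>lborel) \<le> ennreal I"
    and \<tau>: "0 \<le> \<tau>" "\<tau> \<le> 1" "(\<integral>\<^sup>+ x. exp_neg (U x) * indicator {x. L \<le> \<bar>x\<bar>} x \<partial>lborel) \<le> ennreal \<tau>"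
    and delta: "0 < \<delta>" "\<delta> < 1"
    and small: "Q ^ 16 * I ^ 4 * \<tau> \<le> \<delta> ^ 8 * (\<epsilon> ^ 16 * (a / 2) ^ 4)"
  shows "controlled_gradients \<delta> L n U"
proof -
  define z where "z = \<epsilon> ^ 16 * (a / 2) ^ 4"
  have z: "0 < z" using eps a by (simp add: z_def)
  have lower: "ennreal (z ^ (n * n)) \<le> torus_mass n q L {}"
    unfolding z_def using eps by (intro torus_mass_lower n a qm bad) auto
  note upper = torus_mass_columns_upper[OF n qm even Q I(1) _ \<tau>(1,2), unfolded qU, OF I(2) \<tau>(3)]
  have pos: "0 < torus_mass n q L {}"
  proof -
    have "0 < ennreal (z ^ (n * n))" using z by simp
    then show ?thesis using lower by (rule less_le_trans)
  qed
  interpret torus_weights n q L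
    using n qm pos upper(2)[of 0] by unfold_locales auto
  have Z: "z ^ (n * n) \<le> enn2real (mass {})"
    using enn2real_mono[OF lower mass_less_top] z by simp
  define \<kappa> where "\<kappa> = Q ^ 16 * I ^ 4 * \<tau> / z"
  have kappa: "0 \<le> \<kappa>" "\<kappa> \<le> \<delta> ^ 8"
    using Q I \<tau> z small by (auto simp: \<kappa>_def z_def[symmetric] divide_le_eq)
  have columns: "prob (column_edges n {x. x mod 2 = p}) \<le> \<kappa> ^ (n * n)" if p: "p = 0 \<or> p = 1" for p
  proof -
    have nn: "0 \<le> (Q ^ 16 * I ^ 4 * \<tau>) ^ (n * n)" using Q I \<tau> by simp
    have "enn2real (mass (column_edges n {x. x mod 2 = p})) \<le> (Q ^ 16 * I ^ 4 * \<tau>) ^ (n * n)"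
      using enn2real_mono[OF upper(1)[OF p] ennreal_less_top] nn by simp
    then have "prob (column_edges n {x. x mod 2 = p}) \<le> (Q ^ 16 * I ^ 4 * \<tau>) ^ (n * n) / z ^ (n * n)"
      unfolding torus_prob_def using Z z nn by (intro frac_le) auto
    then show ?thesis by (simp add: \<kappa>_def power_divide)
  qed
  have "gibbs_prob n U {\<phi>. \<forall>(v, w)\<in>S. \<bar>\<phi> v - \<phi> w\<bar> \<ge> L} \<le> ennreal (\<delta> ^ card S)" if S: "S \<subseteq> torus_E n" for S
  proof -
    have "gibbs_prob n U {\<phi>. \<forall>(v, w)\<in>S. \<bar>\<phi> v - \<phi> w\<bar> \<ge> L} = mass (S \<union> S\<inverse>) / mass {}"
      by (rule gibbs_prob_eq(2)[where q = q and U = U, OF n S qm qU even U])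
    also have "\<dots> = ennreal (enn2real (mass (S \<union> S\<inverse>))) / ennreal (enn2real (mass {}))"
      using mass_less_top by simp
    also have "\<dots> = ennreal (prob (S \<union> S\<inverse>))"
      unfolding torus_prob_def using Z_pos by (intro divide_ennreal) auto
    also have "\<dots> \<le> ennreal (\<delta> ^ card S)"
      by (intro ennreal_leI prob_edges_le[OF kappa delta columns S])
    finally show ?thesis .
  qed
  moreover have "partition_fn n U = mass {}"
    by (rule gibbs_prob_eq(1)[where q = q and U = U and S = "{}", OF n _ qm qU even U]) simp
  ultimately show ?thesis
    unfolding controlled_gradients_def using K mass_pos mass_finite by auto
qed

theorem theorem3p2:
  fixes U :: "real \<Rightarrow> ereal"
  assumes meas: "U \<in> borel_measurable borel"
    and sym: "\<And>x. U x = U (- x)"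
    and bdd_below: "\<exists>c::real. \<forall>x. ereal c \<le> U x"
    and int_pos: "0 < (\<integral>\<^sup>+ x. exp_neg (U x) \<partial>lborel)"
    and int_fin: "(\<integral>\<^sup>+ x. exp_neg (U x) \<partial>lborel) < \<infinity>"
    and finite_or_hardcore:
      "(\<forall>x. U x < \<infinity>) \<or>
       (\<exists>K::real. 0 < K \<and> (\<forall>x. \<bar>x\<bar> < K \<longrightarrow> U x < \<infinity>) \<and> (\<forall>x. \<bar>x\<bar> > K \<longrightarrow> U x = \<infinity>))"
  shows "\<forall>\<delta>::real. 0 < \<delta> \<and> \<delta> < 1 \<longrightarrow>
           (\<exists>L::real. 0 < L \<and> (\<forall>n::nat. n \<ge> 1 \<longrightarrow> controlled_gradients \<delta> L n U))"
proof (intro allI impI)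
  fix \<delta> :: real assume delta: "0 < \<delta> \<and> \<delta> < 1"
  obtain c :: real where c: "\<And>x. ereal c \<le> U x" using bdd_below by blast
  have U: "U x \<noteq> -\<infinity>" for x using c[of x] by auto
  define w where "w = (\<lambda>x. exp_neg (U x))"
  have w[measurable]: "w \<in> borel_measurable borel"
    unfolding w_def by (rule exp_neg_measurable[OF meas])
  have w_le: "w x \<le> ennreal (exp (- c))" for x
    using c[of x] by (cases "U x") (auto simp: w_def exp_neg_def intro!: ennreal_leI)
  \<comment> \<open>The lower bound on \<open>U\<close> makes \<open>w\<close> finite, so the
    passage through the reals loses nothing and \<open>q\<close> is a true square root of
    \<open>w\<close>.\<close>
  define q where "q = (\<lambda>x. ennreal (sqrt (enn2real (w x))))"
  have qm[measurable]: "q \<in> borel_measurable borel" unfolding q_def by measurable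
  have q: "q x * q x = exp_neg (U x)" for x
  proof -
    have "q x * q x = ennreal (enn2real (w x))" by (simp add: q_def ennreal_mult[symmetric])
    also have "\<dots> = w x" using le_less_trans[OF w_le ennreal_less_top, of x] by simp
    finally show ?thesis by (simp add: w_def)
  qed
  have even: "q (- x) = q x" for x using sym[of x] by (simp add: q_def w_def)
  \<comment> \<open>\<open>Q\<close> and later \<open>I\<close> are at least \<open>1\<close>, so
    that edge counts in exponents may be replaced by upper bounds.\<close>
  define Q where "Q = max 1 (sqrt (exp (- c)))"
  have Q: "1 \<le> Q" "q x \<le> ennreal Q" for x
  proof -
    have "enn2real (w x) \<le> exp (- c)" using enn2real_mono[OF w_le ennreal_less_top, of x] by simp
    then show "q x \<le> ennreal Q" unfolding q_def Q_def by (intro ennreal_leI) (simp add: le_max_iff_disj)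
  qed (simp add: Q_def)
  define I where "I = max 1 (enn2real (\<integral>\<^sup>+ x. w x \<partial>lborel))"
  have w_fin: "(\<integral>\<^sup>+ x. w x \<partial>lborel) < \<infinity>" using int_fin by (simp add: w_def)
  have I: "1 \<le> I" "(\<integral>\<^sup>+ x. w x \<partial>lborel) \<le> ennreal I"
  proof -
    have "(\<integral>\<^sup>+ x. w x \<partial>lborel) = ennreal (enn2real (\<integral>\<^sup>+ x. w x \<partial>lborel))" using w_fin by simp
    also have "\<dots> \<le> ennreal I" unfolding I_def by (intro ennreal_leI) simp
    finally show "(\<integral>\<^sup>+ x. w x \<partial>lborel) \<le> ennreal I" .
  qed (simp add: I_def)
  \<comment> \<open>Thresholds increasing to the edge of the region where \<open>U\<close> is finite.\<close>
  obtain l :: "nat \<Rightarrow> real" where l: "incseq l" "\<And>k. 0 < l k"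
    "\<And>k. \<exists>K>l k. \<forall>x. \<bar>x\<bar> < K \<longrightarrow> U x < \<infinity>" "AE x in lborel. w x * indicator (\<Inter>k. {x. l k \<le> \<bar>x\<bar>}) x = 0"
  proof (cases "\<forall>x. U x < \<infinity>")
    case True
    show thesis
    proof (rule that[of "\<lambda>k. real k + 1"])
      have "x \<notin> (\<Inter>k. {x. real k + 1 \<le> \<bar>x\<bar>})" for x :: real
      proof -
        obtain k :: nat where "\<bar>x\<bar> < real k" using reals_Archimedean2 by blast
        then have "\<not> real k + 1 \<le> \<bar>x\<bar>" by simp
        then show ?thesis by blast
      qed
      then show "AE x in lborel. w x * indicator (\<Inter>k. {x. real k + 1 \<le> \<bar>x\<bar>}) x = 0" by auto
      show "\<exists>K>real k + 1. \<forall>x. \<bar>x\<bar> < K \<longrightarrow> U x < \<infinity>" for k using True by (intro exI[of _ "real k + 2"]) auto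
    qed (auto simp: incseq_def)
  next
    case False
    then obtain K :: real where K: "0 < K" "\<And>x. \<bar>x\<bar> < K \<Longrightarrow> U x < \<infinity>" "\<And>x. \<bar>x\<bar> > K \<Longrightarrow> U x = \<infinity>"
      using finite_or_hardcore by blast
    \<comment> \<open>The shift by \<open>2\<close> makes \<open>l 0 = K / 2\<close> positive. All
      thresholds stay strictly below \<open>K\<close>, as controlled gradients require finiteness of
      \<open>U\<close> beyond \<open>L\<close>.\<close>
    define l where "l = (\<lambda>k :: nat. K * (1 - 1 / (real k + 2)))"
    have l_less: "l k < K" for k using K(1) by (simp add: l_def algebra_simps)
    have lim: "l \<longlonglongrightarrow> K"
    proof -
      have "(\<lambda>k. 1 / real (k + 2)) \<longlonglongrightarrow> 0"
        by (rule LIMSEQ_ignore_initial_segment[OF lim_1_over_n])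
      then have "(\<lambda>k. K * (1 - 1 / real (k + 2))) \<longlonglongrightarrow> K * (1 - 0)"
        by (intro tendsto_intros)
      then show ?thesis by (simp add: l_def add.commute)
    qed
    show thesis
    proof (rule that[of l])
      show "incseq l" using K(1) by (auto simp: incseq_def l_def intro!: mult_left_mono divide_left_mono)
      show "0 < l k" for k using K(1) by (simp add: l_def)
      show "\<exists>K>l k. \<forall>x. \<bar>x\<bar> < K \<longrightarrow> U x < \<infinity>" for k using l_less K(2) by blast
      \<comment> \<open>In the limit only \<open>\<bar>x\<bar> \<ge> K\<close> remains, where the
        weight vanishes except possibly at the null set of the two end points.\<close>
      have "AE x in lborel. x \<notin> {K, - K}"
        by (intro AE_not_in finite_imp_null_set_lborel) auto
      then show "AE x in lborel. w x * indicator (\<Inter>k. {x. l k \<le> \<bar>x\<bar>}) x = 0"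
      proof eventually_elim
        case (elim x)
        show ?case
        proof (cases "\<forall>k. l k \<le> \<bar>x\<bar>")
          case True
          then have "K \<le> \<bar>x\<bar>" using lim by (intro LIMSEQ_le_const2[OF lim]) auto
          then have "w x = 0" using elim K(3)[of x] by (auto simp: w_def exp_neg_def abs_if split: if_splits)
          then show ?thesis by simp
        qed auto
      qed
    qed
  qed
  \<comment> \<open>Differences of heights in \<open>{0..a}\<close> must stay where \<open>U\<close>
    is finite; \<open>l 0\<close> lies strictly inside that region.\<close>
  define a where "a = min 1 (l 0)"
  have a: "0 < a" "a \<le> 1" using l(2)[of 0] by (auto simp: a_def)
  have q_pos: "0 < q x" if "\<bar>x\<bar> \<le> a" for x
  proof -
    obtain K where K: "K > l 0" "\<And>x. \<bar>x\<bar> < K \<Longrightarrow> U x < \<infinity>" using l(3)[of 0] by blast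
    have "U x \<noteq> \<infinity>" using that K(1) K(2)[of x] by (auto simp: a_def)
    then have "0 < w x" using U[of x] by (simp add: w_def exp_neg_def)
    then show ?thesis using q[of x] by (auto simp: w_def zero_less_iff_neq_zero)
  qed
  obtain \<epsilon> :: real where eps: "0 < \<epsilon>" "\<epsilon> \<le> 1"
    and bad: "emeasure lborel {x\<in>{-a..a}. q x < ennreal \<epsilon>} \<le> ennreal (a / 16)"
  proof -
    \<comment> \<open>Since \<open>q\<close> is positive on \<open>{-a..a}\<close>, these sets
      decrease to the empty set.\<close>
    let ?A = "\<lambda>k :: nat. {x\<in>{-a..a}. q x < ennreal (1 / (real k + 1))}"
    have A: "?A k \<in> sets borel" for k by measurable
    have "\<exists>k. (\<integral>\<^sup>+ x. indicator {-a..a} x * indicator (?A k) x \<partial>lborel) \<le> ennreal (a / 16)"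
    proof (rule nn_integral_decseq_small)
      show "(\<integral>\<^sup>+ x. indicator {- a..a} x \<partial>lborel) < \<infinity>" using a by simp
      show "decseq ?A"
      proof (rule decseq_SucI, rule subsetI)
        fix k x assume "x \<in> ?A (Suc k)"
        moreover have "ennreal (1 / (real (Suc k) + 1)) \<le> ennreal (1 / (real k + 1))"
          by (intro ennreal_leI divide_left_mono) auto
        ultimately show "x \<in> ?A k" by (auto intro: less_le_trans)
      qed
      have "x \<notin> (\<Inter>k. ?A k)" for x
      proof
        assume x: "x \<in> (\<Inter>k. ?A k)"
        then have "0 < q x" by (intro q_pos) auto
        then have "0 < enn2real (q x)" using le_less_trans[OF Q(2) ennreal_less_top, of x]
          by (simp add: enn2real_positive_iff)
        then obtain k :: nat where k: "1 / (real k + 1) < enn2real (q x)"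
          by (metis nat_approx_posE of_nat_Suc add.commute)
        have "ennreal (1 / (real k + 1)) \<le> ennreal (enn2real (q x))" using k by (intro ennreal_leI) simp
        also have "\<dots> = q x" using le_less_trans[OF Q(2) ennreal_less_top, of x] by simp
        finally show False using x by (auto simp: not_less[symmetric])
      qed
      then have "(\<Inter>k. ?A k) = {}" by blast
      then show "(\<integral>\<^sup>+ x. indicator {- a..a} x * indicator (\<Inter>k. ?A k) x \<partial>lborel) = 0" by simp
    qed (use a A in auto)
    then obtain k where k: "(\<integral>\<^sup>+ x. indicator {-a..a} x * indicator (?A k) x \<partial>lborel) \<le> ennreal (a / 16)" ..
    have "indicator {-a..a} x * indicator (?A k) x = (indicator (?A k) x :: ennreal)" for x
      by (auto simp: indicator_def)
    then have "emeasure lborel (?A k) \<le> ennreal (a / 16)" using k A[of k] by simp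
    then show thesis by (intro that[of "1 / (real k + 1)"]) auto
  qed
  \<comment> \<open>The second entry is the value at which \<open>small\<close> becomes an
    equality.\<close>
  define \<tau> where "\<tau> = min 1 (\<delta> ^ 8 * (\<epsilon> ^ 16 * (a / 2) ^ 4) / (Q ^ 16 * I ^ 4))"
  have QI: "0 < Q ^ 16 * I ^ 4" using Q(1) I(1) by simp
  have tau: "0 < \<tau>" "\<tau> \<le> 1" using QI delta eps a by (auto simp: \<tau>_def)
  have small: "Q ^ 16 * I ^ 4 * \<tau> \<le> \<delta> ^ 8 * (\<epsilon> ^ 16 * (a / 2) ^ 4)"
  proof -
    have "\<tau> \<le> \<delta> ^ 8 * (\<epsilon> ^ 16 * (a / 2) ^ 4) / (Q ^ 16 * I ^ 4)" by (simp add: \<tau>_def)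
    then show ?thesis using QI by (simp add: pos_le_divide_eq mult.commute)
  qed
  \<comment> \<open>The threshold is chosen last, from \<open>\<tau>\<close>, which depends only on
    \<open>\<delta>\<close> and on constants attached to \<open>U\<close>.\<close>
  have "\<exists>k. (\<integral>\<^sup>+ x. w x * indicator {x. l k \<le> \<bar>x\<bar>} x \<partial>lborel) \<le> ennreal \<tau>"
  proof (rule nn_integral_decseq_small)
    show "decseq (\<lambda>k. {x. l k \<le> \<bar>x\<bar>})" using incseqD[OF l(1)] by (fastforce simp: decseq_def)
    show "(\<integral>\<^sup>+ x. w x * indicator (\<Inter>k. {x. l k \<le> \<bar>x\<bar>}) x \<partial>lborel) = 0"
      using l(4) by (subst nn_integral_cong_AE[where v = "\<lambda>_. 0"]) auto
  qed (use w_fin tau in auto)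
  then obtain k where k: "(\<integral>\<^sup>+ x. w x * indicator {x. l k \<le> \<bar>x\<bar>} x \<partial>lborel) \<le> ennreal \<tau>" ..
  have "controlled_gradients \<delta> (l k) n U" if n: "n \<ge> 1" for n
    using delta tau
    by (intro controlled_gradientsI[OF n qm q even U l(3) a eps bad Q I[unfolded w_def] _ _ k[unfolded w_def] _ _ small]) auto
  then show "\<exists>L>0. \<forall>n\<ge>1. controlled_gradients \<delta> L n U" using l(2)[of k] by blast
qed

end
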